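(* Let $\lambda\in\mathbb{C}\setminus\mathbb{R}$. Suppose that the definiteness condition $\mathcal{L}_0=\{0\}$ holds, that $n_+=n_-$, and that $\lambda\notin\Lambda$. Then the following dichotomy holds. (1) $D(b,\lambda)$ has positive radius if and only if $\|\psi(\cdot,\lambda)\|<\infty$. In this case all solutions of $Ju'+qu=\lambda wu$ are in $\mathcal{L}^2(w)$, i.e. $n_\pm=2$. (2) $D(b,\lambda)$ is a singleton, say $\{m_0\}$, if and only if $\|\psi(\cdot,\lambda)\|=\infty$. In this case $\chi_{m_0}(\cdot,\lambda)\in\mathcal{L}^2(w)$ and $n_\pm=1$.
   Context: Let $0<b\le\infty$ and $J=\begin{pmatrix}0&-1\\ 1&0\end{pmatrix}$. Let $q,w$ be $2\times2$ matrices whose entries are distributions of order $0$ on $(0,b)$, equivalently local complex measures on $(0,b)$ (complex measures when restricted to compact subsets of $(0,b)$). Here $q$ is Hermitian ($q=q^*$; off-diagonal entries may be non-real), and $w$ is non-negative (a matrix-valued measure with $w(E)\ge0$ as a Hermitian matrix) and not identically $0$. The endpoint $0$ is regular: $q$ and $w$ are finite measures on $(0,c)$ for each $c\in(0,b)$. For a function $u$ of locally bounded variation put $u^\pm(x)$ for its right/left limits; $u$ is balanced if $u=\frac12(u^-+u^+)$. A solution of $Ju'+qu=\lambda wu$ is a balanced function $u:(0,b)\to\mathbb{C}^2$ of locally bounded variation satisfying the equation as an identity of local measures, and $u(0)=\lim_{x\downarrow0}u(x)$. Let $\Delta_q(x)=q(\{x\})$, $\Delta_w(x)=w(\{x\})$,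 $B_\pm(x,\lambda)=J\pm\frac12(\Delta_q(x)-\lambda\Delta_w(x))$, and $\Lambda=\{\lambda\in\mathbb{C}:\exists x\in(0,b):\det B_+(x,\lambda)\det B_-(x,\lambda)=0\}$; it is assumed throughout that $\Lambda\ne\mathbb{C}$. For $\lambda\notin\Lambda$ initial value problems with data posed at $0$ have unique balanced solutions on $(0,b)$. A point of continuity is an $x\in(0,b)$ with $\Delta_q(x)=\Delta_w(x)=0$. Let $\|u\|_c^2=\int_{(0,c)}u^*wu$ and $\|u\|^2=\int_{(0,b)}u^*wu\in[0,\infty]$; $\mathcal{L}^2(w)$ is the space of functions with $\|u\|<\infty$. $\mathcal{L}_0$ is the space of solutions of $Ju'+qu=0$ with norm $0$ (these solve $Ju'+qu=\lambda wu$ for every $\lambda$). The deficiency index $n_+$ (resp. $n_-$) is the number of linearly independent solutions of $Ju'+qu=\lambda wu$ of positive finite norm, i.e. the dimension of the space of solutions in $\mathcal{L}^2(w)$ modulo $\mathcal{L}_0$, for $\lambda$ in the upper (resp. lower) half-plane; it is known not to depend on the choice of $\lambda$ in that half-plane. A statement about $n_\pm$ means both $n_+$ and $n_-$. Fix $\alpha\in[0,\pi)$. For $\lambda\notin\Lambda$ let $U(\cdot,\lambda)$ be the fundamental matrix of $Ju'+qu=\lambda wu$ with $U(0,\lambda)=\begin{pmatrix}\cos\alpha&-\sin\alpha\\ \sin\alpha&\cos\alpha\end{pmatrix}$, with first and second columns $\varphi(\cdot,\lambda)$ and $\psi(\cdot,\lambda)$, and let $\chi_m(\cdot,\lambda)=\varphi(\cdot,\lambda)+m\psi(\cdot,\lambda)$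 for $m\in\mathbb{C}$. Weyl disks: let $\lambda\in\mathbb{C}\setminus\mathbb{R}$, $\lambda\notin\Lambda$, and let $c\in(0,b)$ be a point of continuity. Write $U(c,\lambda)=\begin{pmatrix}A&C\\ B&D\end{pmatrix}$. If $\|\psi(\cdot,\lambda)\|_c>0$ (equivalently $C\overline D-\overline CD\ne0$), put $\tilde m=\frac{B\overline C-A\overline D}{C\overline D-\overline CD}$, $r(c,\lambda)=\left|\frac{AD-BC}{C\overline D-\overline CD}\right|$ and $D(c,\lambda)=\{m\in\mathbb{C}:|m-\tilde m|\le r(c,\lambda)\}$. These closed disks are nested decreasing in $c$. If $\|\psi(\cdot,\lambda)\|_c$ is eventually positive as $c\to b$ (which is the case under the definiteness condition), $D(b,\lambda)$ denotes the intersection of all these disks, which is a closed disk of radius $r(b,\lambda)=\lim_{c\to b}r(c,\lambda)>0$ or a singleton. *)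

theory Defs
  imports "HOL-Analysis.Analysis"
begin

section \<open>Local measures\<close>

text \<open>
  A local (complex, vector or matrix valued) measure on \<open>(0,b)\<close> is a set function on the ring of
  Borel sets contained in some compact \<open>[a,c]\<close> inside \<open>(0,b)\<close>; its values on other sets are
  irrelevant. The endpoint \<open>b\<close> is extended real, so that \<open>b = \<infinity>\<close> is allowed.
\<close>

definition local_sets :: "ereal \<Rightarrow> real set set" where
  "local_sets b = {E \<in> sets borel. \<exists>a c. 0 < a \<and> ereal c < b \<and> E \<subseteq> {a..c}}"

definition local_measure :: "ereal \<Rightarrow> (real set \<Rightarrow> 'a::euclidean_space) \<Rightarrow> bool" where
  "local_measure b \<mu> \<longleftrightarrow>
     (\<forall>A :: nat \<Rightarrow> real set. range A \<subseteq> local_sets b \<longrightarrow> disjoint_family A \<longrightarrow>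
        (\<Union>n. A n) \<in> local_sets b \<longrightarrow> (\<lambda>n. \<mu> (A n)) sums \<mu> (\<Union>n. A n))"

text \<open>
  Total variation \<open>|\<mu>|\<close>, as a positive Borel measure on the line carried by \<open>(0,b)\<close>, and the
  polar density \<open>h\<close> with \<open>d\<mu> = h d|\<mu>|\<close> (determined up to \<open>|\<mu>|\<close>-null sets).
\<close>

definition total_variation :: "ereal \<Rightarrow> (real set \<Rightarrow> 'a::euclidean_space) \<Rightarrow> real measure" where
  "total_variation b \<mu> = measure_of UNIV (sets borel)
     (\<lambda>E. SUP P \<in> {P. finite P \<and> disjoint P \<and> P \<subseteq> local_sets b \<and> \<Union>P \<subseteq> E}.
            \<Sum>F\<in>P. ennreal (norm (\<mu> F)))"

definition polar_density :: "ereal \<Rightarrow> (real set \<Rightarrow> 'a::euclidean_space) \<Rightarrow> real \<Rightarrow> 'a" where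
  "polar_density b \<mu> = (SOME h. h \<in> borel_measurable borel \<and>
     (\<forall>E \<in> local_sets b. set_integrable (total_variation b \<mu>) E h \<and>
        \<mu> E = (LINT x:E|total_variation b \<mu>. h x)))"

definition finite_near_0 :: "ereal \<Rightarrow> (real set \<Rightarrow> 'a::euclidean_space) \<Rightarrow> bool" where
  "finite_near_0 b \<mu> \<longleftrightarrow>
     (\<forall>c. 0 < c \<and> ereal c < b \<longrightarrow> emeasure (total_variation b \<mu>) {0<..<c} < \<infinity>)"

text \<open>The local vector measure \<open>\<mu> u\<close>, for a matrix measure \<open>\<mu>\<close> and a vector function \<open>u\<close>.\<close>

definition apply_measure ::
  "ereal \<Rightarrow> (real set \<Rightarrow> complex^2^2) \<Rightarrow> (real \<Rightarrow> complex^2) \<Rightarrow> real set \<Rightarrow> complex^2" where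
  "apply_measure b \<mu> u E = (LINT x:E|total_variation b \<mu>. polar_density b \<mu> x *v u x)"


section \<open>Hermitian and non-negative matrix measures\<close>

definition conj_transpose :: "complex^2^2 \<Rightarrow> complex^2^2" where
  "conj_transpose A = (\<chi> i j. cnj (A $ j $ i))"

definition quad_form :: "complex^2^2 \<Rightarrow> complex^2 \<Rightarrow> complex" where
  "quad_form A v = (\<Sum>i\<in>UNIV. \<Sum>j\<in>UNIV. cnj (v $ i) * A $ i $ j * v $ j)"

definition hermitian_measure :: "ereal \<Rightarrow> (real set \<Rightarrow> complex^2^2) \<Rightarrow> bool" where
  "hermitian_measure b \<mu> \<longleftrightarrow> (\<forall>E \<in> local_sets b. conj_transpose (\<mu> E) = \<mu> E)"

definition nonneg_measure :: "ereal \<Rightarrow> (real set \<Rightarrow> complex^2^2) \<Rightarrow> bool" where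
  "nonneg_measure b \<mu> \<longleftrightarrow> hermitian_measure b \<mu> \<and>
     (\<forall>E \<in> local_sets b. \<forall>v. 0 \<le> Re (quad_form (\<mu> E) v))"

text \<open>
  The extended real number \<open>\<integral>\<^sub>X u\<^sup>* w u\<close>. For non-negative \<open>w\<close> the polar density is positive
  semidefinite almost everywhere, so no negative values are cut off by \<open>ennreal\<close>.
\<close>

definition norm2_on ::
  "ereal \<Rightarrow> (real set \<Rightarrow> complex^2^2) \<Rightarrow> real set \<Rightarrow> (real \<Rightarrow> complex^2) \<Rightarrow> ennreal" where
  "norm2_on b w X u =
     (\<integral>\<^sup>+x\<in>X. ennreal (Re (quad_form (polar_density b w x) (u x))) \<partial>total_variation b w)"

abbreviation norm2 ::
  "ereal \<Rightarrow> (real set \<Rightarrow> complex^2^2) \<Rightarrow> (real \<Rightarrow> complex^2) \<Rightarrow> ennreal" where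
  "norm2 b w u \<equiv> norm2_on b w (einterval 0 b) u"


section \<open>Balanced solutions\<close>

definition right_lim :: "(real \<Rightarrow> 'a::t2_space) \<Rightarrow> real \<Rightarrow> 'a" where
  "right_lim u x = Lim (at_right x) u"

definition left_lim :: "(real \<Rightarrow> 'a::t2_space) \<Rightarrow> real \<Rightarrow> 'a" where
  "left_lim u x = Lim (at_left x) u"

definition locally_BV :: "ereal \<Rightarrow> (real \<Rightarrow> complex^2) \<Rightarrow> bool" where
  "locally_BV b u \<longleftrightarrow>
     (\<forall>a c. 0 < a \<longrightarrow> ereal c < b \<longrightarrow>
       (\<exists>K. \<forall>n. \<forall>t :: nat \<Rightarrow> real. mono t \<longrightarrow> range t \<subseteq> {a..c} \<longrightarrow>
          (\<Sum>i<n. norm (u (t (Suc i)) - u (t i))) \<le> K))"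

definition balanced :: "ereal \<Rightarrow> (real \<Rightarrow> complex^2) \<Rightarrow> bool" where
  "balanced b u \<longleftrightarrow>
     (\<forall>x \<in> einterval 0 b. u x = (1/2) *\<^sub>R (left_lim u x + right_lim u x))"

text \<open>The distributional derivative of \<open>u\<close>, i.e. its Lebesgue-Stieltjes measure.\<close>

definition derivative_measure ::
  "ereal \<Rightarrow> (real \<Rightarrow> complex^2) \<Rightarrow> (real set \<Rightarrow> complex^2) \<Rightarrow> bool" where
  "derivative_measure b u du \<longleftrightarrow> local_measure b du \<and>
     (\<forall>x y. 0 < x \<longrightarrow> x < y \<longrightarrow> ereal y < b \<longrightarrow> du {x<..y} = right_lim u y - right_lim u x)"

definition Jmat :: "complex^2^2" where
  "Jmat = vector [vector [0, -1], vector [1, 0]]"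

definition is_solution ::
  "ereal \<Rightarrow> (real set \<Rightarrow> complex^2^2) \<Rightarrow> (real set \<Rightarrow> complex^2^2) \<Rightarrow> complex \<Rightarrow>
   (real \<Rightarrow> complex^2) \<Rightarrow> bool" where
  "is_solution b q w z u \<longleftrightarrow> locally_BV b u \<and> balanced b u \<and>
     (\<exists>du. derivative_measure b u du \<and>
        (\<forall>E \<in> local_sets b.
           Jmat *v du E + apply_measure b q u E = z *s apply_measure b w u E))"

text \<open>
  A solution is a function on \<open>(0,b)\<close>; to count solutions, it is extended by \<open>0\<close> to the line.
\<close>

definition solution_space ::
  "ereal \<Rightarrow> (real set \<Rightarrow> complex^2^2) \<Rightarrow> (real set \<Rightarrow> complex^2^2) \<Rightarrow> complex \<Rightarrow>
   (real \<Rightarrow> complex^2) set" where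
  "solution_space b q w z = {u. is_solution b q w z u \<and> (\<forall>x. x \<notin> einterval 0 b \<longrightarrow> u x = 0)}"

definition null_solutions ::
  "ereal \<Rightarrow> (real set \<Rightarrow> complex^2^2) \<Rightarrow> (real set \<Rightarrow> complex^2^2) \<Rightarrow>
   (real \<Rightarrow> complex^2) set" where
  "null_solutions b q w = {u \<in> solution_space b q w 0. norm2 b w u = 0}"


section \<open>Deficiency indices\<close>

text \<open>\<open>dim (V / N) = n\<close>: some \<open>f 0, ..., f (n-1)\<close> in \<open>V\<close> represent a basis of the quotient.\<close>

definition quotient_dim ::
  "(real \<Rightarrow> complex^2) set \<Rightarrow> (real \<Rightarrow> complex^2) set \<Rightarrow> nat \<Rightarrow> bool" where
  "quotient_dim V N n \<longleftrightarrow>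
     (\<exists>f :: nat \<Rightarrow> real \<Rightarrow> complex^2. (\<forall>i<n. f i \<in> V) \<and>
        (\<forall>u\<in>V. \<exists>a. (\<lambda>x. u x - (\<Sum>i<n. a i *s f i x)) \<in> N) \<and>
        (\<forall>a. (\<lambda>x. \<Sum>i<n. a i *s f i x) \<in> N \<longrightarrow> (\<forall>i<n. a i = 0)))"

text \<open>
  \<open>n\<close> is the deficiency index for the half-plane \<open>H\<close>: the dimension below, which does not depend
  on the choice of \<open>z\<close> in \<open>H\<close>, is \<open>n\<close>.
\<close>

definition deficiency_index ::
  "ereal \<Rightarrow> (real set \<Rightarrow> complex^2^2) \<Rightarrow> (real set \<Rightarrow> complex^2^2) \<Rightarrow> complex set \<Rightarrow>
   nat \<Rightarrow> bool" where
  "deficiency_index b q w H n \<longleftrightarrow>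
     (\<forall>z\<in>H. quotient_dim {u \<in> solution_space b q w z. norm2 b w u < \<infinity>}
        (null_solutions b q w) n)"


section \<open>Exceptional set, fundamental matrix and Weyl disks\<close>

text \<open>\<open>B\<^sub>s\<close> for the sign \<open>s = 1\<close> or \<open>s = - 1\<close>; \<open>mat z ** M\<close> is the scalar multiple of \<open>M\<close> by \<open>z\<close>.\<close>

definition Bmat ::
  "(real set \<Rightarrow> complex^2^2) \<Rightarrow> (real set \<Rightarrow> complex^2^2) \<Rightarrow> real \<Rightarrow> real \<Rightarrow> complex \<Rightarrow>
   complex^2^2" where
  "Bmat q w s x z = Jmat + (s/2) *\<^sub>R (q {x} - mat z ** w {x})"

definition exceptional_set ::
  "ereal \<Rightarrow> (real set \<Rightarrow> complex^2^2) \<Rightarrow> (real set \<Rightarrow> complex^2^2) \<Rightarrow> complex set" where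
  "exceptional_set b q w =
     {z. \<exists>x \<in> einterval 0 b. det (Bmat q w 1 x z) * det (Bmat q w (-1) x z) = 0}"

definition continuity_point ::
  "ereal \<Rightarrow> (real set \<Rightarrow> complex^2^2) \<Rightarrow> (real set \<Rightarrow> complex^2^2) \<Rightarrow> real \<Rightarrow> bool" where
  "continuity_point b q w x \<longleftrightarrow> x \<in> einterval 0 b \<and> q {x} = 0 \<and> w {x} = 0"

definition fundamental_matrix ::
  "ereal \<Rightarrow> (real set \<Rightarrow> complex^2^2) \<Rightarrow> (real set \<Rightarrow> complex^2^2) \<Rightarrow> real \<Rightarrow> complex \<Rightarrow>
   (real \<Rightarrow> complex^2^2) \<Rightarrow> bool" where
  "fundamental_matrix b q w \<alpha> z U \<longleftrightarrow>
     (\<forall>j. is_solution b q w z (\<lambda>x. column j (U x))) \<and>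
     (U \<longlongrightarrow> vector [vector [of_real (cos \<alpha>), - of_real (sin \<alpha>)],
                   vector [of_real (sin \<alpha>), of_real (cos \<alpha>)]]) (at_right 0)"

definition phi :: "(real \<Rightarrow> complex^2^2) \<Rightarrow> real \<Rightarrow> complex^2" where
  "phi U x = column 1 (U x)"

definition psi :: "(real \<Rightarrow> complex^2^2) \<Rightarrow> real \<Rightarrow> complex^2" where
  "psi U x = column 2 (U x)"

definition weyl_solution :: "(real \<Rightarrow> complex^2^2) \<Rightarrow> complex \<Rightarrow> real \<Rightarrow> complex^2" where
  "weyl_solution U m x = phi U x + m *s psi U x"

text \<open>With \<open>V = U(c,\<lambda>)\<close>, the entries of the paper are
  \<open>A = V $ 1 $ 1\<close>, \<open>C = V $ 1 $ 2\<close>, \<open>B = V $ 2 $ 1\<close>, \<open>D = V $ 2 $ 2\<close>.\<close>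

definition weyl_denom :: "complex^2^2 \<Rightarrow> complex" where
  "weyl_denom V = V$1$2 * cnj (V$2$2) - cnj (V$1$2) * V$2$2"

definition weyl_center :: "complex^2^2 \<Rightarrow> complex" where
  "weyl_center V = (V$2$1 * cnj (V$1$2) - V$1$1 * cnj (V$2$2)) / weyl_denom V"

definition weyl_radius :: "complex^2^2 \<Rightarrow> real" where
  "weyl_radius V = norm ((V$1$1 * V$2$2 - V$2$1 * V$1$2) / weyl_denom V)"

definition weyl_disk :: "complex^2^2 \<Rightarrow> complex set" where
  "weyl_disk V = cball (weyl_center V) (weyl_radius V)"

definition limit_disk ::
  "ereal \<Rightarrow> (real set \<Rightarrow> complex^2^2) \<Rightarrow> (real set \<Rightarrow> complex^2^2) \<Rightarrow>
   (real \<Rightarrow> complex^2^2) \<Rightarrow> complex set" where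
  "limit_disk b q w U =
     (\<Inter>c \<in> {c. continuity_point b q w c \<and> 0 < norm2_on b w {0<..<c} (psi U)}. weyl_disk (U c))"

definition has_positive_radius :: "complex set \<Rightarrow> bool" where
  "has_positive_radius D \<longleftrightarrow> (\<exists>m r. 0 < r \<and> D = cball m r)"

end

theory Submission
  imports Defs "HOL-Real_Asymp.Real_Asymp"
begin

text \<open>
  The whole argument rests on one identity. For solutions \<open>u\<close> of the equation at \<open>z\<close> and \<open>v\<close> of the
  equation at \<open>z'\<close>, the form \<open>v\<^sup>* J u\<close> has derivative \<open>(z - cnj z') v\<^sup>* w u\<close>
  (\<open>lagrange_identity\<close>). It needs integration by parts for functions that jump, which is free of
  correction terms because solutions are balanced (\<open>balanced_integration_by_parts\<close>). For
  \<open>\<chi>\<^sub>m = \<phi> + m \<psi>\<close> the identity says that \<open>\<chi>\<^sub>m\<^sup>* J \<chi>\<^sub>m\<close> at \<open>c\<close> is \<open>2 i (Im z N - Im m)\<close>, where \<open>N\<close> is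
  the squared norm of \<open>\<chi>\<^sub>m\<close> over \<open>(0,c)\<close>. As a function of \<open>m\<close> the left-hand side is a
  quadratic polynomial whose zero set is the Weyl circle (\<open>wronskian_weyl_circle\<close>). Hence, once
  \<open>\<psi>\<close> has positive norm over \<open>(0,c)\<close>, \<open>m\<close> lies in the disk at \<open>c\<close> if and only if
  \<open>N \<le> Im m / Im z\<close> (\<open>mem_weyl_disk\<close>). The disks therefore shrink as \<open>c\<close> grows, their
  intersection is a disk of radius \<open>\<rho> = lim r(c)\<close> (\<open>nested_cballs\<close>), and
  \<open>\<chi>\<^sub>m\<close> is square-integrable for every \<open>m\<close> in it.

  If \<open>\<rho> > 0\<close>, two different points of the limit disk exhibit \<open>\<psi>\<close> as a combination of
  square-integrable solutions. Conversely let \<open>\<psi>\<close> be square-integrable. Then so are all solutions, and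
  the deficiency index at \<open>z\<close> is two. Now \<open>r(c) = |det U(c)| / (2 |Im z| \<parallel>\<psi>\<parallel>\<^sub>c\<^sup>2)\<close>, but since \<open>w\<close> need
  not be real, \<open>|det U|\<close> need not be constant and might tend to zero. This is excluded by the equality of
  the deficiency indices: there are two independent square-integrable solutions at \<open>cnj z\<close>,
  the columns of a matrix \<open>F\<close>, and \<open>F\<^sup>* J U\<close> is constant while \<open>F\<^sup>* J F\<close> is bounded, so that
  \<open>|det U|\<close> stays away from zero (\<open>radius_bounded_below\<close>). Thus \<open>\<rho> > 0\<close> is equivalent to
  square-integrability of \<open>\<psi>\<close>, and the complementary case leaves a single point \<open>m\<close> and the single
  square-integrable solution \<open>\<chi>\<^sub>m\<close>.

  Two groups of facts prepare the ground. Measure theory: the total variation of a local measure is a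
  measure, and \<open>q\<close> and \<open>w\<close> have pointwise Hermitian, respectively non-negative, densities with
  respect to \<open>|q| + |w|\<close> (\<open>density_system_exists\<close>). Differential equations: outside the
  exceptional set, a solution that vanishes at one point of continuity vanishes identically
  (\<open>solution_unique\<close>), by Gronwall's argument between the jumps and invertibility of the jump matrices at them. Uniqueness makes evaluation at a
  point an embedding of the solutions into \<open>\<complex>\<^sup>2\<close>, which turns the deficiency indices into dimensions of
  subspaces; at \<open>cnj z\<close> it is the deficiency index that supplies the solutions.
\<close>

section \<open>Local measures and their densities\<close>

lemma local_setsI:
  "E \<in> sets borel \<Longrightarrow> 0 < a \<Longrightarrow> ereal c < b \<Longrightarrow> E \<subseteq> {a..c} \<Longrightarrow> E \<in> local_sets b"
  unfolding local_sets_def by blast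

lemma local_sets_borel: "E \<in> local_sets b \<Longrightarrow> E \<in> sets borel"
  unfolding local_sets_def by blast

lemma local_sets_subset:
  "E \<in> local_sets b \<Longrightarrow> F \<in> sets borel \<Longrightarrow> F \<subseteq> E \<Longrightarrow> F \<in> local_sets b"
  unfolding local_sets_def by blast

lemma empty_local_sets: "0 < b \<Longrightarrow> {} \<in> local_sets b"
  by (rule local_setsI[of _ 1 0]) (auto simp: zero_ereal_def)

lemma local_sets_Un:
  assumes "E \<in> local_sets b" "F \<in> local_sets b"
  shows "E \<union> F \<in> local_sets b"
proof -
  obtain a c a' c' where *: "0 < a" "ereal c < b" "E \<subseteq> {a..c}" "0 < a'" "ereal c' < b" "F \<subseteq> {a'..c'}"
    using assms unfolding local_sets_def by blast
  show ?thesis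
  proof (rule local_setsI)
    show "E \<union> F \<in> sets borel" using assms by (intro sets.Un local_sets_borel)
    show "0 < min a a'" "ereal (max c c') < b" using * by (auto simp: max_def)
    show "E \<union> F \<subseteq> {min a a'..max c c'}"
      using *(3,6) by (fastforce simp: subset_eq)
  qed
qed

lemma local_sets_Icc: "0 < a \<Longrightarrow> ereal c < b \<Longrightarrow> {a..c} \<in> local_sets b"
  by (rule local_setsI) auto

lemma local_sets_Ioc: "0 < a \<Longrightarrow> ereal c < b \<Longrightarrow> {a<..c} \<in> local_sets b"
  by (rule local_setsI[of _ a c]) auto

lemma local_sets_subset_einterval: "E \<in> local_sets b \<Longrightarrow> E \<subseteq> einterval 0 b"
proof
  fix x assume E: "E \<in> local_sets b" "x \<in> E"
  then obtain a c where "0 < a" "ereal c < b" "x \<in> {a..c}"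
    unfolding local_sets_def by blast
  then have "0 < x" "ereal x < b" by (auto intro: le_less_trans[of "ereal x" "ereal c" b])
  then show "x \<in> einterval 0 b" unfolding einterval_def by (simp add: zero_ereal_def)
qed

lemma in_einterval_0: "x \<in> einterval 0 b \<longleftrightarrow> 0 < x \<and> ereal x < b"
  by (simp add: einterval_def zero_ereal_def)

lemma local_exhaustion:
  assumes "0 < b"
  obtains r l :: "nat \<Rightarrow> real" where "einterval 0 b = (\<Union>i. {l i..r i})" "incseq r" "decseq l"
    "\<And>i. l i < r i" "\<And>i. 0 < l i" "\<And>i. ereal (r i) < b" "\<And>i. {l i..r i} \<in> local_sets b"
proof -
  obtain r l :: "nat \<Rightarrow> real" where *: "einterval 0 b = (\<Union>i. {l i..r i})" "incseq r" "decseq l"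
    "\<And>i. l i < r i" "\<And>i. 0 < ereal (l i)" "\<And>i. ereal (r i) < b"
    by (rule einterval_Icc_approximation[OF assms]) (rule that; assumption)
  have l: "0 < l i" for i using *(5)[of i] by (simp add: zero_ereal_def)
  have "{l i..r i} \<in> local_sets b" for i by (rule local_sets_Icc[OF l *(6)])
  from *(1-4) l *(6) this show ?thesis by (rule that)
qed

lemma local_measure_sums:
  "local_measure b \<mu> \<Longrightarrow> range A \<subseteq> local_sets b \<Longrightarrow> disjoint_family A \<Longrightarrow>
    (\<Union>n. A n) \<in> local_sets b \<Longrightarrow> (\<lambda>n. \<mu> (A n)) sums \<mu> (\<Union>n. A n)"
  unfolding local_measure_def by blast

lemma local_measure_empty:
  assumes "0 < b" "local_measure b \<mu>"
  shows "\<mu> {} = 0"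
proof -
  have "(\<lambda>n::nat. \<mu> {}) sums \<mu> (\<Union>n::nat. {})"
    using assms by (intro local_measure_sums) (auto simp: disjoint_family_on_def empty_local_sets)
  then have "(\<lambda>n::nat. \<mu> {}) \<longlonglongrightarrow> 0"
    by (metis sums_summable summable_LIMSEQ_zero)
  then show ?thesis by (simp add: LIMSEQ_const_iff)
qed

lemma measure_of_borel:
  fixes f :: "real set \<Rightarrow> ennreal"
  defines "M \<equiv> measure_of UNIV (sets borel) f"
  shows sets_measure_of_borel: "sets M = sets borel"
    and emeasure_measure_of_borel: "f {} = 0 \<Longrightarrow>
      (\<And>A :: nat \<Rightarrow> real set. range A \<subseteq> sets borel \<Longrightarrow> disjoint_family A \<Longrightarrow>
        (\<Sum>n. f (A n)) = f (\<Union>n. A n)) \<Longrightarrow>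
      E \<in> sets borel \<Longrightarrow> emeasure M E = f E"
proof -
  show "sets M = sets borel"
    unfolding M_def using sets.sigma_sets_eq[of "borel::real measure"] by (simp add: sets_measure_of)
  assume f: "f {} = 0" and E: "E \<in> sets borel"
    and ca: "\<And>A :: nat \<Rightarrow> real set. range A \<subseteq> sets borel \<Longrightarrow> disjoint_family A \<Longrightarrow>
        (\<Sum>n. f (A n)) = f (\<Union>n. A n)"
  have "sigma_algebra UNIV (sets (borel::real measure))"
    using sets.sigma_algebra_axioms[of "borel::real measure"] by simp
  moreover have "countably_additive (sets borel) f" by (rule countably_additiveI) (rule ca)
  ultimately show "emeasure M E = f E"
    unfolding M_def using f E by (intro emeasure_measure_of_sigma) (auto simp: positive_def)
qed

text \<open>The supremum over finite families of disjoint local sets that defines the total variation.\<close>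

definition variation_sup :: "ereal \<Rightarrow> (real set \<Rightarrow> 'a::euclidean_space) \<Rightarrow> real set \<Rightarrow> ennreal" where
  "variation_sup b \<mu> E = (SUP P \<in> {P. finite P \<and> disjoint P \<and> P \<subseteq> local_sets b \<and> \<Union>P \<subseteq> E}.
            \<Sum>F\<in>P. ennreal (norm (\<mu> F)))"

lemma sum_le_variation_sup:
  "finite P \<Longrightarrow> disjoint P \<Longrightarrow> P \<subseteq> local_sets b \<Longrightarrow> \<Union>P \<subseteq> E \<Longrightarrow>
    (\<Sum>F\<in>P. ennreal (norm (\<mu> F))) \<le> variation_sup b \<mu> E"
  unfolding variation_sup_def by (rule SUP_upper) auto

lemma variation_sup_mono: "E \<subseteq> F \<Longrightarrow> variation_sup b \<mu> E \<le> variation_sup b \<mu> F"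
  unfolding variation_sup_def by (rule SUP_subset_mono) auto

lemma variation_sup_empty:
  assumes "0 < b" "local_measure b \<mu>"
  shows "variation_sup b \<mu> {} = 0"
proof -
  have "(\<Sum>F\<in>P. ennreal (norm (\<mu> F))) \<le> 0" if "\<Union>P \<subseteq> {}" for P
    using that assms local_measure_empty[of b \<mu>] by (intro sum_nonpos) auto
  then have "variation_sup b \<mu> {} \<le> 0"
    unfolding variation_sup_def by (intro SUP_least) auto
  then show ?thesis by simp
qed

text \<open>Admissible families for two disjoint sets can be united; only the empty set, on which \<open>\<mu>\<close>
  vanishes, can occur in both.\<close>

lemma variation_sup_superadditive:
  assumes b: "0 < b" and m: "local_measure b \<mu>" and d: "A \<inter> B = {}"
  shows "variation_sup b \<mu> A + variation_sup b \<mu> B \<le> variation_sup b \<mu> (A \<union> B)"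
proof -
  let ?S = "\<lambda>P. \<Sum>F\<in>P. ennreal (norm (\<mu> F))"
  let ?Q = "\<lambda>A. {P. finite P \<and> disjoint P \<and> P \<subseteq> local_sets b \<and> \<Union>P \<subseteq> A}"
  have ne: "?Q A \<noteq> {}" for A by auto
  have 1: "?S P + ?S P' \<le> variation_sup b \<mu> (A \<union> B)" if P: "P \<in> ?Q A" and P': "P' \<in> ?Q B" for P P'
  proof -
    have I: "F = {}" if "F \<in> P \<inter> P'" for F using that d P P' by blast
    have "?S (P \<inter> P') = 0"
      using I local_measure_empty[OF b m] by (intro sum.neutral) auto
    moreover have "?S (P \<union> P') + ?S (P \<inter> P') = ?S P + ?S P'"
      using P P' by (intro sum.union_inter) auto
    moreover have "disjoint (P \<union> P')"
      using P P' d by (intro disjoint_union) blast+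
    then have "?S (P \<union> P') \<le> variation_sup b \<mu> (A \<union> B)"
      using P P' by (intro sum_le_variation_sup) auto
    ultimately show ?thesis by simp
  qed
  have 2: "?S P + variation_sup b \<mu> B \<le> variation_sup b \<mu> (A \<union> B)" if P: "P \<in> ?Q A" for P
    unfolding variation_sup_def[of b \<mu> B]
    by (subst add.commute, subst ennreal_SUP_add_left[OF ne, symmetric], rule SUP_least)
      (use 1[OF P] in \<open>simp add: add.commute\<close>)
  show ?thesis
    unfolding variation_sup_def[of b \<mu> A]
    by (subst ennreal_SUP_add_left[OF ne, symmetric], rule SUP_least) (rule 2)
qed

text \<open>A member \<open>F\<close> of a finite family is cut into the pieces \<open>F \<inter> A n\<close>, and
  \<open>|\<mu> F| \<le> \<Sum>n. |\<mu> (F \<inter> A n)|\<close>.\<close>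

lemma variation_sup_subadditive:
  assumes b: "0 < b" and m: "local_measure b \<mu>"
    and A: "range A \<subseteq> sets borel" "disjoint_family A"
  shows "variation_sup b \<mu> (\<Union>n. A n) \<le> (\<Sum>n. variation_sup b \<mu> (A n))"
  unfolding variation_sup_def[of b \<mu> "\<Union>n. A n"]
proof (rule SUP_least, clarify)
  fix P assume P: "finite P" "disjoint P" "P \<subseteq> local_sets b" "\<Union>P \<subseteq> (\<Union>n. A n)"
  have loc: "F \<inter> A n \<in> local_sets b" if "F \<in> P" for F n
  proof (rule local_sets_subset)
    show F: "F \<in> local_sets b" using that P(3) by blast
    show "F \<inter> A n \<in> sets borel"
      using local_sets_borel[OF F] A(1) by (intro sets.Int) auto
  qed simp
  have 1: "ennreal (norm (\<mu> F)) \<le> (\<Sum>n. ennreal (norm (\<mu> (F \<inter> A n))))" if F: "F \<in> P" for F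
  proof -
    have U: "(\<Union>n. F \<inter> A n) = F" using F P(4) by auto
    have "(\<lambda>n. \<mu> (F \<inter> A n)) sums \<mu> (\<Union>n. F \<inter> A n)"
    proof (rule local_measure_sums[OF m])
      show "range (\<lambda>n. F \<inter> A n) \<subseteq> local_sets b" using loc[OF F] by auto
      show "disjoint_family (\<lambda>n. F \<inter> A n)"
        using A(2) unfolding disjoint_family_on_def by blast
      show "(\<Union>n. F \<inter> A n) \<in> local_sets b" unfolding U using F P(3) by blast
    qed
    then have "(\<lambda>N. \<Sum>n<N. \<mu> (F \<inter> A n)) \<longlonglongrightarrow> \<mu> F"
      unfolding U sums_def .
    then have lim: "(\<lambda>N. ennreal (norm (\<Sum>n<N. \<mu> (F \<inter> A n)))) \<longlonglongrightarrow> ennreal (norm (\<mu> F))"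
      by (intro tendsto_ennrealI tendsto_norm)
    have "ennreal (norm (\<Sum>n<N. \<mu> (F \<inter> A n))) \<le> (\<Sum>n. ennreal (norm (\<mu> (F \<inter> A n))))" for N
    proof -
      have "ennreal (norm (\<Sum>n<N. \<mu> (F \<inter> A n))) \<le> ennreal (\<Sum>n<N. norm (\<mu> (F \<inter> A n)))"
        by (intro ennreal_leI norm_sum)
      also have "\<dots> = (\<Sum>n<N. ennreal (norm (\<mu> (F \<inter> A n))))" by (simp add: sum_ennreal)
      also have "\<dots> \<le> (\<Sum>n. ennreal (norm (\<mu> (F \<inter> A n))))" by (intro sum_le_suminf) auto
      finally show ?thesis .
    qed
    then show ?thesis by (intro LIMSEQ_le_const2[OF lim]) auto
  qed
  have 2: "(\<Sum>F\<in>P. ennreal (norm (\<mu> (F \<inter> A n)))) \<le> variation_sup b \<mu> (A n)" for n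
  proof -
    have inj: "F \<inter> A n = {}" if "F \<in> P" "G \<in> P" "F \<noteq> G" "F \<inter> A n = G \<inter> A n" for F G
      using that P(2) unfolding disjoint_def by blast
    have "(\<Sum>F\<in>P. ennreal (norm (\<mu> (F \<inter> A n)))) = (\<Sum>F\<in>(\<lambda>F. F \<inter> A n) ` P. ennreal (norm (\<mu> F)))"
    proof (subst sum.reindex_nontrivial)
      fix F G assume FG: "F \<in> P" "G \<in> P" "F \<noteq> G" "F \<inter> A n = G \<inter> A n"
      show "ennreal (norm (\<mu> (F \<inter> A n))) = 0"
        using inj[OF FG] local_measure_empty[OF b m] by simp
    qed (use P(1) in auto)
    also have "\<dots> \<le> variation_sup b \<mu> (A n)"
      using P loc
      by (intro sum_le_variation_sup) (auto simp: disjoint_def)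
    finally show ?thesis .
  qed
  have "(\<Sum>F\<in>P. ennreal (norm (\<mu> F))) \<le> (\<Sum>F\<in>P. \<Sum>n. ennreal (norm (\<mu> (F \<inter> A n))))"
    by (intro sum_mono 1)
  also have "\<dots> = (\<Sum>n. \<Sum>F\<in>P. ennreal (norm (\<mu> (F \<inter> A n))))"
    by (intro suminf_sum[symmetric]) auto
  also have "\<dots> \<le> (\<Sum>n. variation_sup b \<mu> (A n))"
    by (intro suminf_le 2) auto
  finally show "(\<Sum>F\<in>P. ennreal (norm (\<mu> F))) \<le> (\<Sum>n. variation_sup b \<mu> (A n))" .
qed

lemma variation_sup_countably_additive:
  assumes b: "0 < b" and m: "local_measure b \<mu>"
    and A: "range A \<subseteq> sets borel" "disjoint_family A"
  shows "(\<Sum>n. variation_sup b \<mu> (A n)) = variation_sup b \<mu> (\<Union>n. A n)"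
proof -
  have fin: "(\<Sum>n<N. variation_sup b \<mu> (A n)) \<le> variation_sup b \<mu> (\<Union>n<N. A n)" for N
  proof (induction N)
    case 0 then show ?case by simp
  next
    case (Suc N)
    have "(\<Union>n<N. A n) \<inter> A N = {}"
      using A(2) unfolding disjoint_family_on_def by (auto dest: bspec[of _ _ N])
        (metis disjoint_iff less_irrefl)
    from variation_sup_superadditive[OF b m this] Suc
    have "(\<Sum>n<N. variation_sup b \<mu> (A n)) + variation_sup b \<mu> (A N)
        \<le> variation_sup b \<mu> ((\<Union>n<N. A n) \<union> A N)"
      by (meson add_right_mono order_trans)
    moreover have "(\<Union>n<N. A n) \<union> A N = (\<Union>n<Suc N. A n)" by (auto simp: less_Suc_eq)
    ultimately show ?case by simp
  qed
  have "(\<Sum>n<N. variation_sup b \<mu> (A n)) \<le> variation_sup b \<mu> (\<Union>n. A n)" for N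
    using fin[of N] variation_sup_mono[of "\<Union>n<N. A n" "\<Union>n. A n" b \<mu>] by (auto intro: order_trans)
  then have "(\<Sum>n. variation_sup b \<mu> (A n)) \<le> variation_sup b \<mu> (\<Union>n. A n)"
    by (intro suminf_le_const) auto
  with variation_sup_subadditive[OF b m A]
  show "(\<Sum>n. variation_sup b \<mu> (A n)) = variation_sup b \<mu> (\<Union>n. A n)" by simp
qed

lemma total_variation_alt: "total_variation b \<mu> = measure_of UNIV (sets borel) (variation_sup b \<mu>)"
  unfolding total_variation_def variation_sup_def ..

lemma sets_total_variation [simp, measurable_cong]: "sets (total_variation b \<mu>) = sets borel"
  unfolding total_variation_alt by (rule sets_measure_of_borel)

lemma emeasure_total_variation:
  assumes "0 < b" "local_measure b \<mu>" "E \<in> sets borel"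
  shows "emeasure (total_variation b \<mu>) E = variation_sup b \<mu> E"
  unfolding total_variation_alt
  by (rule emeasure_measure_of_borel[OF variation_sup_empty variation_sup_countably_additive assms(3)])
    (use assms in auto)

lemma norm_le_total_variation:
  assumes b: "0 < b" and m: "local_measure b \<mu>" and E: "E \<in> local_sets b"
  shows "ennreal (norm (\<mu> E)) \<le> emeasure (total_variation b \<mu>) E"
  using sum_le_variation_sup[of "{E}" b E \<mu>] E
  by (simp add: emeasure_total_variation[OF b m] local_sets_borel)

text \<open>A local set that avoids \<open>(0,b)\<close> is empty.\<close>

lemma total_variation_outside:
  assumes b: "0 < b" and m: "local_measure b \<mu>"
  shows "emeasure (total_variation b \<mu>) (- einterval 0 b) = 0"
proof -
  have "(\<Sum>F\<in>P. ennreal (norm (\<mu> F))) \<le> 0"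
    if P: "P \<subseteq> local_sets b" "\<Union>P \<subseteq> - einterval 0 b" for P
  proof (rule sum_nonpos)
    fix F assume "F \<in> P"
    then have "F = {}" using P local_sets_subset_einterval[of F b] by blast
    then show "ennreal (norm (\<mu> F)) \<le> 0" using local_measure_empty[OF b m] by simp
  qed
  then have "variation_sup b \<mu> (- einterval 0 b) \<le> 0"
    unfolding variation_sup_def by (intro SUP_least) auto
  then show ?thesis
    by (simp add: emeasure_total_variation[OF b m])
qed

lemma emeasure_local_finite:
  assumes s: "sets M = sets borel"
    and f: "\<And>c. 0 < c \<Longrightarrow> ereal c < b \<Longrightarrow> emeasure M {0<..<c} < \<infinity>"
    and E: "E \<in> local_sets b"
  shows "emeasure M E < \<infinity>"
proof -
  obtain a c where ac: "0 < a" "ereal c < b" "E \<subseteq> {a..c}"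
    using E unfolding local_sets_def by blast
  obtain d where d: "c < d" "ereal d < b"
    using ereal_dense2[OF ac(2)] by auto
  show ?thesis
  proof (cases "a \<le> c")
    case True
    have "E \<subseteq> {0<..<d}" using ac d by (fastforce simp: subset_eq)
    then have "emeasure M E \<le> emeasure M {0<..<d}"
      using s by (intro emeasure_mono) auto
    also have "\<dots> < \<infinity>" using f d ac True by auto
    finally show ?thesis .
  next
    case False
    then have "E = {}" using ac by auto
    then show ?thesis by simp
  qed
qed

lemma local_sigma_finite:
  assumes b: "0 < b" and s: "sets M = sets borel"
    and f: "\<And>c. 0 < c \<Longrightarrow> ereal c < b \<Longrightarrow> emeasure M {0<..<c} < \<infinity>"
    and o: "emeasure M (- einterval 0 b) = 0"
  shows "sigma_finite_measure M"
proof -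
  obtain u l :: "nat \<Rightarrow> real" where
    ul: "einterval 0 b = (\<Union>i. {l i..u i})" and loc: "\<And>i. {l i..u i} \<in> local_sets b"
    by (rule local_exhaustion[OF b]) (rule that; assumption)
  let ?A = "insert (- einterval 0 b) (range (\<lambda>i. {l i..u i}))"
  have sp: "space M = UNIV" using sets_eq_imp_space_eq[OF s] by simp
  show ?thesis
  proof
    have "emeasure M a \<noteq> \<infinity>" if "a \<in> ?A" for a
      using that o emeasure_local_finite[OF s f loc] by (auto simp: less_top)
    moreover have "\<Union> ?A = space M"
    proof -
      have "\<Union> ?A = - einterval 0 b \<union> (\<Union>i. {l i..u i})" by blast
      then show ?thesis unfolding ul[symmetric] sp by blast
    qed
    moreover have "?A \<subseteq> sets M"
    proof -
      have "- einterval 0 b \<in> sets borel" by (intro borel_comp) measurable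
      moreover have "range (\<lambda>i. {l i..u i}) \<subseteq> sets borel" by (intro image_subsetI) simp
      ultimately show ?thesis unfolding s by (simp only: insert_subset simp_thms)
    qed
    moreover have "countable ?A" by simp
    ultimately show "\<exists>A. countable A \<and> A \<subseteq> sets M \<and> \<Union> A = space M \<and> (\<forall>a\<in>A. emeasure M a \<noteq> \<infinity>)"
      by blast
  qed
qed

lemma total_variation_local_finite:
  assumes "finite_near_0 b \<mu>" "E \<in> local_sets b"
  shows "emeasure (total_variation b \<mu>) E < \<infinity>"
  by (rule emeasure_local_finite[OF sets_total_variation _ assms(2)])
    (use assms(1) in \<open>auto simp: finite_near_0_def\<close>)

lemma sigma_finite_total_variation:
  assumes "0 < b" "local_measure b \<mu>" "finite_near_0 b \<mu>"
  shows "sigma_finite_measure (total_variation b \<mu>)"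
  using assms total_variation_outside
  by (intro local_sigma_finite[of b]) (auto simp: finite_near_0_def)

text \<open>
  As \<open>M\<close> dominates \<open>\<mu>\<close>, the sum \<open>M + \<mu>\<close> is non-negative and extends from the local sets to a
  measure on the line, to which the theorem of Radon and Nikodym applies. The extension adds up the values on the pieces
  \<open>I k\<close> of a partition of \<open>(0,b)\<close> into local sets.
\<close>

lemma real_local_measure_density:
  fixes \<mu> :: "real set \<Rightarrow> real"
  assumes b: "0 < b" and m: "local_measure b \<mu>"
    and s: "sets M = sets borel" and sf: "sigma_finite_measure M"
    and fin: "\<And>E. E \<in> local_sets b \<Longrightarrow> emeasure M E < \<infinity>"
    and dom: "\<And>E. E \<in> local_sets b \<Longrightarrow> ennreal \<bar>\<mu> E\<bar> \<le> emeasure M E"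
  shows "\<exists>h \<in> borel_measurable borel. \<forall>E \<in> local_sets b.
    set_integrable M E h \<and> \<mu> E = (LINT x:E|M. h x)"
proof -
  interpret sigma_finite_measure M by fact
  have sp: "space M = UNIV" using sets_eq_imp_space_eq[OF s] by simp
  obtain u l :: "nat \<Rightarrow> real" where
    ul: "einterval 0 b = (\<Union>i. {l i..u i})" and loc: "\<And>i. {l i..u i} \<in> local_sets b"
    by (rule local_exhaustion[OF b]) (rule that; assumption)
  define I where "I = disjointed (\<lambda>i. {l i..u i})"
  have I_bor: "I i \<in> sets borel" for i
  proof -
    have "range (disjointed (\<lambda>i. {l i..u i})) \<subseteq> sets borel"
      by (intro sets.range_disjointed_sets image_subsetI) simp
    then show ?thesis unfolding I_def by blast
  qed
  have I_loc: "E \<inter> I i \<in> local_sets b" if "E \<in> sets borel" for E i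
  proof (rule local_sets_subset[OF loc])
    show "E \<inter> I i \<in> sets borel" using that I_bor by auto
    show "E \<inter> I i \<subseteq> {l i..u i}" unfolding I_def using disjointed_subset[of "\<lambda>i. {l i..u i}" i] by auto
  qed
  have I_Un: "(\<Union>i. I i) = einterval 0 b" unfolding I_def UN_disjointed_eq ul ..
  have I_disj: "disjoint_family I" unfolding I_def by (rule disjoint_family_disjointed)
  \<comment> \<open>non-negative on local sets because \<open>M\<close> dominates \<open>\<mu>\<close>\<close>
  define N0 where "N0 E = measure M E + \<mu> E" for E
  have N0_nonneg: "0 \<le> N0 E" if "E \<in> local_sets b" for E
  proof -
    have "ennreal \<bar>\<mu> E\<bar> \<le> ennreal (measure M E)"
      using dom[OF that] fin[OF that] by (simp add: emeasure_eq_ennreal_measure less_top)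
    then have "\<bar>\<mu> E\<bar> \<le> measure M E" by (simp add: ennreal_le_iff)
    then show ?thesis unfolding N0_def by simp
  qed
  have N0_sums: "(\<lambda>n. N0 (A n)) sums N0 (\<Union>n. A n)"
    if A: "range A \<subseteq> local_sets b" "disjoint_family A" "(\<Union>n. A n) \<in> local_sets b" for A :: "nat \<Rightarrow> real set"
    unfolding N0_def
  proof (intro sums_add local_measure_sums[OF m A] measure_UNION)
    show "range A \<subseteq> sets M" using A(1) local_sets_borel unfolding s by auto
    show "disjoint_family A" by fact
    show "emeasure M (\<Union>n. A n) \<noteq> \<infinity>" using fin[OF A(3)] by simp
  qed
  have N0_suminf: "(\<Sum>n. ennreal (N0 (A n))) = ennreal (N0 (\<Union>n. A n))"
    if A: "range A \<subseteq> local_sets b" "disjoint_family A" "(\<Union>n. A n) \<in> local_sets b" for A :: "nat \<Rightarrow> real set"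
    using N0_sums[OF A] N0_nonneg A(1)
    by (intro suminf_ennreal_eq) auto
  define N1 where "N1 E = (\<Sum>k. ennreal (N0 (E \<inter> I k)))" for E
  define N where "N = measure_of UNIV (sets borel) N1"
  have N_sets: "sets N = sets borel" unfolding N_def by (rule sets_measure_of_borel)
  have N_em: "emeasure N E = N1 E" if "E \<in> sets borel" for E
    unfolding N_def
  proof (rule emeasure_measure_of_borel[OF _ _ that])
    show "N1 {} = 0" unfolding N1_def by (simp add: N0_def local_measure_empty[OF b m])
    fix A :: "nat \<Rightarrow> real set"
    assume A: "range A \<subseteq> sets borel" "disjoint_family A"
    have "(\<Sum>n. N1 (A n)) = (\<Sum>k. \<Sum>n. ennreal (N0 (A n \<inter> I k)))"
      unfolding N1_def by (subst (1 2) nn_integral_count_space_nat[symmetric])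
        (simp add: nn_integral_suminf)
    also have "\<dots> = (\<Sum>k. ennreal (N0 (\<Union>n. A n \<inter> I k)))"
    proof (intro suminf_cong N0_suminf)
      fix k
      show "range (\<lambda>n. A n \<inter> I k) \<subseteq> local_sets b" using A(1) I_loc by blast
      show "disjoint_family (\<lambda>n. A n \<inter> I k)"
        using A(2) unfolding disjoint_family_on_def by blast
      have "(\<Union>n. A n) \<inter> I k \<in> local_sets b" using A(1) by (intro I_loc) auto
      then show "(\<Union>n. A n \<inter> I k) \<in> local_sets b" by simp
    qed
    also have "\<dots> = N1 (\<Union>n. A n)" unfolding N1_def by simp
    finally show "(\<Sum>n. N1 (A n)) = N1 (\<Union>n. A n)" .
  qed
  have N_loc: "emeasure N E = ennreal (N0 E)" if E: "E \<in> local_sets b" for E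
  proof -
    have U: "(\<Union>k. E \<inter> I k) = E" using I_Un local_sets_subset_einterval[OF E] by blast
    have "(\<Sum>k. ennreal (N0 (E \<inter> I k))) = ennreal (N0 (\<Union>k. E \<inter> I k))"
    proof (rule N0_suminf)
      show "range (\<lambda>k. E \<inter> I k) \<subseteq> local_sets b" using I_loc local_sets_borel[OF E] by blast
      show "disjoint_family (\<lambda>k. E \<inter> I k)"
        using I_disj unfolding disjoint_family_on_def by blast
      show "(\<Union>k. E \<inter> I k) \<in> local_sets b" unfolding U by fact
    qed
    then show ?thesis using N_em[OF local_sets_borel[OF E]] unfolding N1_def U by simp
  qed
  have "absolutely_continuous M N"
    unfolding absolutely_continuous_def
  proof
    fix E assume E: "E \<in> null_sets M"
    then have Eb: "E \<in> sets borel" using null_setsD2[OF E] unfolding s by simp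
    have "N0 (E \<inter> I k) = 0" for k
    proof -
      have "emeasure M (E \<inter> I k) = 0"
        by (rule emeasure_eq_0[OF null_setsD2[OF E] null_setsD1[OF E]]) simp
      then show ?thesis
        using dom[OF I_loc[OF Eb, of k]] unfolding N0_def by (simp add: measure_def ennreal_eq_0_iff)
    qed
    then show "E \<in> null_sets N"
      using Eb N_sets by (intro null_setsI) (simp_all add: N_em N1_def)
  qed
  then obtain f where f: "f \<in> borel_measurable M" "density M f = N"
    using Radon_Nikodym[of N] N_sets s by auto
  have fb: "f \<in> borel_measurable borel" using f(1) s by (simp cong: measurable_cong_sets)
  define h where "h x = enn2real (f x) - 1" for x
  have hb: "h \<in> borel_measurable borel" unfolding h_def using fb by measurable
  have "set_integrable M E h \<and> \<mu> E = (LINT x:E|M. h x)" if E: "E \<in> local_sets b" for E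
  proof -
    have EM: "E \<in> sets M" using local_sets_borel[OF E] s by simp
    have int: "(\<integral>\<^sup>+x. f x * indicator E x \<partial>M) = ennreal (N0 E)"
      using N_loc[OF E] f EM by (subst emeasure_density[symmetric]) auto
    have ae: "AE x in M. f x * indicator E x \<noteq> \<infinity>"
    proof (rule nn_integral_PInf_AE)
      show "(\<lambda>x. f x * indicator E x) \<in> borel_measurable M" using f(1) EM by measurable
    qed (simp add: int)
    have int': "(\<integral>\<^sup>+x. ennreal (indicator E x * enn2real (f x)) \<partial>M) = ennreal (N0 E)"
      unfolding int[symmetric]
    proof (rule nn_integral_cong_AE, use ae in \<open>rule eventually_mono\<close>)
      fix x assume "f x * indicator E x \<noteq> \<infinity>"
      then show "ennreal (indicator E x * enn2real (f x)) = f x * indicator E x"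
        by (cases "x \<in> E") (simp_all add: ennreal_enn2real_if)
    qed
    have m1: "(\<lambda>x. indicator E x * enn2real (f x)) \<in> borel_measurable M"
      using f(1) EM by measurable
    have i1: "set_integrable M E (\<lambda>x. enn2real (f x))"
      unfolding set_integrable_def real_scaleR_def
      using int' m1 by (intro integrableI_nonneg) auto
    have v1: "(LINT x:E|M. enn2real (f x)) = N0 E"
      unfolding set_lebesgue_integral_def real_scaleR_def
      using int' m1 N0_nonneg[OF E] by (subst integral_eq_nn_integral) auto
    have i2: "set_integrable M E (\<lambda>x. 1 :: real)"
      unfolding set_integrable_def using EM fin[OF E] by (simp add: integrable_indicator_iff)
    have v2: "(LINT x:E|M. 1) = measure M E"
      using fin[OF E] EM by (simp add: set_lebesgue_integral_def)
    show ?thesis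
      unfolding h_def using set_integral_diff[OF i1 i2] v1 v2 by (simp add: N0_def)
  qed
  then show ?thesis using hb by blast
qed

text \<open>The density is found one coordinate at a time.\<close>

lemma polar_density_exists:
  fixes \<mu> :: "real set \<Rightarrow> 'a::euclidean_space"
  assumes b: "0 < b" and m: "local_measure b \<mu>" and f: "finite_near_0 b \<mu>"
  shows "\<exists>h. h \<in> borel_measurable borel \<and> (\<forall>E \<in> local_sets b.
    set_integrable (total_variation b \<mu>) E h \<and> \<mu> E = (LINT x:E|total_variation b \<mu>. h x))"
proof -
  let ?M = "total_variation b \<mu>"
  have "\<exists>h \<in> borel_measurable borel. \<forall>E \<in> local_sets b.
    set_integrable ?M E h \<and> \<mu> E \<bullet> i = (LINT x:E|?M. h x)" if i: "i \<in> Basis" for i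
  proof (rule real_local_measure_density[OF b])
    show "local_measure b (\<lambda>E. \<mu> E \<bullet> i)"
      using m unfolding local_measure_def by (auto intro!: bounded_linear.sums[OF bounded_linear_inner_left])
    show "sets ?M = sets borel" by simp
    show "sigma_finite_measure ?M" by (rule sigma_finite_total_variation[OF b m f])
    fix E assume E: "E \<in> local_sets b"
    show "emeasure ?M E < \<infinity>" by (rule total_variation_local_finite[OF f E])
    have "ennreal \<bar>\<mu> E \<bullet> i\<bar> \<le> ennreal (norm (\<mu> E))"
      using i by (intro ennreal_leI Basis_le_norm)
    then show "ennreal \<bar>\<mu> E \<bullet> i\<bar> \<le> emeasure ?M E"
      using norm_le_total_variation[OF b m E] by (rule order_trans)
  qed
  then obtain h where h: "\<And>i. i \<in> Basis \<Longrightarrow> h i \<in> borel_measurable borel"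
    "\<And>i E. i \<in> Basis \<Longrightarrow> E \<in> local_sets b \<Longrightarrow> set_integrable ?M E (h i)"
    "\<And>i E. i \<in> Basis \<Longrightarrow> E \<in> local_sets b \<Longrightarrow> \<mu> E \<bullet> i = (LINT x:E|?M. h i x)"
    by metis
  define H where "H x = (\<Sum>i\<in>Basis. h i x *\<^sub>R i)" for x
  have "H \<in> borel_measurable borel"
    unfolding H_def using h(1) by measurable
  moreover have "set_integrable ?M E H \<and> \<mu> E = (LINT x:E|?M. H x)" if E: "E \<in> local_sets b" for E
  proof -
    have eq: "indicator E x *\<^sub>R H x = (\<Sum>i\<in>Basis. (indicator E x *\<^sub>R h i x) *\<^sub>R i)" for x
      unfolding H_def by (simp add: scaleR_sum_right)
    have int: "integrable ?M (\<lambda>x. indicator E x *\<^sub>R h i x)" if "i \<in> Basis" for i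
      using h(2)[OF that E] unfolding set_integrable_def .
    have "integrable ?M (\<lambda>x. indicator E x *\<^sub>R H x)"
      unfolding eq by (intro Bochner_Integration.integrable_sum integrable_scaleR_left int)
    moreover have "(LINT x|?M. indicator E x *\<^sub>R H x) = (\<Sum>i\<in>Basis. (LINT x:E|?M. h i x) *\<^sub>R i)"
      unfolding eq set_lebesgue_integral_def
      by (simp only: Bochner_Integration.integral_sum[OF integrable_scaleR_left[OF int]])
        (intro sum.cong refl integral_scaleR_left int)
    moreover have "\<dots> = (\<Sum>i\<in>Basis. (\<mu> E \<bullet> i) *\<^sub>R i)"
      using h(3)[OF _ E] by simp
    ultimately show ?thesis
      unfolding set_integrable_def set_lebesgue_integral_def by (simp add: euclidean_representation)
  qed
  ultimately show ?thesis by blast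
qed

lemma polar_density:
  fixes \<mu> :: "real set \<Rightarrow> 'a::euclidean_space"
  assumes "0 < b" "local_measure b \<mu>" "finite_near_0 b \<mu>"
  shows borel_measurable_polar_density: "polar_density b \<mu> \<in> borel_measurable borel"
    and set_integrable_polar_density:
      "E \<in> local_sets b \<Longrightarrow> set_integrable (total_variation b \<mu>) E (polar_density b \<mu>)"
    and set_integral_polar_density:
      "E \<in> local_sets b \<Longrightarrow> (LINT x:E|total_variation b \<mu>. polar_density b \<mu> x) = \<mu> E"
  using someI_ex[OF polar_density_exists[OF assms], folded polar_density_def] by auto

section \<open>Densities with respect to one reference measure\<close>

lemma norm_matrix_vector_mult_le:
  fixes A :: "complex^2^2" and v :: "complex^2"
  shows "norm (A *v v) \<le> 4 * norm A * norm v"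
proof -
  have "norm ((A *v v) $ i) \<le> 2 * (norm A * norm v)" for i
  proof -
    have "norm ((A *v v) $ i) \<le> (\<Sum>j\<in>UNIV. norm (A $ i $ j * v $ j))"
      unfolding matrix_vector_mult_def by (simp add: norm_sum)
    also have "\<dots> \<le> (\<Sum>j\<in>(UNIV::2 set). norm A * norm v)"
    proof (rule sum_mono)
      fix j :: 2
      have "norm (A $ i $ j) \<le> norm A"
        using Finite_Cartesian_Product.norm_nth_le[of "A $ i" j] Finite_Cartesian_Product.norm_nth_le[of A i] by (rule order_trans)
      then show "norm (A $ i $ j * v $ j) \<le> norm A * norm v"
        unfolding norm_mult by (intro mult_mono Finite_Cartesian_Product.norm_nth_le) auto
    qed
    finally show ?thesis by simp
  qed
  then have "(\<Sum>i\<in>(UNIV::2 set). norm ((A *v v) $ i)) \<le> (\<Sum>i\<in>(UNIV::2 set). 2 * (norm A * norm v))"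
    by (intro sum_mono)
  moreover have "norm (A *v v) \<le> (\<Sum>i\<in>(UNIV::2 set). norm ((A *v v) $ i))"
    unfolding norm_vec_def by (rule L2_set_le_sum) simp
  ultimately show ?thesis by simp
qed

lemma bounded_bilinear_matrix_vector_mult:
  "bounded_bilinear (\<lambda>(A::complex^2^2) (v::complex^2). A *v v)"
proof
  fix A A' :: "complex^2^2" and v v' :: "complex^2" and r :: real
  show "(A + A') *v v = A *v v + A' *v v" by (simp add: matrix_vector_mult_add_rdistrib)
  show "A *v (v + v') = A *v v + A *v v'" by (simp add: matrix_vector_right_distrib)
  show "(r *\<^sub>R A) *v v = r *\<^sub>R (A *v v)"
    by (simp add: matrix_vector_mult_def vec_eq_iff scaleR_sum_right)
  show "A *v (r *\<^sub>R v) = r *\<^sub>R (A *v v)"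
    by (simp add: matrix_vector_mult_def vec_eq_iff scaleR_sum_right)
  show "\<exists>K. \<forall>A v. norm ((A::complex^2^2) *v v) \<le> norm A * norm v * K"
    using norm_matrix_vector_mult_le by (intro exI[of _ 4]) (simp add: mult_ac)
qed

interpretation mv: bounded_bilinear "\<lambda>(A::complex^2^2) (v::complex^2). A *v v"
  by (rule bounded_bilinear_matrix_vector_mult)

lemma borel_measurable_matrix_vector_mult [measurable (raw)]:
  fixes A :: "'a \<Rightarrow> complex^2^2"
  assumes "A \<in> borel_measurable M" "u \<in> borel_measurable M"
  shows "(\<lambda>x. A x *v u x) \<in> borel_measurable M"
  by (rule borel_measurable_continuous_Pair[OF assms])
    (intro mv.continuous_on continuous_on_fst continuous_on_snd continuous_on_id)

lemma continuous_on_quad_form [continuous_intros]: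
  "continuous_on S A \<Longrightarrow> continuous_on S v \<Longrightarrow> continuous_on S (\<lambda>x. quad_form (A x) (v x))"
  unfolding quad_form_def by (intro continuous_intros)

lemma borel_measurable_quad_form [measurable (raw)]:
  assumes "A \<in> borel_measurable M" "u \<in> borel_measurable M"
  shows "(\<lambda>x. quad_form (A x) (u x)) \<in> borel_measurable M"
  by (rule borel_measurable_continuous_Pair[OF assms])
    (intro continuous_intros)

lemma quad_form_scaleR_left: "quad_form (a *\<^sub>R A) v = of_real a * quad_form A v"
  by (simp add: quad_form_def sum_distrib_left scaleR_conv_of_real[where 'a=complex] mult_ac)

lemma conj_transpose_scaleR: "conj_transpose (a *\<^sub>R A) = a *\<^sub>R conj_transpose A"
  by (simp add: conj_transpose_def vec_eq_iff)

lemma conj_transpose_0 [simp]: "conj_transpose 0 = 0"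
  by (simp add: conj_transpose_def vec_eq_iff)

lemma closed_hermitian: "closed {A. conj_transpose A = A}"
  unfolding conj_transpose_def by (intro closed_Collect_eq continuous_intros)

lemma closed_nonneg_hermitian: "closed {A. conj_transpose A = A \<and> (\<forall>v. 0 \<le> Re (quad_form A v))}"
  by (intro closed_Collect_conj closed_hermitian closed_Collect_all closed_Collect_le continuous_intros)

text \<open>All averages of the density lie in the closed cone \<open>S\<close>, hence almost all of its values do.\<close>

lemma density_in_cone:
  fixes h :: "real \<Rightarrow> 'a::euclidean_space"
  assumes b: "0 < b" and s: "sets M = sets borel" and sf: "sigma_finite_measure M"
    and out: "emeasure M (- einterval 0 b) = 0"
    and h: "h \<in> borel_measurable borel"
    and int: "\<And>E. E \<in> local_sets b \<Longrightarrow> set_integrable M E h"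
    and val: "\<And>E. E \<in> local_sets b \<Longrightarrow> (LINT x:E|M. h x) \<in> S"
    and S: "closed S" "\<And>a x. 0 \<le> a \<Longrightarrow> x \<in> S \<Longrightarrow> a *\<^sub>R x \<in> S"
  shows "AE x in M. h x \<in> S"
proof -
  interpret sigma_finite_measure M by fact
  obtain u l :: "nat \<Rightarrow> real" where
    ul: "einterval 0 b = (\<Union>i. {l i..u i})" and loc: "\<And>i. {l i..u i} \<in> local_sets b"
    by (rule local_exhaustion[OF b]) (rule that; assumption)
  have "AE x in M. indicator {l i..u i} x *\<^sub>R h x \<in> S" for i
  proof (rule averaging_theorem[OF _ S(1)])
    show "integrable M (\<lambda>x. indicator {l i..u i} x *\<^sub>R h x)"
      using int[OF loc] unfolding set_integrable_def .
    fix A assume A: "A \<in> sets M" "0 < measure M A"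
    have "A \<inter> {l i..u i} \<in> local_sets b"
      using A(1) by (intro local_sets_subset[OF loc[of i]]) (simp_all add: s)
    moreover have "set_lebesgue_integral M A (\<lambda>x. indicator {l i..u i} x *\<^sub>R h x)
        = (LINT x:A \<inter> {l i..u i}|M. h x)"
      unfolding set_lebesgue_integral_def by (simp add: indicator_inter_arith)
    ultimately show "(1 / measure M A) *\<^sub>R set_lebesgue_integral M A (\<lambda>x. indicator {l i..u i} x *\<^sub>R h x) \<in> S"
      using val by (auto intro!: S(2))
  qed
  then have "AE x in M. \<forall>i. indicator {l i..u i} x *\<^sub>R h x \<in> S"
    unfolding AE_all_countable by blast
  moreover have "- einterval 0 b \<in> sets borel" by (intro borel_comp) measurable
  then have "AE x in M. x \<notin> - einterval 0 b"
    using out by (intro AE_not_in null_setsI) (simp_all add: s)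
  ultimately show ?thesis
  proof eventually_elim
    case (elim x)
    then obtain i where "x \<in> {l i..u i}" using ul by blast
    then show ?case using elim(1)[rule_format, of i] by simp
  qed
qed

text \<open>
  From here on, \<open>q\<close> and \<open>w\<close> are represented by matrix functions \<open>Q\<close> and \<open>W\<close> that are Hermitian,
  respectively non-negative, at every point, so that the algebra of the equation can be done
  pointwise under the integral sign. Measurability is only asked of \<open>u\<close> on the set of integration,
  since solutions are arbitrary outside \<open>(0,b)\<close>.
\<close>

locale density_system =
  fixes b :: ereal and q w :: "real set \<Rightarrow> complex^2^2"
    and \<nu> :: "real measure" and Q W :: "real \<Rightarrow> complex^2^2"
  assumes b_pos: "0 < b"
    and sets_nu [simp, measurable_cong]: "sets \<nu> = sets borel"
    and nu_sigma_finite: "sigma_finite_measure \<nu>"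
    and nu_finite: "E \<in> local_sets b \<Longrightarrow> emeasure \<nu> E < \<infinity>"
    and Q_borel [measurable]: "Q \<in> borel_measurable borel"
    and W_borel [measurable]: "W \<in> borel_measurable borel"
    and Q_integrable: "E \<in> local_sets b \<Longrightarrow> set_integrable \<nu> E Q"
    and W_integrable: "E \<in> local_sets b \<Longrightarrow> set_integrable \<nu> E W"
    and Q_hermitian: "conj_transpose (Q x) = Q x"
    and W_hermitian: "conj_transpose (W x) = W x"
    and W_nonneg: "0 \<le> Re (quad_form (W x) v)"
    and q_density: "E \<in> local_sets b \<Longrightarrow> q E = (LINT x:E|\<nu>. Q x)"
    and w_density: "E \<in> local_sets b \<Longrightarrow> w E = (LINT x:E|\<nu>. W x)"
    and apply_q: "E \<in> local_sets b \<Longrightarrow> (\<lambda>x. indicator E x *\<^sub>R u x) \<in> borel_measurable borel \<Longrightarrow>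
      apply_measure b q u E = (LINT x:E|\<nu>. Q x *v u x)"
    and apply_w: "E \<in> local_sets b \<Longrightarrow> (\<lambda>x. indicator E x *\<^sub>R u x) \<in> borel_measurable borel \<Longrightarrow>
      apply_measure b w u E = (LINT x:E|\<nu>. W x *v u x)"
    and norm2_on_density: "X \<in> sets borel \<Longrightarrow> (\<lambda>x. indicator X x *\<^sub>R u x) \<in> borel_measurable borel \<Longrightarrow>
      norm2_on b w X u = (\<integral>\<^sup>+x\<in>X. ennreal (Re (quad_form (W x) (u x))) \<partial>\<nu>)"

lemma dominated_real_density:
  assumes M: "sigma_finite_measure M" and N: "sigma_finite_measure N"
    and s: "sets M = sets borel" "sets N = sets borel"
    and le: "\<And>E. E \<in> sets borel \<Longrightarrow> emeasure N E \<le> emeasure M E"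
  shows "\<exists>r::real \<Rightarrow> real. r \<in> borel_measurable borel \<and> (\<forall>x. 0 \<le> r x) \<and> density M (\<lambda>x. ennreal (r x)) = N"
proof -
  interpret M: sigma_finite_measure M by fact
  have ac: "absolutely_continuous M N"
    unfolding absolutely_continuous_def
  proof
    fix E assume E: "E \<in> null_sets M"
    have Eb: "E \<in> sets borel" using null_setsD2[OF E] unfolding s .
    have "emeasure N E = 0" using le[OF Eb] null_setsD1[OF E] by simp
    then show "E \<in> null_sets N" using Eb by (intro null_setsI) (simp_all add: s)
  qed
  have ss: "sets N = sets M" unfolding s ..
  define r where "r x = enn2real (RN_deriv M N x)" for x
  have rb: "RN_deriv M N \<in> borel_measurable borel"
    using borel_measurable_RN_deriv[of M N] by (simp only: measurable_cong_sets[OF s(1) refl])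
  then have 1: "r \<in> borel_measurable borel" unfolding r_def by measurable
  have "density M (\<lambda>x. ennreal (r x)) = density M (RN_deriv M N)"
  proof (rule density_cong)
    show "(\<lambda>x. ennreal (r x)) \<in> borel_measurable M" using 1 by (simp add: measurable_cong_sets[OF s(1) refl])
    show "AE x in M. ennreal (r x) = RN_deriv M N x"
      using M.RN_deriv_finite[OF N ac ss]
      by eventually_elim (simp add: r_def ennreal_enn2real_if)
  qed simp
  also have "\<dots> = N" by (rule M.density_RN_deriv[OF ac ss])
  finally show ?thesis using 1 by (intro exI[of _ r]) (simp add: r_def)
qed

text \<open>A density of \<open>\<mu>\<close> that takes values in \<open>S\<close> everywhere and may replace the polar density and the
  total variation in all the integrals of the theory.\<close>

definition matrix_density ::
  "ereal \<Rightarrow> (real set \<Rightarrow> complex^2^2) \<Rightarrow> real measure \<Rightarrow> (complex^2^2) set \<Rightarrow> (real \<Rightarrow> complex^2^2) \<Rightarrow> bool"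
  where "matrix_density b \<mu> M S h \<longleftrightarrow> h \<in> borel_measurable borel \<and> (\<forall>x. h x \<in> S) \<and>
    (\<forall>E \<in> local_sets b. set_integrable M E h \<and> \<mu> E = (LINT x:E|M. h x)) \<and>
    (\<forall>E u. E \<in> sets borel \<longrightarrow> (\<lambda>x. indicator E x *\<^sub>R u x) \<in> borel_measurable borel \<longrightarrow>
      apply_measure b \<mu> u E = (LINT x:E|M. h x *v u x)) \<and>
    (\<forall>X u. X \<in> sets borel \<longrightarrow> (\<lambda>x. indicator X x *\<^sub>R u x) \<in> borel_measurable borel \<longrightarrow>
      norm2_on b \<mu> X u = (\<integral>\<^sup>+x\<in>X. ennreal (Re (quad_form (h x) (u x))) \<partial>M))"

lemma matrix_densityD:
  assumes "matrix_density b \<mu> M S h"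
  shows "h \<in> borel_measurable borel" "h x \<in> S"
    and "E \<in> local_sets b \<Longrightarrow> set_integrable M E h"
    and "E \<in> local_sets b \<Longrightarrow> \<mu> E = (LINT x:E|M. h x)"
    and "E \<in> sets borel \<Longrightarrow> (\<lambda>x. indicator E x *\<^sub>R u x) \<in> borel_measurable borel \<Longrightarrow>
      apply_measure b \<mu> u E = (LINT x:E|M. h x *v u x)"
    and "E \<in> sets borel \<Longrightarrow> (\<lambda>x. indicator E x *\<^sub>R u x) \<in> borel_measurable borel \<Longrightarrow>
      norm2_on b \<mu> E u = (\<integral>\<^sup>+x\<in>E. ennreal (Re (quad_form (h x) (u x))) \<partial>M)"
  using assms unfolding matrix_density_def by blast+

text \<open>Transport of a polar density along a change of the reference measure, followed by a
  correction on a null set that puts all its values into the cone \<open>S\<close>.\<close>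

lemma density_change_of_measure:
  fixes \<mu> :: "real set \<Rightarrow> complex^2^2"
  assumes b: "0 < b" and m: "local_measure b \<mu>" "finite_near_0 b \<mu>"
    and M: "sigma_finite_measure M" and s: "sets M = sets borel"
    and out: "emeasure M (- einterval 0 b) = 0"
    and le: "\<forall>E \<in> sets borel. emeasure (total_variation b \<mu>) E \<le> emeasure M E"
    and val: "\<forall>E \<in> local_sets b. \<mu> E \<in> S"
    and S: "closed S" "0 \<in> S" "\<forall>a\<ge>0. \<forall>x\<in>S. a *\<^sub>R x \<in> S"
  shows "\<exists>h. matrix_density b \<mu> M S h"
proof -
  let ?T = "total_variation b \<mu>" and ?p = "polar_density b \<mu>"
  note [measurable_cong] = s
  obtain r where r: "r \<in> borel_measurable borel" "\<And>x. 0 \<le> r x" "density M (\<lambda>x. ennreal (r x)) = ?T"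
    using dominated_real_density[OF M sigma_finite_total_variation[OF b m] s sets_total_variation] le by blast
  have rM: "r \<in> borel_measurable M" using r(1) by (simp add: measurable_cong_sets[OF s refl])
  have p: "?p \<in> borel_measurable borel" by (rule borel_measurable_polar_density[OF b m])
  have pM: "?p \<in> borel_measurable M" using p by (simp add: measurable_cong_sets[OF s refl])
  define h0 where "h0 x = r x *\<^sub>R ?p x" for x
  \<comment> \<open>the polar density is only almost everywhere in the cone\<close>
  define h where "h x = (if h0 x \<in> S then h0 x else 0)" for x
  have h0: "h0 \<in> borel_measurable borel" unfolding h0_def using r(1) p by measurable
  have h: "h \<in> borel_measurable borel"
  proof -
    have [measurable]: "Measurable.pred borel (\<lambda>x. h0 x \<in> S)"
      using h0 S(1) by (intro pred_sets2[OF borel_closed]) auto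
    show ?thesis unfolding h_def using h0 by measurable
  qed
  have int_T: "integrable ?T f \<longleftrightarrow> integrable M (\<lambda>x. r x *\<^sub>R f x)"
    and lint_T: "(LINT x|?T. f x) = (LINT x|M. r x *\<^sub>R f x)" if "f \<in> borel_measurable borel"
    for f :: "real \<Rightarrow> 'z::{banach, second_countable_topology}"
  proof -
    have fM: "f \<in> borel_measurable M" using that by (simp add: measurable_cong_sets[OF s refl])
    show "integrable ?T f \<longleftrightarrow> integrable M (\<lambda>x. r x *\<^sub>R f x)"
      using r fM rM unfolding r(3)[symmetric] by (intro integrable_density) auto
    show "(LINT x|?T. f x) = (LINT x|M. r x *\<^sub>R f x)"
      using r fM rM unfolding r(3)[symmetric] by (intro integral_density) auto
  qed
  have h0_int: "set_integrable M E h0" and h0_val: "(LINT x:E|M. h0 x) = \<mu> E" if E: "E \<in> local_sets b" for E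
  proof -
    have eq: "r x *\<^sub>R indicator E x *\<^sub>R ?p x = indicator E x *\<^sub>R h0 x" for x
      unfolding h0_def by simp
    have me: "(\<lambda>x. indicator E x *\<^sub>R ?p x) \<in> borel_measurable borel"
      using p local_sets_borel[OF E] by measurable
    show "set_integrable M E h0"
      using set_integrable_polar_density[OF b m E] int_T[OF me] unfolding set_integrable_def eq by simp
    show "(LINT x:E|M. h0 x) = \<mu> E"
      using set_integral_polar_density[OF b m E] lint_T[OF me] unfolding set_lebesgue_integral_def eq by simp
  qed
  have ae0: "AE x in M. h0 x \<in> S"
    by (rule density_in_cone[OF b s M out h0 h0_int _ S(1)]) (use h0_val val S(3) in auto)
  have ae: "AE x in M. h0 x = h x"
    using ae0 by eventually_elim (simp add: h_def)
  show ?thesis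
    unfolding matrix_density_def
  proof (intro exI[of _ h] conjI allI ballI impI)
    show "h \<in> borel_measurable borel" by fact
    show "h x \<in> S" for x unfolding h_def using S(2) by simp
    fix E assume E: "E \<in> local_sets b"
    have m1: "(\<lambda>x. indicator E x *\<^sub>R h0 x) \<in> borel_measurable M"
      "(\<lambda>x. indicator E x *\<^sub>R h x) \<in> borel_measurable M"
      using h h0 local_sets_borel[OF E] by measurable
    have ae1: "AE x in M. indicator E x *\<^sub>R h0 x = indicator E x *\<^sub>R h x"
      using ae by eventually_elim simp
    show "set_integrable M E h"
      using h0_int[OF E] integrable_cong_AE[OF m1 ae1] unfolding set_integrable_def by simp
    show "\<mu> E = (LINT x:E|M. h x)"
      using h0_val[OF E] integral_cong_AE[OF m1 ae1] unfolding set_lebesgue_integral_def by simp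
  next
    fix E and u :: "real \<Rightarrow> complex^2"
    assume E: "E \<in> sets borel" and u: "(\<lambda>x. indicator E x *\<^sub>R u x) \<in> borel_measurable borel"
    have m1: "(\<lambda>x. A x *v (indicator E x *\<^sub>R u x)) \<in> borel_measurable borel"
      if "A \<in> borel_measurable borel" for A :: "real \<Rightarrow> complex^2^2"
      using that u by (rule borel_measurable_matrix_vector_mult)
    have "apply_measure b \<mu> u E = (LINT x|?T. ?p x *v (indicator E x *\<^sub>R u x))"
      unfolding apply_measure_def set_lebesgue_integral_def by (simp add: mv.scaleR_right)
    also have "\<dots> = (LINT x|M. h0 x *v (indicator E x *\<^sub>R u x))"
      unfolding lint_T[OF m1[OF p]] h0_def by (simp add: mv.scaleR_left)
    also have "\<dots> = (LINT x|M. h x *v (indicator E x *\<^sub>R u x))"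
    proof (rule integral_cong_AE)
      show "AE x in M. h0 x *v (indicator E x *\<^sub>R u x) = h x *v (indicator E x *\<^sub>R u x)"
        using ae by eventually_elim simp
    qed (use m1[OF h] m1[OF h0] in \<open>simp_all add: measurable_cong_sets[OF s refl]\<close>)
    finally show "apply_measure b \<mu> u E = (LINT x:E|M. h x *v u x)"
      unfolding set_lebesgue_integral_def by (simp add: mv.scaleR_right)
  next
    fix X and u :: "real \<Rightarrow> complex^2"
    assume X: "X \<in> sets borel" and u: "(\<lambda>x. indicator X x *\<^sub>R u x) \<in> borel_measurable borel"
    have q1: "ennreal (Re (quad_form A (indicator X x *\<^sub>R v))) = ennreal (Re (quad_form A v)) * indicator X x" for A v x
      by (cases "x \<in> X") (simp_all add: quad_form_def)
    have m1: "(\<lambda>x. ennreal (Re (quad_form (?p x) (indicator X x *\<^sub>R u x)))) \<in> borel_measurable borel"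
      using borel_measurable_quad_form[OF p u] by measurable
    have "norm2_on b \<mu> X u = (\<integral>\<^sup>+x. ennreal (Re (quad_form (?p x) (indicator X x *\<^sub>R u x))) \<partial>?T)"
      unfolding norm2_on_def q1 ..
    also have "\<dots> = (\<integral>\<^sup>+x. ennreal (r x) * ennreal (Re (quad_form (?p x) (indicator X x *\<^sub>R u x))) \<partial>M)"
      unfolding r(3)[symmetric] using rM m1
      by (intro nn_integral_density) (simp_all add: measurable_cong_sets[OF s refl])
    also have "\<dots> = (\<integral>\<^sup>+x. ennreal (Re (quad_form (h0 x) (indicator X x *\<^sub>R u x))) \<partial>M)"
      unfolding h0_def using r(2)
      by (simp add: quad_form_scaleR_left ennreal_mult')
    also have "\<dots> = (\<integral>\<^sup>+x. ennreal (Re (quad_form (h x) (indicator X x *\<^sub>R u x))) \<partial>M)"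
      using ae by (intro nn_integral_cong_AE) (auto elim!: eventually_mono)
    finally show "norm2_on b \<mu> X u = (\<integral>\<^sup>+x\<in>X. ennreal (Re (quad_form (h x) (u x))) \<partial>M)"
      unfolding q1 .
  qed
qed

text \<open>The reference measure is \<open>|q| + |w|\<close>, which dominates both total variations.\<close>

theorem density_system_exists:
  assumes b: "0 < b"
    and q: "local_measure b q" "hermitian_measure b q" "finite_near_0 b q"
    and w: "local_measure b w" "nonneg_measure b w" "finite_near_0 b w"
  shows "\<exists>\<nu> Q W. density_system b q w \<nu> Q W"
proof -
  let ?S = "{A. conj_transpose A = A}" and ?P = "{A. conj_transpose A = A \<and> (\<forall>v. 0 \<le> Re (quad_form A v))}"
  let ?q = "total_variation b q" and ?w = "total_variation b w"
  let ?n = "\<lambda>E. emeasure ?q E + emeasure ?w E"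
  define \<nu> where "\<nu> = measure_of UNIV (sets borel) ?n"
  have s: "sets \<nu> = sets borel" unfolding \<nu>_def by (rule sets_measure_of_borel)
  have em: "emeasure \<nu> E = ?n E" if "E \<in> sets borel" for E
    unfolding \<nu>_def
  proof (rule emeasure_measure_of_borel[OF _ _ that])
    fix A :: "nat \<Rightarrow> real set"
    assume A: "range A \<subseteq> sets borel" "disjoint_family A"
    then show "(\<Sum>n. ?n (A n)) = ?n (\<Union>n. A n)"
      using suminf_emeasure[of A ?q] suminf_emeasure[of A ?w]
      by (subst suminf_add[symmetric]) simp_all
  qed simp
  have fin0: "emeasure \<nu> {0<..<c} < \<infinity>" if "0 < c" "ereal c < b" for c
    using q(3) w(3) that unfolding finite_near_0_def by (simp add: em)
  have out: "emeasure \<nu> (- einterval 0 b) = 0"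
    using total_variation_outside[OF b q(1)] total_variation_outside[OF b w(1)]
    by (subst em) (auto intro!: borel_comp)
  have sf: "sigma_finite_measure \<nu>" by (rule local_sigma_finite[OF b s fin0 out])
  have cS: "\<forall>a\<ge>0. \<forall>A\<in>?S. a *\<^sub>R A \<in> ?S"
    by (simp add: conj_transpose_scaleR)
  have cP: "\<forall>a\<ge>0. \<forall>A\<in>?P. a *\<^sub>R A \<in> ?P"
    by (simp add: conj_transpose_scaleR quad_form_scaleR_left)
  have zS: "0 \<in> ?S" by simp
  have zP: "0 \<in> ?P" by (simp add: quad_form_def)
  have lq: "\<forall>E \<in> sets borel. emeasure ?q E \<le> emeasure \<nu> E"
    and lw: "\<forall>E \<in> sets borel. emeasure ?w E \<le> emeasure \<nu> E"
    by (simp_all add: em)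
  have vq: "\<forall>E \<in> local_sets b. q E \<in> ?S" and vw: "\<forall>E \<in> local_sets b. w E \<in> ?P"
    using q(2) w(2) unfolding nonneg_measure_def hermitian_measure_def by auto
  obtain Q where Q: "matrix_density b q \<nu> ?S Q"
    using density_change_of_measure[OF b q(1,3) sf s out lq vq closed_hermitian zS cS] by blast
  obtain W where W: "matrix_density b w \<nu> ?P W"
    using density_change_of_measure[OF b w(1,3) sf s out lw vw closed_nonneg_hermitian zP cP] by blast
  have "density_system b q w \<nu> Q W"
  proof (rule density_system.intro)
    show "0 < b" "sets \<nu> = sets borel" "sigma_finite_measure \<nu>" by fact+
  next
    fix E assume E: "E \<in> local_sets b"
    show "emeasure \<nu> E < \<infinity>" by (rule emeasure_local_finite[OF s fin0 E])
    show "set_integrable \<nu> E Q" "set_integrable \<nu> E W"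
      "q E = (LINT x:E|\<nu>. Q x)" "w E = (LINT x:E|\<nu>. W x)"
      using matrix_densityD(3,4)[OF Q E] matrix_densityD(3,4)[OF W E] by auto
    fix u :: "real \<Rightarrow> complex^2"
    assume u: "(\<lambda>x. indicator E x *\<^sub>R u x) \<in> borel_measurable borel"
    show "apply_measure b q u E = (LINT x:E|\<nu>. Q x *v u x)"
      "apply_measure b w u E = (LINT x:E|\<nu>. W x *v u x)"
      using matrix_densityD(5)[OF Q local_sets_borel[OF E] u]
        matrix_densityD(5)[OF W local_sets_borel[OF E] u] by auto
  next
    fix X and u :: "real \<Rightarrow> complex^2"
    assume X: "X \<in> sets borel" "(\<lambda>x. indicator X x *\<^sub>R u x) \<in> borel_measurable borel"
    show "norm2_on b w X u = (\<integral>\<^sup>+x\<in>X. ennreal (Re (quad_form (W x) (u x))) \<partial>\<nu>)"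
      by (rule matrix_densityD(6)[OF W X])
  qed (use matrix_densityD(1,2)[OF Q] matrix_densityD(1,2)[OF W] in auto)
  then show ?thesis by blast
qed

section \<open>Functions of locally bounded variation\<close>

text \<open>\<open>V x\<close> is the variation of \<open>u\<close> on \<open>[a,x]\<close>: a partition of \<open>[a,x]\<close>, prolonged by the points
  \<open>x\<close> and \<open>y\<close>, is a partition of \<open>[a,y]\<close>. One-sided limits and measurability of \<open>u\<close> are inherited
  from this monotone function.\<close>

lemma BV_dominated_by_monotone:
  fixes u :: "real \<Rightarrow> 'a::real_normed_vector"
  assumes K: "\<And>n t. mono (t :: nat \<Rightarrow> real) \<Longrightarrow> range t \<subseteq> {a..c} \<Longrightarrow>
    (\<Sum>i<n. norm (u (t (Suc i)) - u (t i))) \<le> K"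
  obtains V :: "real \<Rightarrow> real" where "\<And>x y. a \<le> x \<Longrightarrow> x \<le> y \<Longrightarrow> y \<le> c \<Longrightarrow> norm (u y - u x) \<le> V y - V x"
proof -
  define T where "T y = {\<Sum>i<n. norm (u (t (Suc i)) - u (t i)) | n t. mono (t :: nat \<Rightarrow> real) \<and> range t \<subseteq> {a..y}}" for y
  define V where "V y = Sup (T y)" for y
  have bdd: "bdd_above (T y)" if "y \<le> c" for y
  proof (rule bdd_aboveI)
    fix s assume "s \<in> T y"
    then obtain n t where "s = (\<Sum>i<n. norm (u (t (Suc i)) - u (t i)))" "mono (t :: nat \<Rightarrow> real)" "range t \<subseteq> {a..y}"
      unfolding T_def by blast
    moreover from this(3) have "range t \<subseteq> {a..c}" using that by (auto simp: image_subset_iff intro: order_trans)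
    ultimately show "s \<le> K" using K by blast
  qed
  have ne: "T y \<noteq> {}" if "a \<le> y" for y
  proof -
    have "mono (\<lambda>n::nat. a)" "range (\<lambda>n::nat. a) \<subseteq> {a..y}" using that by (auto simp: mono_def)
    then show ?thesis unfolding T_def by blast
  qed
  have "norm (u y - u x) \<le> V y - V x" if xy: "a \<le> x" "x \<le> y" "y \<le> c" for x y
  proof -
    have "s \<le> V y - norm (u y - u x)" if s: "s \<in> T x" for s
    proof -
      obtain n t where t: "s = (\<Sum>i<n. norm (u (t (Suc i)) - u (t i)))" "mono (t :: nat \<Rightarrow> real)" "range t \<subseteq> {a..x}"
        using s unfolding T_def by blast
      \<comment> \<open>follow \<open>t\<close> for \<open>n\<close> steps, then visit \<open>x\<close> and stay at \<open>y\<close>\<close>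
      define t' where "t' i = (if i \<le> n then t i else if i = Suc n then x else y)" for i
      have tx: "a \<le> t i" "t i \<le> x" for i using t(3) by (auto simp: image_subset_iff)
      have "t' i \<le> t' (Suc i)" for i
        using monoD[OF t(2), of i "Suc i"] tx[of i] xy unfolding t'_def by auto
      then have "mono t'" by (simp add: mono_iff_le_Suc)
      moreover have "range t' \<subseteq> {a..y}"
        using tx xy order_trans[OF tx(2) xy(2)] unfolding t'_def by auto
      ultimately have "(\<Sum>i<Suc (Suc n). norm (u (t' (Suc i)) - u (t' i))) \<in> T y"
        unfolding T_def by blast
      then have "(\<Sum>i<Suc (Suc n). norm (u (t' (Suc i)) - u (t' i))) \<le> V y"
        unfolding V_def by (intro cSup_upper bdd xy)
      moreover have "(\<Sum>i<n. norm (u (t' (Suc i)) - u (t' i))) = s"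
        unfolding t(1) by (intro sum.cong refl) (auto simp: t'_def)
      ultimately have "s + norm (u x - u (t n)) + norm (u y - u x) \<le> V y"
        by (simp add: t'_def)
      then show ?thesis using norm_ge_zero[of "u x - u (t n)"] by linarith
    qed
    then have "V x \<le> V y - norm (u y - u x)"
      unfolding V_def[of x] by (intro cSup_least ne xy) auto
    then show ?thesis by simp
  qed
  then show ?thesis by (rule that)
qed

lemma convergent_of_Cauchy_filter:
  fixes f :: "real \<Rightarrow> 'a::{banach}"
  assumes F: "F \<noteq> bot"
    and c: "\<And>e. 0 < e \<Longrightarrow> \<exists>P. eventually P F \<and> (\<forall>x y. P x \<and> P y \<longrightarrow> dist (f x) (f y) < e)"
  shows "\<exists>L. (f \<longlongrightarrow> L) F"
proof -
  have "cauchy_filter (filtermap f F)" unfolding cauchy_filter_metric_filtermap using c by blast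
  then have "\<exists>L. filtermap f F \<le> nhds L"
    by (rule cauchy_filter_complete_converges[OF _ complete_UNIV])
      (use F in \<open>auto simp: filtermap_bot_iff\<close>)
  then show ?thesis unfolding filterlim_def .
qed

lemma right_limit_exists:
  fixes u :: "real \<Rightarrow> 'a::banach"
  assumes V: "\<And>x y. a \<le> x \<Longrightarrow> x \<le> y \<Longrightarrow> y \<le> c \<Longrightarrow> norm (u y - u x) \<le> V y - V x"
    and x: "a \<le> x" "x < c"
  shows "\<exists>L. (u \<longlongrightarrow> L) (at_right x)"
proof (rule convergent_of_Cauchy_filter)
  have mono: "V s \<le> V t" if "a \<le> s" "s \<le> t" "t \<le> c" for s t
    using V[OF that] norm_ge_zero[of "u t - u s"] by linarith
  define I where "I = Inf (V ` {x<..c})"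
  have bdd: "bdd_below (V ` {x<..c})"
    by (rule bdd_belowI2[of _ "V x"]) (use x mono in auto)
  fix e :: real assume e: "0 < e"
  have "\<exists>s\<in>V ` {x<..c}. s < I + e"
    using e x bdd by (subst cInf_less_iff[symmetric]) (auto simp: I_def)
  then obtain y where y: "x < y" "y \<le> c" "V y < I + e" by auto
  have I: "I \<le> V s" if "x < s" "s \<le> c" for s
    unfolding I_def using that bdd by (intro cInf_lower) auto
  have *: "dist (u s) (u t) < e" if "s \<in> {x<..<y}" "t \<in> {x<..<y}" "s \<le> t" for s t
  proof -
    have "dist (u s) (u t) \<le> V t - V s"
      using V[of s t] that x y by (simp add: dist_norm norm_minus_commute)
    moreover have "V t \<le> V y" using that x y by (intro mono) auto
    moreover have "I \<le> V s" using that y by (intro I) auto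
    ultimately show ?thesis using y by linarith
  qed
  show "\<exists>P. eventually P (at_right x) \<and> (\<forall>s t. P s \<and> P t \<longrightarrow> dist (u s) (u t) < e)"
  proof (intro exI[of _ "\<lambda>s. s \<in> {x<..<y}"] conjI allI impI)
    show "eventually (\<lambda>s. s \<in> {x<..<y}) (at_right x)"
      using y by (intro eventually_at_right_real)
    fix s t assume "s \<in> {x<..<y} \<and> t \<in> {x<..<y}"
    then show "dist (u s) (u t) < e"
      using *[of s t] *[of t s] by (cases "s \<le> t") (auto simp: dist_commute)
  qed
qed simp

lemma left_limit_exists:
  fixes u :: "real \<Rightarrow> 'a::banach"
  assumes V: "\<And>x y. a \<le> x \<Longrightarrow> x \<le> y \<Longrightarrow> y \<le> c \<Longrightarrow> norm (u y - u x) \<le> V y - V x"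
    and x: "a < x" "x \<le> c"
  shows "\<exists>L. (u \<longlongrightarrow> L) (at_left x)"
proof -
  have "\<exists>L. ((\<lambda>t. u (- t)) \<longlongrightarrow> L) (at_right (- x))"
  proof (rule right_limit_exists[where V = "\<lambda>t. - V (- t)"])
    fix s t assume "- c \<le> s" "s \<le> t" "t \<le> - a"
    then show "norm (u (- t) - u (- s)) \<le> - V (- t) - - V (- s)"
      using V[of "- t" "- s"] by (simp add: norm_minus_commute)
  qed (use x in auto)
  then show ?thesis
    by (simp add: filterlim_at_left_to_right)
qed

lemma borel_measurable_dominated_by_monotone:
  fixes u :: "real \<Rightarrow> 'a::euclidean_space"
  assumes V: "\<And>x y. a \<le> x \<Longrightarrow> x \<le> y \<Longrightarrow> y \<le> c \<Longrightarrow> norm (u y - u x) \<le> V y - V x"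
  shows "(\<lambda>x. indicator {a..c} x *\<^sub>R u x) \<in> borel_measurable borel"
proof -
  let ?R = "restrict_space borel {a..c}"
  have "(\<lambda>x. u x \<bullet> i) \<in> borel_measurable ?R" if i: "i \<in> Basis" for i
  proof -
    have *: "\<bar>u y \<bullet> i - u x \<bullet> i\<bar> \<le> V y - V x" if "a \<le> x" "x \<le> y" "y \<le> c" for x y
      using order_trans[OF Basis_le_norm[OF i, of "u y - u x"] V[OF that]] by (simp add: inner_diff_left)
    have "mono_on {a..c} (\<lambda>x. u x \<bullet> i + V x)" "mono_on {a..c} V"
      using * by (auto simp: mono_on_def abs_le_iff) (smt (verit, ccfv_SIG))+
    then have "(\<lambda>x. (u x \<bullet> i + V x) - V x) \<in> borel_measurable ?R"
      by (intro borel_measurable_diff borel_measurable_mono_on_fnc)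
    then show ?thesis by simp
  qed
  then have "u \<in> borel_measurable ?R" by (subst borel_measurable_euclidean_space) blast
  then show ?thesis by (subst borel_measurable_restrict_space_iff[symmetric]) auto
qed

lemma locally_BV_dominated:
  assumes "locally_BV b u" "0 < a" "ereal c < b"
  obtains V :: "real \<Rightarrow> real" where "\<And>x y. a \<le> x \<Longrightarrow> x \<le> y \<Longrightarrow> y \<le> c \<Longrightarrow> norm (u y - u x) \<le> V y - V x"
proof -
  obtain K where K: "\<And>n t. mono (t :: nat \<Rightarrow> real) \<Longrightarrow> range t \<subseteq> {a..c} \<Longrightarrow>
    (\<Sum>i<n. norm (u (t (Suc i)) - u (t i))) \<le> K"
    using assms unfolding locally_BV_def by meson
  from BV_dominated_by_monotone[of a c u K, OF K] that show ?thesis by blast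
qed

lemma locally_BV_right_lim:
  assumes u: "locally_BV b u" and x: "0 < x" "ereal x < b"
  shows "(u \<longlongrightarrow> right_lim u x) (at_right x)"
proof -
  obtain c where c: "x < c" "ereal c < b" using ereal_dense2[OF x(2)] by auto
  obtain V where "\<And>s t. x \<le> s \<Longrightarrow> s \<le> t \<Longrightarrow> t \<le> c \<Longrightarrow> norm (u t - u s) \<le> V t - V s"
    using locally_BV_dominated[OF u x(1) c(2)] by metis
  from right_limit_exists[of x c u V, OF this] c obtain L where "(u \<longlongrightarrow> L) (at_right x)" by auto
  then show ?thesis unfolding right_lim_def using tendsto_Lim[of "at_right x" u L] by simp
qed

text \<open>Values of \<open>right_lim u\<close> near the limit point are limits of values of \<open>u\<close> that are still near it;
  this is the meaning of the second hypothesis.\<close>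

lemma tendsto_right_lim:
  fixes u :: "real \<Rightarrow> 'a::metric_space"
  assumes L: "(u \<longlongrightarrow> L) F"
    and ev: "\<And>P. eventually P F \<Longrightarrow> eventually (\<lambda>t. eventually P (at_right t)) F"
    and lim: "eventually (\<lambda>t. (u \<longlongrightarrow> right_lim u t) (at_right t)) F"
  shows "(right_lim u \<longlongrightarrow> L) F"
proof (rule tendstoI)
  fix e :: real assume e: "0 < e"
  have "eventually (\<lambda>t. eventually (\<lambda>s. dist (u s) L < e/2) (at_right t)) F"
    using e by (intro ev tendstoD[OF L]) simp
  with lim show "eventually (\<lambda>t. dist (right_lim u t) L < e) F"
  proof eventually_elim
    case (elim t)
    have "eventually (\<lambda>s. dist (u s) L \<le> e/2) (at_right t)"
      using elim(2) by eventually_elim simp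
    then have "dist (right_lim u t) L \<le> e/2"
      by (rule tendsto_upperbound[OF tendsto_dist[OF elim(1) tendsto_const]]) simp
    then show ?case using e by simp
  qed
qed

lemma locally_BV_left_lim:
  assumes u: "locally_BV b u" and x: "0 < x" "ereal x < b"
  shows "(u \<longlongrightarrow> left_lim u x) (at_left x)"
proof -
  obtain V where "\<And>s t. x/2 \<le> s \<Longrightarrow> s \<le> t \<Longrightarrow> t \<le> x \<Longrightarrow> norm (u t - u s) \<le> V t - V s"
    using locally_BV_dominated[OF u, of "x/2" x] x by auto
  from left_limit_exists[of "x/2" x u V x, OF this] x obtain L where "(u \<longlongrightarrow> L) (at_left x)" by auto
  then show ?thesis unfolding left_lim_def using tendsto_Lim[of "at_left x" u L] by simp
qed

lemma locally_BV_bounded: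
  assumes u: "locally_BV b u" and x: "0 < a" "ereal c < b"
  obtains M where "0 \<le> M" "\<And>x. x \<in> {a..c} \<Longrightarrow> norm (u x) \<le> M"
proof -
  obtain V where V: "\<And>s t. a \<le> s \<Longrightarrow> s \<le> t \<Longrightarrow> t \<le> c \<Longrightarrow> norm (u t - u s) \<le> V t - V s"
    using locally_BV_dominated[OF u x] by metis
  have "norm (u t) \<le> \<bar>norm (u a) + V c - V a\<bar>" if "t \<in> {a..c}" for t
  proof -
    have "norm (u t - u a) \<le> V t - V a" "norm (u c - u t) \<le> V c - V t" using V that by auto
    then show ?thesis
      using norm_triangle_sub[of "u t" "u a"] norm_ge_zero[of "u c - u t"] by linarith
  qed
  then show ?thesis by (intro that[of "\<bar>norm (u a) + V c - V a\<bar>"]) auto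
qed

lemma locally_BV_borel:
  assumes b: "0 < b" and u: "locally_BV b u" and E: "E \<in> sets borel" "E \<subseteq> einterval 0 b"
  shows "(\<lambda>x. indicator E x *\<^sub>R u x) \<in> borel_measurable borel"
proof -
  obtain r l :: "nat \<Rightarrow> real" where
    ul: "einterval 0 b = (\<Union>i. {l i..r i})" "incseq r" "decseq l" "\<And>i. 0 < l i" "\<And>i. ereal (r i) < b"
    by (rule local_exhaustion[OF b]) (rule that; assumption)
  have "(\<lambda>x. indicator {l i..r i} x *\<^sub>R u x) \<in> borel_measurable borel" for i
  proof -
    obtain V where "\<And>s t. l i \<le> s \<Longrightarrow> s \<le> t \<Longrightarrow> t \<le> r i \<Longrightarrow> norm (u t - u s) \<le> V t - V s"
      using locally_BV_dominated[OF u, of "l i" "r i"] ul(4,5)[of i] by auto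
    then show ?thesis by (rule borel_measurable_dominated_by_monotone)
  qed
  then have m: "(\<lambda>x. indicator E x *\<^sub>R indicator {l i..r i} x *\<^sub>R u x) \<in> borel_measurable borel" for i
    using E(1) by measurable
  show ?thesis
  proof (rule borel_measurable_LIMSEQ_metric[OF m])
    fix x
    show "(\<lambda>i. indicator E x *\<^sub>R indicator {l i..r i} x *\<^sub>R u x) \<longlonglongrightarrow> indicator E x *\<^sub>R u x"
    proof (cases "x \<in> E")
      case True
      then obtain i where i: "x \<in> {l i..r i}" using E(2) ul(1) by blast
      have "indicator E x *\<^sub>R indicator {l j..r j} x *\<^sub>R u x = indicator E x *\<^sub>R u x" if "i \<le> j" for j
        using i incseqD[OF ul(2) that] decseqD[OF ul(3) that] by (auto simp: indicator_def)
      then have "\<forall>\<^sub>F j in sequentially. indicator E x *\<^sub>R indicator {l j..r j} x *\<^sub>R u x = indicator E x *\<^sub>R u x"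
        by (auto simp: eventually_sequentially)
      then show ?thesis by (rule tendsto_eventually)
    qed simp
  qed
qed

section \<open>Solutions: integral form, jump condition and uniqueness\<close>

lemma mat_vector_mult: "mat z *v v = z *s (v :: complex^2)"
  by (simp add: matrix_vector_mult_def mat_def vec_eq_iff sum_2 forall_2)

lemma Jmat_mult: "Jmat *v v = vector [- (v $ 2), v $ 1]"
  by (simp add: Jmat_def matrix_vector_mult_def vec_eq_iff sum_2 forall_2)

lemma Jmat_mult_nth [simp]: "(Jmat *v v) $ 1 = - (v $ 2)" "(Jmat *v v) $ 2 = v $ 1"
  by (simp_all add: Jmat_mult)

lemma Jmat_Jmat: "Jmat *v (Jmat *v v) = - v"
  by (simp add: vec_eq_iff forall_2)

lemma vmult_scaleR: "z *s (a *\<^sub>R v) = a *\<^sub>R (z *s (v :: complex^2))"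
  by (simp add: vec_eq_iff)

lemma set_integral_matrix_mult:
  fixes f :: "real \<Rightarrow> complex^2" and A :: "complex^2^2"
  assumes "set_integrable M E f"
  shows "set_integrable M E (\<lambda>x. A *v f x)" "(LINT x:E|M. A *v f x) = A *v (LINT x:E|M. f x)"
proof -
  have eq: "indicator E x *\<^sub>R (A *v f x) = A *v (indicator E x *\<^sub>R f x)" for x
    by (simp add: mv.scaleR_right)
  show "set_integrable M E (\<lambda>x. A *v f x)"
    using integrable_bounded_linear[OF mv.bounded_linear_right] assms unfolding set_integrable_def eq by blast
  show "(LINT x:E|M. A *v f x) = A *v (LINT x:E|M. f x)"
    using integral_bounded_linear[OF mv.bounded_linear_right] assms
    unfolding set_integrable_def set_lebesgue_integral_def eq by blast
qed

lemma set_integral_vmult: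
  fixes f :: "real \<Rightarrow> complex^2"
  assumes "set_integrable M E f"
  shows "set_integrable M E (\<lambda>x. z *s f x)" "(LINT x:E|M. z *s f x) = z *s (LINT x:E|M. f x)"
  using set_integral_matrix_mult[OF assms, of "mat z"] unfolding mat_vector_mult .

text \<open>The equation only concerns values in \<open>(0,b)\<close>; solutions may be altered outside.\<close>

lemma is_solution_cong:
  assumes u: "is_solution b q w z u" and uv: "\<And>x. x \<in> einterval 0 b \<Longrightarrow> u x = v x"
  shows "is_solution b q w z v"
    and "x \<in> einterval 0 b \<Longrightarrow> right_lim v x = right_lim u x"
    and "x \<in> einterval 0 b \<Longrightarrow> left_lim v x = left_lim u x"
proof -
  have BV: "locally_BV b u" and bal: "balanced b u" using u unfolding is_solution_def by auto
  have o: "open (einterval 0 b)" by simp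
  have r: "right_lim v x = right_lim u x" and l: "left_lim v x = left_lim u x"
    if x: "x \<in> einterval 0 b" for x
  proof -
    have "eventually (\<lambda>y. y \<in> einterval 0 b) (at x)" using o x by (rule eventually_at_in_open')
    then have ev: "eventually (\<lambda>y. u y = v y) (at x)" by eventually_elim (rule uv)
    have "(v \<longlongrightarrow> right_lim u x) (at_right x)"
    proof (rule Lim_transform_eventually)
      show "(u \<longlongrightarrow> right_lim u x) (at_right x)"
        using locally_BV_right_lim[OF BV, of x] x by (simp add: in_einterval_0)
      show "eventually (\<lambda>y. u y = v y) (at_right x)" using ev unfolding eventually_at_split by simp
    qed
    then show "right_lim v x = right_lim u x"
      unfolding right_lim_def[of v] by (intro tendsto_Lim) auto
    have "(v \<longlongrightarrow> left_lim u x) (at_left x)"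
    proof (rule Lim_transform_eventually)
      show "(u \<longlongrightarrow> left_lim u x) (at_left x)"
        using locally_BV_left_lim[OF BV, of x] x by (simp add: in_einterval_0)
      show "eventually (\<lambda>y. u y = v y) (at_left x)" using ev unfolding eventually_at_split by simp
    qed
    then show "left_lim v x = left_lim u x"
      unfolding left_lim_def[of v] by (intro tendsto_Lim) auto
  qed
  show "x \<in> einterval 0 b \<Longrightarrow> right_lim v x = right_lim u x" by (rule r)
  show "x \<in> einterval 0 b \<Longrightarrow> left_lim v x = left_lim u x" by (rule l)
  have inI: "t \<in> einterval 0 b" if "0 < a" "ereal c < b" "t \<in> {a..c}" for a c t :: real
    using that by (auto simp: in_einterval_0 intro: le_less_trans[of "ereal t" "ereal c"])
  have "locally_BV b v"
    unfolding locally_BV_def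
  proof (intro allI impI)
    fix a c :: real assume ac: "0 < a" "ereal c < b"
    then obtain K where K: "\<forall>n. \<forall>t :: nat \<Rightarrow> real. mono t \<longrightarrow> range t \<subseteq> {a..c} \<longrightarrow>
          (\<Sum>i<n. norm (u (t (Suc i)) - u (t i))) \<le> K"
      using BV unfolding locally_BV_def by blast
    have "(\<Sum>i<n. norm (v (t (Suc i)) - v (t i))) \<le> K" if t: "mono t" "range t \<subseteq> {a..c}" for n t
    proof -
      have "v (t i) = u (t i)" for i using t(2) inI[OF ac] uv by (metis range_subsetD)
      then show ?thesis using K t by simp
    qed
    then show "\<exists>K. \<forall>n. \<forall>t :: nat \<Rightarrow> real. mono t \<longrightarrow> range t \<subseteq> {a..c} \<longrightarrow>
          (\<Sum>i<n. norm (v (t (Suc i)) - v (t i))) \<le> K" by blast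
  qed
  moreover have "balanced b v" using bal uv r l unfolding balanced_def by metis
  moreover have "\<exists>dv. derivative_measure b v dv \<and>
        (\<forall>E \<in> local_sets b. Jmat *v dv E + apply_measure b q v E = z *s apply_measure b w v E)"
  proof -
    obtain du where du: "derivative_measure b u du"
      "\<And>E. E \<in> local_sets b \<Longrightarrow> Jmat *v du E + apply_measure b q u E = z *s apply_measure b w u E"
      using u unfolding is_solution_def by blast
    have "derivative_measure b v du"
      unfolding derivative_measure_def
    proof (intro conjI allI impI)
      fix x y :: real assume xy: "0 < x" "x < y" "ereal y < b"
      have "x \<in> einterval 0 b" "y \<in> einterval 0 b"
        using xy inI[of x y] by auto
      then show "du {x<..y} = right_lim v y - right_lim v x"
        using xy du(1) unfolding derivative_measure_def by (simp add: r)
    qed (use du(1) in \<open>simp add: derivative_measure_def\<close>)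
    moreover have "apply_measure b \<mu> v E = apply_measure b \<mu> u E" if "E \<in> local_sets b" for E \<mu>
    proof -
      have "indicator E x *\<^sub>R (A *v v x) = indicator E x *\<^sub>R (A *v u x)" for x and A :: "complex^2^2"
        using uv local_sets_subset_einterval[OF that] by (cases "x \<in> E") auto
      then show ?thesis unfolding apply_measure_def set_lebesgue_integral_def by presburger
    qed
    ultimately show ?thesis using du(2) by (intro exI[of _ du]) simp
  qed
  ultimately show "is_solution b q w z v" unfolding is_solution_def by blast
qed

context density_system
begin

text \<open>The density of \<open>u'\<close> with respect to \<open>\<nu>\<close> when \<open>u\<close> solves the equation; the factor
  \<open>J\<close> is \<open>- J\<^sup>-\<^sup>1\<close>.\<close>

definition derivative_density :: "complex \<Rightarrow> (real \<Rightarrow> complex^2) \<Rightarrow> real \<Rightarrow> complex^2" where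
  "derivative_density z u x = Jmat *v (Q x *v u x - z *s (W x *v u x))"

text \<open>An integrable majorant with \<open>|u'| \<le> bound_density \<cdot> |u|\<close>, the kernel of Gronwall's argument.\<close>

definition bound_density :: "complex \<Rightarrow> real \<Rightarrow> real" where
  "bound_density z x = norm (Jmat) * 4 * (4 * norm (Q x) + norm (mat z :: complex^2^2) * 16 * norm (W x))"

lemma bound_density_nonneg: "0 \<le> bound_density z x"
  unfolding bound_density_def by (intro mult_nonneg_nonneg add_nonneg_nonneg) auto

lemma bound_density_integrable: "E \<in> local_sets b \<Longrightarrow> set_integrable \<nu> E (bound_density z)"
  unfolding bound_density_def
  using Q_integrable[of E] W_integrable[of E]
  by (intro set_integrable_mult_right set_integral_add) (auto simp: set_integrable_norm)

lemma norm_derivative_density: "norm (derivative_density z u x) \<le> bound_density z x * norm (u x)"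
proof -
  have "norm (Q x *v u x - z *s (W x *v u x)) \<le> norm (Q x *v u x) + norm (mat z *v (W x *v u x))"
    unfolding mat_vector_mult by (rule norm_triangle_ineq4)
  also have "\<dots> \<le> 4 * norm (Q x) * norm (u x) + 4 * norm (mat z :: complex^2^2) * (4 * norm (W x) * norm (u x))"
    by (intro add_mono norm_matrix_vector_mult_le order_trans[OF norm_matrix_vector_mult_le] mult_left_mono) auto
  finally have 1: "norm (Q x *v u x - z *s (W x *v u x)) \<le>
    4 * norm (Q x) * norm (u x) + 4 * norm (mat z :: complex^2^2) * (4 * norm (W x) * norm (u x))" .
  have "norm (derivative_density z u x) \<le> 4 * norm Jmat * norm (Q x *v u x - z *s (W x *v u x))"
    unfolding derivative_density_def by (rule norm_matrix_vector_mult_le)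
  also have "\<dots> \<le> 4 * norm Jmat *
     (4 * norm (Q x) * norm (u x) + 4 * norm (mat z :: complex^2^2) * (4 * norm (W x) * norm (u x)))"
    by (intro mult_left_mono 1) auto
  also have "\<dots> = bound_density z x * norm (u x)"
    unfolding bound_density_def by (simp add: algebra_simps)
  finally show ?thesis .
qed

lemma set_integrable_density_times_BV:
  fixes A :: "real \<Rightarrow> complex^2^2"
  assumes u: "locally_BV b u" and E: "E \<in> local_sets b"
    and A: "A \<in> borel_measurable borel" "\<And>E. E \<in> local_sets b \<Longrightarrow> set_integrable \<nu> E A"
  shows "set_integrable \<nu> E (\<lambda>x. A x *v u x)"
proof -
  obtain a c where ac: "0 < a" "ereal c < b" "E \<subseteq> {a..c}"
    using E unfolding local_sets_def by blast
  obtain M where M: "0 \<le> M" "\<And>x. x \<in> {a..c} \<Longrightarrow> norm (u x) \<le> M"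
    using locally_BV_bounded[OF u ac(1,2)] by blast
  have um: "(\<lambda>x. indicator E x *\<^sub>R u x) \<in> borel_measurable borel"
    by (rule locally_BV_borel[OF b_pos u local_sets_borel[OF E] local_sets_subset_einterval[OF E]])
  have eq: "indicator E x *\<^sub>R (A x *v u x) = A x *v (indicator E x *\<^sub>R u x)" for x
    by (simp add: mv.scaleR_right)
  show ?thesis
  proof (rule set_integrable_bound)
    show "set_integrable \<nu> E (\<lambda>x. (4 * M) *\<^sub>R A x)"
      using A(2)[OF E] by (intro set_integrable_scaleR_right) auto
    show "set_borel_measurable \<nu> E (\<lambda>x. A x *v u x)"
      unfolding set_borel_measurable_def eq using A(1) um by measurable
    show "AE x in \<nu>. x \<in> E \<longrightarrow> norm (A x *v u x) \<le> norm ((4 * M) *\<^sub>R A x)"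
    proof (intro AE_I2 impI)
      fix x assume "x \<in> E"
      then have "norm (u x) \<le> M" using M(2) ac(3) by blast
      then have "4 * norm (A x) * norm (u x) \<le> 4 * norm (A x) * M" by (intro mult_left_mono) auto
      then show "norm (A x *v u x) \<le> norm ((4 * M) *\<^sub>R A x)"
        using norm_matrix_vector_mult_le[of "A x" "u x"] M(1) by (simp add: mult_ac)
    qed
  qed
qed

lemma derivative_density_integrable:
  assumes u: "locally_BV b u" and E: "E \<in> local_sets b"
  shows "set_integrable \<nu> E (derivative_density z u)"
    and "(LINT x:E|\<nu>. derivative_density z u x) =
      Jmat *v (apply_measure b q u E - z *s apply_measure b w u E)"
proof -
  have um: "(\<lambda>x. indicator E x *\<^sub>R u x) \<in> borel_measurable borel"
    by (rule locally_BV_borel[OF b_pos u local_sets_borel[OF E] local_sets_subset_einterval[OF E]])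
  note i1 = set_integrable_density_times_BV[OF u E Q_borel Q_integrable]
  note i2 = set_integrable_density_times_BV[OF u E W_borel W_integrable]
  note i3 = set_integral_diff(1)[OF i1 set_integral_vmult(1)[OF i2, of z]]
  show "set_integrable \<nu> E (derivative_density z u)"
    unfolding derivative_density_def by (rule set_integral_matrix_mult[OF i3])
  show "(LINT x:E|\<nu>. derivative_density z u x) =
      Jmat *v (apply_measure b q u E - z *s apply_measure b w u E)"
  proof -
    have "(LINT x:E|\<nu>. derivative_density z u x) =
        Jmat *v (LINT x:E|\<nu>. Q x *v u x - z *s (W x *v u x))"
      unfolding derivative_density_def by (rule set_integral_matrix_mult(2)[OF i3])
    also have "(LINT x:E|\<nu>. Q x *v u x - z *s (W x *v u x)) =
        (LINT x:E|\<nu>. Q x *v u x) - (LINT x:E|\<nu>. z *s (W x *v u x))"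
      by (rule set_integral_diff(2)[OF i1 set_integral_vmult(1)[OF i2]])
    also have "(LINT x:E|\<nu>. z *s (W x *v u x)) = z *s (LINT x:E|\<nu>. W x *v u x)"
      by (rule set_integral_vmult(2)[OF i2])
    finally show ?thesis unfolding apply_q[OF E um] apply_w[OF E um] .
  qed
qed

context
  fixes z u assumes sol: "is_solution b q w z u"
begin

lemma solution_BV: "locally_BV b u"
  using sol unfolding is_solution_def by blast

lemma solution_balanced: "x \<in> einterval 0 b \<Longrightarrow> u x = (1/2) *\<^sub>R (left_lim u x + right_lim u x)"
  using sol unfolding is_solution_def balanced_def by blast

lemma solution_right_lim: "x \<in> einterval 0 b \<Longrightarrow> (u \<longlongrightarrow> right_lim u x) (at_right x)"
  using locally_BV_right_lim[OF solution_BV] by (simp add: in_einterval_0)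

lemma solution_left_lim: "x \<in> einterval 0 b \<Longrightarrow> (u \<longlongrightarrow> left_lim u x) (at_left x)"
  using locally_BV_left_lim[OF solution_BV] by (simp add: in_einterval_0)

lemma right_lim_diff:
  assumes xy: "0 < x" "x < y" "ereal y < b"
  shows "right_lim u y = right_lim u x + (LINT t:{x<..y}|\<nu>. derivative_density z u t)"
proof -
  obtain du where du: "derivative_measure b u du"
    "\<And>E. E \<in> local_sets b \<Longrightarrow> Jmat *v du E + apply_measure b q u E = z *s apply_measure b w u E"
    using sol unfolding is_solution_def by blast
  let ?E = "{x<..y}"
  have E: "?E \<in> local_sets b" using xy by (intro local_sets_Ioc)
  have "Jmat *v du ?E = z *s apply_measure b w u ?E - apply_measure b q u ?E"
    using du(2)[OF E] by (simp add: algebra_simps)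
  then have "Jmat *v (Jmat *v du ?E) = - (Jmat *v (apply_measure b q u ?E - z *s apply_measure b w u ?E))"
    by (metis minus_diff_eq mv.minus_right)
  then have "du ?E = Jmat *v (apply_measure b q u ?E - z *s apply_measure b w u ?E)"
    by (simp add: Jmat_Jmat)
  moreover have "du ?E = right_lim u y - right_lim u x"
    using du(1) xy unfolding derivative_measure_def by blast
  ultimately have "right_lim u y - right_lim u x = (LINT t:?E|\<nu>. derivative_density z u t)"
    using derivative_density_integrable(2)[OF solution_BV E, of z] by simp
  then show ?thesis by (simp add: algebra_simps)
qed

lemma right_lim_at_left:
  assumes x: "x \<in> einterval 0 b"
  shows "(right_lim u \<longlongrightarrow> left_lim u x) (at_left x)"
proof (rule tendsto_right_lim[OF solution_left_lim[OF x]])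
  have x0: "0 < x" "ereal x < b" using x by (auto simp: in_einterval_0)
  show "eventually (\<lambda>t. (u \<longlongrightarrow> right_lim u t) (at_right t)) (at_left x)"
    using eventually_at_left_real[OF x0(1)]
  proof eventually_elim
    case (elim t)
    then have "t \<in> einterval 0 b" using x0 by (auto simp: in_einterval_0 intro: less_trans[of "ereal t" "ereal x"])
    then show ?case by (rule solution_right_lim)
  qed
  fix P assume "eventually P (at_left x)"
  then obtain s where s: "s < x" "\<And>t. s < t \<Longrightarrow> t < x \<Longrightarrow> P t"
    unfolding eventually_at_left_field by blast
  have "eventually P (at_right t)" if "t \<in> {s<..<x}" for t
    using eventually_at_right_real[of t x] that s(2) by (auto elim!: eventually_mono)
  then show "eventually (\<lambda>t. eventually P (at_right t)) (at_left x)"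
    using eventually_at_left_real[OF s(1)] by (rule eventually_mono[rotated])
qed

lemma left_lim_diff:
  assumes xy: "0 < x" "x < y" "ereal y < b"
  shows "left_lim u y = right_lim u x + (LINT t:{x<..<y}|\<nu>. derivative_density z u t)"
proof -
  define s where "s n = y - (y - x) / (real n + 2)" for n
  have s: "x < s n" "s n < y" for n
  proof -
    have "(y - x) / (real n + 2) < (y - x) / 1" "0 < (y - x) / (real n + 2)"
      using xy by (intro divide_strict_left_mono divide_pos_pos; simp add: add_pos_pos)+
    then show "x < s n" "s n < y" unfolding s_def by auto
  qed
  have s_mono: "incseq s"
    unfolding s_def using xy by (intro incseq_SucI diff_left_mono divide_left_mono) auto
  have s_lim: "s \<longlonglongrightarrow> y"
    unfolding s_def by real_asymp
  have sl: "filterlim s (at_left y) sequentially"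
    using s_lim s by (auto simp: filterlim_at less_imp_neq intro!: always_eventually)
  have y: "y \<in> einterval 0 b" using xy by (simp add: in_einterval_0)
  have U: "(\<Union>n. {x<..s n}) = {x<..<y}"
  proof (intro equalityI subsetI)
    fix t assume t: "t \<in> {x<..<y}"
    then have "eventually (\<lambda>n. t < s n) sequentially" using order_tendstoD(1)[OF s_lim] by auto
    then obtain n where "t < s n" by (auto simp: eventually_sequentially)
    then show "t \<in> (\<Union>n. {x<..s n})" using t by (auto intro!: exI[of _ n])
  qed (use s in \<open>auto intro: le_less_trans\<close>)
  have loc: "{x<..<y} \<in> local_sets b"
    using xy by (intro local_setsI[of _ x y]) auto
  have "(\<lambda>n. right_lim u x + (LINT t:{x<..s n}|\<nu>. derivative_density z u t)) \<longlonglongrightarrow>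
     right_lim u x + (LINT t:(\<Union>n. {x<..s n})|\<nu>. derivative_density z u t)"
  proof (intro tendsto_add tendsto_const set_integral_cont_up)
    show "set_integrable \<nu> (\<Union>n. {x<..s n}) (derivative_density z u)"
      unfolding U by (rule derivative_density_integrable(1)[OF solution_BV loc])
    show "incseq (\<lambda>n. {x<..s n})"
      unfolding incseq_def
    proof (intro allI impI)
      fix m n :: nat assume "m \<le> n"
      from incseqD[OF s_mono this] show "{x<..s m} \<subseteq> {x<..s n}" by auto
    qed
  qed simp
  moreover have "right_lim u x + (LINT t:{x<..s n}|\<nu>. derivative_density z u t) = right_lim u (s n)" for n
  proof -
    have "ereal (s n) < ereal y" using s(2)[of n] by simp
    then have "ereal (s n) < b" using xy(3) by (rule less_trans)
    then show ?thesis using right_lim_diff[of x "s n"] s[of n] xy by simp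
  qed
  ultimately have "(\<lambda>n. right_lim u (s n)) \<longlonglongrightarrow> right_lim u x + (LINT t:{x<..<y}|\<nu>. derivative_density z u t)"
    unfolding U by simp
  moreover have "(\<lambda>n. right_lim u (s n)) \<longlonglongrightarrow> left_lim u y"
    by (rule filterlim_compose[OF right_lim_at_left[OF y] sl])
  ultimately show ?thesis by (rule LIMSEQ_unique[symmetric])
qed

end

lemma singleton_local: "x \<in> einterval 0 b \<Longrightarrow> {x} \<in> local_sets b"
  by (rule local_setsI[of _ x x]) (auto simp: in_einterval_0)

lemma set_integral_singleton:
  fixes f :: "real \<Rightarrow> 'a::{banach, second_countable_topology}"
  assumes "x \<in> einterval 0 b"
  shows "(LINT t:{x}|\<nu>. f t) = measure \<nu> {x} *\<^sub>R f x"
proof -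
  have "(\<lambda>t. indicator {x} t *\<^sub>R f t) = (\<lambda>t. indicator {x} t *\<^sub>R f x)"
    by (auto simp: indicator_def)
  moreover have "integrable \<nu> (indicator {x} :: real \<Rightarrow> real)"
    using nu_finite[OF singleton_local[OF assms]] by (simp add: integrable_indicator_iff)
  ultimately show ?thesis
    unfolding set_lebesgue_integral_def by (simp add: integral_scaleR_left)
qed

lemma Bmat_mult:
  "Bmat q w s x z *v v = Jmat *v v + (s/2) *\<^sub>R (q {x} *v v - z *s (w {x} *v v))"
  unfolding Bmat_def
  by (simp add: mv.add_left mv.scaleR_left mv.diff_left mat_vector_mult[symmetric] matrix_vector_mul_assoc[symmetric])

lemma Bmat_mult_eq_0_iff:
  assumes "z \<notin> exceptional_set b q w" "x \<in> einterval 0 b" "s = 1 \<or> s = - 1"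
  shows "Bmat q w s x z *v v = 0 \<longleftrightarrow> v = 0"
proof
  have "det (Bmat q w s x z) \<noteq> 0"
    using assms unfolding exceptional_set_def by auto
  then obtain B where B: "B ** Bmat q w s x z = mat 1"
    unfolding invertible_det_nz[symmetric] invertible_def by blast
  assume "Bmat q w s x z *v v = 0"
  then have "B *v (Bmat q w s x z *v v) = 0" by simp
  then show "v = 0" unfolding matrix_vector_mul_assoc B by simp
qed simp

lemma solution_jump:
  assumes sol: "is_solution b q w z u" and x: "x \<in> einterval 0 b"
  shows "right_lim u x = left_lim u x + measure \<nu> {x} *\<^sub>R derivative_density z u x"
proof -
  have x0: "0 < x/2" "x/2 < x" "ereal x < b" using x by (auto simp: in_einterval_0)
  have U: "{x/2<..x} = {x/2<..<x} \<union> {x}" using x0 by auto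
  have loc: "{x/2<..<x} \<in> local_sets b" using x0 by (intro local_setsI[of _ "x/2" x]) auto
  have "(LINT t:{x/2<..x}|\<nu>. derivative_density z u t) =
    (LINT t:{x/2<..<x}|\<nu>. derivative_density z u t) + (LINT t:{x}|\<nu>. derivative_density z u t)"
    unfolding U
    by (intro set_integral_Un derivative_density_integrable solution_BV[OF sol] loc singleton_local x) auto
  then show ?thesis
    using right_lim_diff[OF sol x0] left_lim_diff[OF sol x0] by (simp add: set_integral_singleton[OF x])
qed

lemma point_mass:
  assumes x: "x \<in> einterval 0 b"
  shows "q {x} = measure \<nu> {x} *\<^sub>R Q x" "w {x} = measure \<nu> {x} *\<^sub>R W x"
  using q_density[OF singleton_local[OF x]] w_density[OF singleton_local[OF x]]
  by (simp_all add: set_integral_singleton[OF x])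

text \<open>The jump of a solution at \<open>x\<close> is governed by \<open>\<Delta>\<^sub>q u - \<lambda> \<Delta>\<^sub>w u\<close> at the mean \<open>u = (u\<^sup>- + u\<^sup>+)/2\<close>;
  collecting the terms with \<open>u\<^sup>+\<close> and with \<open>u\<^sup>-\<close> produces the matrices \<open>B\<^sub>\<plusminus>\<close>.\<close>

lemma Bmat_jump:
  assumes sol: "is_solution b q w z u" and x: "x \<in> einterval 0 b"
  shows "Bmat q w 1 x z *v right_lim u x = Bmat q w (- 1) x z *v left_lim u x"
proof -
  define D where "D v = q {x} *v v - z *s (w {x} *v v)" for v :: "complex^2"
  have D_add: "D (v + v') = D v + D v'" for v v'
    unfolding D_def by (simp add: mv.add_right vector_add_ldistrib)
  have D_scale: "D (a *\<^sub>R v) = a *\<^sub>R D v" for a v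
    unfolding D_def by (simp add: mv.scaleR_right vmult_scaleR scaleR_diff_right)
  have "Jmat *v (right_lim u x - left_lim u x) = - D (u x)"
    unfolding solution_jump[OF sol x] D_def point_mass[OF x] derivative_density_def
    by (simp add: mv.scaleR_right mv.scaleR_left vmult_scaleR Jmat_Jmat scaleR_diff_right)
  also have "D (u x) = (1/2) *\<^sub>R D (left_lim u x) + (1/2) *\<^sub>R D (right_lim u x)"
    by (subst solution_balanced[OF sol x]) (simp add: D_scale D_add scaleR_add_right)
  finally show ?thesis
    unfolding Bmat_mult D_def[symmetric] by (simp add: mv.diff_right algebra_simps)
qed

text \<open>Outside the exceptional set both \<open>B\<^sub>+\<close> and \<open>B\<^sub>-\<close> are invertible, so a zero passes through \<open>x\<close>.\<close>

lemma one_sided_limits_vanish: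
  assumes sol: "is_solution b q w z u" and z: "z \<notin> exceptional_set b q w" and x: "x \<in> einterval 0 b"
  shows "left_lim u x = 0 \<longleftrightarrow> right_lim u x = 0"
  using Bmat_jump[OF sol x] Bmat_mult_eq_0_iff[OF z x, of 1] Bmat_mult_eq_0_iff[OF z x, of "- 1"]
  by metis

text \<open>
  Gronwall's argument: if the one-sided limits of \<open>u\<close> at all points of \<open>I\<close> are, up to sign,
  integrals of its derivative over subsets of \<open>I\<close>, and \<open>I\<close> is short, then the supremum of
  \<open>|u|\<close> on \<open>I\<close> is at most half of itself.
\<close>

lemma solution_vanishes_on_short_interval:
  assumes sol: "is_solution b q w z u"
    and I: "I \<in> local_sets b" "(LINT t:I|\<nu>. bound_density z t) \<le> 1/2"
    and R: "\<And>t. t \<in> I \<Longrightarrow> \<exists>S\<in>sets borel. S \<subseteq> I \<and>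
      norm (right_lim u t) = norm (LINT s:S|\<nu>. derivative_density z u s)"
    and L: "\<And>t. t \<in> I \<Longrightarrow> \<exists>S\<in>sets borel. S \<subseteq> I \<and>
      norm (left_lim u t) = norm (LINT s:S|\<nu>. derivative_density z u s)"
    and t: "t \<in> I"
  shows "u t = 0"
proof -
  obtain a c where ac: "0 < a" "ereal c < b" "I \<subseteq> {a..c}"
    using I(1) unfolding local_sets_def by blast
  obtain K where K: "\<And>x. x \<in> {a..c} \<Longrightarrow> norm (u x) \<le> K"
    using locally_BV_bounded[OF solution_BV[OF sol] ac(1,2)] by blast
  define M where "M = Sup ((\<lambda>x. norm (u x)) ` I)"
  have "bdd_above ((\<lambda>x. norm (u x)) ` I)"
    using K ac(3) by (intro bdd_aboveI2[of _ _ K]) blast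
  then have le: "norm (u x) \<le> M" if "x \<in> I" for x
    unfolding M_def using that by (intro cSup_upper) auto
  have M0: "0 \<le> M" using le[OF t] norm_ge_zero[of "u t"] by linarith
  have half: "norm (LINT s:S|\<nu>. derivative_density z u s) \<le> M / 2" if S: "S \<in> sets borel" "S \<subseteq> I" for S
  proof -
    have loc: "S \<in> local_sets b" using local_sets_subset[OF I(1) S] .
    note int = derivative_density_integrable(1)[OF solution_BV[OF sol] loc, of z]
    have "norm (LINT s:S|\<nu>. derivative_density z u s) \<le> (LINT s:S|\<nu>. norm (derivative_density z u s))"
      using int by (rule set_integral_norm_bound)
    also have "\<dots> \<le> (LINT s:S|\<nu>. bound_density z s * M)"
    proof (rule set_integral_mono)
      show "set_integrable \<nu> S (\<lambda>s. norm (derivative_density z u s))"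
        using int by (rule set_integrable_norm)
      show "set_integrable \<nu> S (\<lambda>s. bound_density z s * M)"
        using bound_density_integrable[OF loc] by (rule set_integrable_mult_left)
      fix s assume "s \<in> S"
      then show "norm (derivative_density z u s) \<le> bound_density z s * M"
        using norm_derivative_density[of z u s]
          mult_left_mono[OF le bound_density_nonneg, of s z] S(2) by (auto intro: order_trans)
    qed
    also have "\<dots> = (LINT s:S|\<nu>. bound_density z s) * M" by simp
    also have "\<dots> \<le> (LINT s:I|\<nu>. bound_density z s) * M"
    proof (intro mult_right_mono M0)
      show "(LINT s:S|\<nu>. bound_density z s) \<le> (LINT s:I|\<nu>. bound_density z s)"
        unfolding set_lebesgue_integral_def
        using bound_density_integrable[OF loc, of z] bound_density_integrable[OF I(1), of z] S(2) bound_density_nonneg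
        unfolding set_integrable_def
        by (intro integral_mono) (auto split: split_indicator)
    qed
    also have "\<dots> \<le> 1/2 * M" using I(2) M0 by (intro mult_right_mono)
    finally show ?thesis by simp
  qed
  have "norm (u x) \<le> M / 2" if x: "x \<in> I" for x
  proof -
    have xI: "x \<in> einterval 0 b" using x local_sets_subset_einterval[OF I(1)] by blast
    obtain S S' where S: "S \<in> sets borel" "S \<subseteq> I"
        "norm (right_lim u x) = norm (LINT s:S|\<nu>. derivative_density z u s)"
      and S': "S' \<in> sets borel" "S' \<subseteq> I"
        "norm (left_lim u x) = norm (LINT s:S'|\<nu>. derivative_density z u s)"
      using R[OF x] L[OF x] by blast
    have "norm (right_lim u x) \<le> M / 2" "norm (left_lim u x) \<le> M / 2"
      using half[OF S(1,2)] half[OF S'(1,2)] unfolding S(3) S'(3) by auto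
    then have "norm (left_lim u x + right_lim u x) \<le> M"
      using norm_triangle_ineq[of "left_lim u x" "right_lim u x"] by linarith
    then show ?thesis by (subst solution_balanced[OF sol xI]) simp
  qed
  then have "M \<le> M / 2" unfolding M_def using t by (intro cSup_least) auto
  then show "u t = 0" using le[OF t] M0 by simp
qed

text \<open>Continuity of the integral from above: sets that shrink to nothing are eventually short enough for Gronwall's argument.\<close>

lemma bound_density_small:
  assumes A: "\<And>n. A n \<in> local_sets b" "decseq A" "(\<Inter>n. A n) = {}"
  shows "\<exists>n::nat. (LINT t:A n|\<nu>. bound_density z t) \<le> 1/2"
proof -
  have "(\<lambda>n. LINT t:A n|\<nu>. bound_density z t) \<longlonglongrightarrow> (LINT t:(\<Inter>n. A n)|\<nu>. bound_density z t)"
    using local_sets_borel[OF A(1)]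
    by (intro set_integral_cont_down A(2) bound_density_integrable A(1)) simp
  then have "(\<lambda>n. LINT t:A n|\<nu>. bound_density z t) \<longlonglongrightarrow> 0"
    unfolding A(3) by (simp add: set_lebesgue_integral_def)
  then have "eventually (\<lambda>n. (LINT t:A n|\<nu>. bound_density z t) < 1/2) sequentially"
    by (rule order_tendstoD) simp
  then show ?thesis by (auto simp: eventually_sequentially intro: less_imp_le)
qed

lemma solution_vanishes_right:
  assumes sol: "is_solution b q w z u" and x: "x \<in> einterval 0 b" and r0: "right_lim u x = 0"
  shows "\<exists>d>x. \<forall>t\<in>{x<..<d}. u t = 0"
proof -
  have x0: "0 < x" "ereal x < b" using x by (auto simp: in_einterval_0)
  obtain c where c: "x < c" "ereal c < b" using ereal_dense2[OF x0(2)] by auto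
  define A where "A n = {x<..<x + (c - x) / (real n + 1)}" for n
  have Ac: "A n \<subseteq> {x..c}" for n
  proof -
    have "(c - x) / (real n + 1) \<le> (c - x) / 1" using c by (intro divide_left_mono) auto
    then show ?thesis unfolding A_def by auto
  qed
  have loc: "A n \<in> local_sets b" for n
    using Ac[of n] x0 c by (intro local_setsI[of _ x c]) (auto simp: A_def)
  have "decseq A"
    unfolding decseq_def
  proof (intro allI impI)
    fix m n :: nat assume "m \<le> n"
    then have "(c - x) / (real n + 1) \<le> (c - x) / (real m + 1)" using c by (intro divide_left_mono) auto
    then show "A n \<subseteq> A m" unfolding A_def by auto
  qed
  moreover have "(\<Inter>n. A n) = {}"
  proof (rule ccontr)
    assume "(\<Inter>n. A n) \<noteq> {}"
    then obtain t where t: "\<And>n. t \<in> A n" by blast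
    have "(\<lambda>n. x + (c - x) / (real n + 1)) \<longlonglongrightarrow> x" by real_asymp
    then have "t \<le> x" by (rule LIMSEQ_le_const) (use t in \<open>auto simp: A_def less_imp_le\<close>)
    then show False using t[of 0] by (simp add: A_def)
  qed
  ultimately obtain n where n: "(LINT t:A n|\<nu>. bound_density z t) \<le> 1/2"
    using bound_density_small[of A] loc by blast
  have "u t = 0" if "t \<in> A n" for t
  proof (rule solution_vanishes_on_short_interval[OF sol loc n _ _ that])
    fix t assume t: "t \<in> A n"
    then have "x < t" "t \<le> c" using Ac[of n] by (auto simp: A_def)
    then have xt: "x < t" "ereal t < b" using c by (auto intro: le_less_trans[of "ereal t" "ereal c"])
    show "\<exists>S\<in>sets borel. S \<subseteq> A n \<and> norm (right_lim u t) = norm (LINT s:S|\<nu>. derivative_density z u s)"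
      using right_lim_diff[OF sol x0(1) xt] t r0
      by (intro bexI[of _ "{x<..t}"]) (auto simp: A_def)
    show "\<exists>S\<in>sets borel. S \<subseteq> A n \<and> norm (left_lim u t) = norm (LINT s:S|\<nu>. derivative_density z u s)"
      using left_lim_diff[OF sol x0(1) xt] t r0
      by (intro bexI[of _ "{x<..<t}"]) (auto simp: A_def)
  qed
  then show ?thesis
    using c unfolding A_def by (intro exI[of _ "x + (c - x) / (real n + 1)"]) auto
qed

lemma solution_vanishes_left:
  assumes sol: "is_solution b q w z u" and x: "x \<in> einterval 0 b" and l0: "left_lim u x = 0"
  shows "\<exists>d<x. \<forall>t\<in>{d<..<x}. u t = 0"
proof -
  have x0: "0 < x" "ereal x < b" using x by (auto simp: in_einterval_0)
  define A where "A n = {x - x / (real n + 2)<..<x}" for n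
  have Ac: "A n \<subseteq> {x/2..x}" for n
  proof -
    have "x / (real n + 2) \<le> x / 2" using x0 by (intro divide_left_mono) auto
    then show ?thesis unfolding A_def by auto
  qed
  have loc: "A n \<in> local_sets b" for n
    using Ac[of n] x0 by (intro local_setsI[of _ "x/2" x]) (auto simp: A_def)
  have "decseq A"
    unfolding decseq_def
  proof (intro allI impI)
    fix m n :: nat assume "m \<le> n"
    then have "x / (real n + 2) \<le> x / (real m + 2)" using x0 by (intro divide_left_mono) auto
    then show "A n \<subseteq> A m" unfolding A_def by auto
  qed
  moreover have "(\<Inter>n. A n) = {}"
  proof (rule ccontr)
    assume "(\<Inter>n. A n) \<noteq> {}"
    then obtain t where t: "\<And>n. t \<in> A n" by blast
    have "(\<lambda>n. x - x / (real n + 2)) \<longlonglongrightarrow> x" by real_asymp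
    then have "x \<le> t" by (rule LIMSEQ_le_const2) (use t in \<open>auto simp: A_def less_imp_le\<close>)
    then show False using t[of 0] by (simp add: A_def)
  qed
  ultimately obtain n where n: "(LINT t:A n|\<nu>. bound_density z t) \<le> 1/2"
    using bound_density_small[of A] loc by blast
  have "u t = 0" if "t \<in> A n" for t
  proof (rule solution_vanishes_on_short_interval[OF sol loc n _ _ that])
    fix t assume t: "t \<in> A n"
    then have tx: "0 < t" "t < x" "t \<in> einterval 0 b" using Ac[of n] x0
      by (auto simp: A_def in_einterval_0 intro: less_trans[of "ereal t" "ereal x"])
    have sub: "{t<..<x} \<subseteq> A n" "{t..<x} \<subseteq> A n" using t by (auto simp: A_def)
    note locs = local_sets_subset[OF loc[of n] _ sub(1)] local_sets_subset[OF loc[of n] _ sub(2)]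
    have 1: "right_lim u t = - (LINT s:{t<..<x}|\<nu>. derivative_density z u s)"
      using left_lim_diff[OF sol tx(1,2) x0(2)] l0 by (simp add: eq_neg_iff_add_eq_0)
    then show "\<exists>S\<in>sets borel. S \<subseteq> A n \<and> norm (right_lim u t) = norm (LINT s:S|\<nu>. derivative_density z u s)"
      using sub by (intro bexI[of _ "{t<..<x}"]) auto
    have U: "{t..<x} = {t<..<x} \<union> {t}" using tx by auto
    have "(LINT s:{t..<x}|\<nu>. derivative_density z u s) =
      (LINT s:{t<..<x}|\<nu>. derivative_density z u s) + (LINT s:{t}|\<nu>. derivative_density z u s)"
      unfolding U
      by (intro set_integral_Un derivative_density_integrable solution_BV[OF sol] locs(1) singleton_local tx) auto
    then have "left_lim u t = - (LINT s:{t..<x}|\<nu>. derivative_density z u s)"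
      using 1 solution_jump[OF sol tx(3)] by (simp add: set_integral_singleton[OF tx(3)] algebra_simps)
    then show "\<exists>S\<in>sets borel. S \<subseteq> A n \<and> norm (left_lim u t) = norm (LINT s:S|\<nu>. derivative_density z u s)"
      using sub by (intro bexI[of _ "{t..<x}"]) auto
  qed
  then show ?thesis
    using x0 unfolding A_def by (intro exI[of _ "x - x / (real n + 2)"]) auto
qed

text \<open>The points where both one-sided limits vanish form an open and closed subset of the
  interval: the two preceding lemmas give openness, the jump condition gives closedness.\<close>

theorem solution_unique:
  assumes sol: "is_solution b q w z u" and z: "z \<notin> exceptional_set b q w"
    and x: "x \<in> einterval 0 b" "right_lim u x = 0" and y: "y \<in> einterval 0 b"
  shows "u y = 0" "right_lim u y = 0"
proof -
  let ?I = "einterval 0 b"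
  define Z where "Z = {t \<in> ?I. right_lim u t = 0}"
  define N where "N = {t \<in> ?I. right_lim u t \<noteq> 0}"
  have oI: "open ?I" by simp
  have Rlim: "right_lim u s = 0" if "s \<in> ?I" "\<And>t. t \<in> {s<..<d} \<Longrightarrow> u t = 0" "s < d" for s d
  proof -
    have "eventually (\<lambda>t. u t = 0) (at_right s)"
      using eventually_at_right_real[OF that(3)] by eventually_elim (rule that(2))
    then have "(u \<longlongrightarrow> 0) (at_right s)" by (rule tendsto_eventually)
    then show ?thesis unfolding right_lim_def by (intro tendsto_Lim) auto
  qed
  have openZ: "open Z"
    unfolding open_contains_ball
  proof
    fix t assume t: "t \<in> Z"
    then have tI: "t \<in> ?I" and r: "right_lim u t = 0" unfolding Z_def by auto
    have l: "left_lim u t = 0" using one_sided_limits_vanish[OF sol z tI] r by simp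
    obtain d where d: "t < d" "\<forall>s\<in>{t<..<d}. u s = 0" using solution_vanishes_right[OF sol tI r] by blast
    obtain e where e: "e < t" "\<forall>s\<in>{e<..<t}. u s = 0" using solution_vanishes_left[OF sol tI l] by blast
    obtain r1 where r1: "0 < r1" "ball t r1 \<subseteq> ?I" using oI tI open_contains_ball by blast
    let ?r = "min r1 (min (d - t) (t - e))"
    have "ball t ?r \<subseteq> Z"
    proof
      fix s assume s: "s \<in> ball t ?r"
      then have sI: "s \<in> ?I" using r1 by auto
      have "right_lim u s = 0"
      proof (cases "s < t")
        case True
        then show ?thesis using s e by (intro Rlim[OF sI, of t]) (auto simp: dist_real_def)
      next
        case False
        then show ?thesis using s d by (intro Rlim[OF sI, of d]) (auto simp: dist_real_def)
      qed
      then show "s \<in> Z" using sI unfolding Z_def by simp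
    qed
    moreover have "0 < ?r" using r1 d e by simp
    ultimately show "\<exists>r>0. ball t r \<subseteq> Z" by blast
  qed
  have openN: "open N"
    unfolding open_contains_ball
  proof
    fix t assume t: "t \<in> N"
    then have tI: "t \<in> ?I" and r: "right_lim u t \<noteq> 0" unfolding N_def by auto
    have l: "left_lim u t \<noteq> 0" using one_sided_limits_vanish[OF sol z tI] r by simp
    have "eventually (\<lambda>s. u s \<noteq> 0) (at_right t)" "eventually (\<lambda>s. u s \<noteq> 0) (at_left t)"
      using tendsto_imp_eventually_ne[OF solution_right_lim[OF sol tI] r]
        tendsto_imp_eventually_ne[OF solution_left_lim[OF sol tI] l] by auto
    then obtain d e where d: "t < d" "\<And>s. t < s \<Longrightarrow> s < d \<Longrightarrow> u s \<noteq> 0"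
      and e: "e < t" "\<And>s. e < s \<Longrightarrow> s < t \<Longrightarrow> u s \<noteq> 0"
      unfolding eventually_at_right_field eventually_at_left_field by blast
    obtain r1 where r1: "0 < r1" "ball t r1 \<subseteq> ?I" using oI tI open_contains_ball by blast
    let ?r = "min r1 (min (d - t) (t - e))"
    have "ball t ?r \<subseteq> N"
    proof
      fix s assume s: "s \<in> ball t ?r"
      then have sI: "s \<in> ?I" using r1 by auto
      have "right_lim u s \<noteq> 0"
      proof
        assume "right_lim u s = 0"
        from solution_vanishes_right[OF sol sI this] obtain f where f: "s < f" "\<forall>x\<in>{s<..<f}. u x = 0"
          by blast
        show False
        proof (cases "s < t")
          case True
          obtain m where "s < m" "m < min f t" using dense[of s "min f t"] True f by auto
          then show False using f(2) e(2)[of m] s True by (auto simp: dist_real_def)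
        next
          case False
          have "s < d" using s by (auto simp: dist_real_def)
          then obtain m where "s < m" "m < min f d" using dense[of s "min f d"] f by auto
          then show False using f(2) d(2)[of m] False by auto
        qed
      qed
      then show "s \<in> N" using sI unfolding N_def by simp
    qed
    moreover have "0 < ?r" using r1 d e by simp
    ultimately show "\<exists>r>0. ball t r \<subseteq> N" by blast
  qed
  have "is_interval ?I"
    unfolding is_interval_1
  proof (intro ballI allI impI)
    fix s e t assume *: "s \<in> ?I" "e \<in> ?I" "s \<le> t \<and> t \<le> e"
    then have "ereal t \<le> ereal e" by simp
    with * show "t \<in> ?I"
      unfolding in_einterval_0 by (auto intro: le_less_trans[of "ereal t" "ereal e"])
  qed
  then have "connected ?I" by (intro convex_connected is_interval_convex)
  then have "Z \<inter> ?I = {} \<or> N \<inter> ?I = {}"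
    by (rule connectedD[OF _ openZ openN]) (auto simp: Z_def N_def)
  then have all: "right_lim u t = 0" if "t \<in> ?I" for t
    using x that unfolding Z_def N_def by auto
  show "right_lim u y = 0" by (rule all[OF y])
  moreover have "left_lim u y = 0" using one_sided_limits_vanish[OF sol z y] all[OF y] by simp
  ultimately show "u y = 0" using solution_balanced[OF sol y] by simp
qed

lemma continuity_point_lims:
  assumes sol: "is_solution b q w z u" and c: "continuity_point b q w c"
  shows "right_lim u c = u c" "left_lim u c = u c"
proof -
  have cI: "c \<in> einterval 0 b" and 0: "q {c} = 0" "w {c} = 0"
    using c unfolding continuity_point_def by auto
  have "measure \<nu> {c} *\<^sub>R derivative_density z u c =
    Jmat *v ((measure \<nu> {c} *\<^sub>R Q c) *v u c - z *s ((measure \<nu> {c} *\<^sub>R W c) *v u c))"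
    unfolding derivative_density_def
    by (simp add: mv.scaleR_right mv.scaleR_left vmult_scaleR scaleR_diff_right mv.diff_right)
  then have "measure \<nu> {c} *\<^sub>R derivative_density z u c = 0"
    unfolding point_mass[OF cI, symmetric] 0 by simp
  then have eq: "right_lim u c = left_lim u c" using solution_jump[OF sol cI] by simp
  then show "right_lim u c = u c" "left_lim u c = u c"
    using solution_balanced[OF sol cI] by (simp_all add: scaleR_2[symmetric])
qed

lemma solution_linear:
  assumes u: "is_solution b q w z u" and v: "is_solution b q w z v"
  shows "is_solution b q w z (\<lambda>x. a *s u x + c *s v x)"
    and "x \<in> einterval 0 b \<Longrightarrow> right_lim (\<lambda>x. a *s u x + c *s v x) x = a *s right_lim u x + c *s right_lim v x"
proof -
  let ?f = "\<lambda>x. a *s u x + c *s v x"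
  have t: "((\<lambda>x. a *s f x) \<longlongrightarrow> a *s L) F" if "(f \<longlongrightarrow> L) F" for a and f :: "real \<Rightarrow> complex^2" and L F
    using mv.tendsto[OF tendsto_const that, of "mat a"] unfolding mat_vector_mult .
  have r: "right_lim ?f x = a *s right_lim u x + c *s right_lim v x"
    and l: "left_lim ?f x = a *s left_lim u x + c *s left_lim v x" if x: "x \<in> einterval 0 b" for x
    unfolding right_lim_def[of ?f] left_lim_def[of ?f]
    by (intro tendsto_Lim tendsto_add t solution_right_lim[OF u x] solution_right_lim[OF v x]
        solution_left_lim[OF u x] solution_left_lim[OF v x]; simp)+
  show "x \<in> einterval 0 b \<Longrightarrow> right_lim ?f x = a *s right_lim u x + c *s right_lim v x" by (rule r)
  have "locally_BV b ?f"
    unfolding locally_BV_def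
  proof (intro allI impI)
    fix s e :: real assume se: "0 < s" "ereal e < b"
    obtain K where K: "\<And>n t. mono (t :: nat \<Rightarrow> real) \<Longrightarrow> range t \<subseteq> {s..e} \<Longrightarrow>
          (\<Sum>i<n. norm (u (t (Suc i)) - u (t i))) \<le> K"
      using solution_BV[OF u] se unfolding locally_BV_def by meson
    obtain K' where K': "\<And>n t. mono (t :: nat \<Rightarrow> real) \<Longrightarrow> range t \<subseteq> {s..e} \<Longrightarrow>
          (\<Sum>i<n. norm (v (t (Suc i)) - v (t i))) \<le> K'"
      using solution_BV[OF v] se unfolding locally_BV_def by meson
    let ?a = "4 * norm (mat a :: complex^2^2)" and ?c = "4 * norm (mat c :: complex^2^2)"
    have "(\<Sum>i<n. norm (?f (t (Suc i)) - ?f (t i))) \<le> ?a * K + ?c * K'"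
      if tt: "mono t" "range t \<subseteq> {s..e}" for n and t :: "nat \<Rightarrow> real"
    proof -
      have "norm (?f y - ?f x) \<le> ?a * norm (u y - u x) + ?c * norm (v y - v x)" for x y
      proof -
        have "?f y - ?f x = mat a *v (u y - u x) + mat c *v (v y - v x)"
          unfolding mat_vector_mult by (simp add: vector_ssub_ldistrib algebra_simps)
        then show ?thesis
          using norm_triangle_le[OF add_mono[OF norm_matrix_vector_mult_le norm_matrix_vector_mult_le]] by metis
      qed
      then have "(\<Sum>i<n. norm (?f (t (Suc i)) - ?f (t i))) \<le>
        (\<Sum>i<n. ?a * norm (u (t (Suc i)) - u (t i)) + ?c * norm (v (t (Suc i)) - v (t i)))"
        by (intro sum_mono)
      also have "\<dots> = ?a * (\<Sum>i<n. norm (u (t (Suc i)) - u (t i))) + ?c * (\<Sum>i<n. norm (v (t (Suc i)) - v (t i)))"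
        by (simp add: sum.distrib sum_distrib_left)
      also have "\<dots> \<le> ?a * K + ?c * K'"
        by (intro add_mono mult_left_mono K K' tt) auto
      finally show ?thesis .
    qed
    then show "\<exists>K. \<forall>n. \<forall>t :: nat \<Rightarrow> real. mono t \<longrightarrow> range t \<subseteq> {s..e} \<longrightarrow>
          (\<Sum>i<n. norm (?f (t (Suc i)) - ?f (t i))) \<le> K" by blast
  qed
  moreover have "balanced b ?f"
    unfolding balanced_def
  proof
    fix x assume x: "x \<in> einterval 0 b"
    show "?f x = (1/2) *\<^sub>R (left_lim ?f x + right_lim ?f x)"
      by (subst solution_balanced[OF u x], subst solution_balanced[OF v x])
        (simp add: r[OF x] l[OF x] vec_eq_iff algebra_simps)
  qed
  moreover have "\<exists>d. derivative_measure b ?f d \<and>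
        (\<forall>E \<in> local_sets b. Jmat *v d E + apply_measure b q ?f E = z *s apply_measure b w ?f E)"
  proof -
    obtain du where du: "derivative_measure b u du"
      "\<And>E. E \<in> local_sets b \<Longrightarrow> Jmat *v du E + apply_measure b q u E = z *s apply_measure b w u E"
      using u unfolding is_solution_def by blast
    obtain dv where dv: "derivative_measure b v dv"
      "\<And>E. E \<in> local_sets b \<Longrightarrow> Jmat *v dv E + apply_measure b q v E = z *s apply_measure b w v E"
      using v unfolding is_solution_def by blast
    let ?d = "\<lambda>E. a *s du E + c *s dv E"
    have "derivative_measure b ?f ?d"
      unfolding derivative_measure_def
    proof (intro conjI allI impI)
      show "local_measure b ?d"
        unfolding local_measure_def
      proof (intro allI impI)
        fix A :: "nat \<Rightarrow> real set"
        assume A: "range A \<subseteq> local_sets b" "disjoint_family A" "(\<Union>n. A n) \<in> local_sets b"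
        have "(\<lambda>n. du (A n)) sums du (\<Union>n. A n)" "(\<lambda>n. dv (A n)) sums dv (\<Union>n. A n)"
          using du(1) dv(1) A unfolding derivative_measure_def local_measure_def by auto
        then show "(\<lambda>n. ?d (A n)) sums ?d (\<Union>n. A n)"
          unfolding mat_vector_mult[symmetric]
          by (intro sums_add bounded_linear.sums[OF mv.bounded_linear_right])
      qed
      fix x y :: real assume xy: "0 < x" "x < y" "ereal y < b"
      then have I: "x \<in> einterval 0 b" "y \<in> einterval 0 b"
        by (auto simp: in_einterval_0 intro: less_trans[of "ereal x" "ereal y"])
      have "du {x<..y} = right_lim u y - right_lim u x" "dv {x<..y} = right_lim v y - right_lim v x"
        using du(1) dv(1) xy unfolding derivative_measure_def by auto
      note d = this
      show "?d {x<..y} = right_lim ?f y - right_lim ?f x"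
        unfolding r[OF I(1)] r[OF I(2)] d by (simp add: vec_eq_iff algebra_simps)
    qed
    moreover have "Jmat *v ?d E + apply_measure b q ?f E = z *s apply_measure b w ?f E" if E: "E \<in> local_sets b" for E
    proof -
      have um: "(\<lambda>x. indicator E x *\<^sub>R f x) \<in> borel_measurable borel" if "locally_BV b f" for f
        by (rule locally_BV_borel[OF b_pos that local_sets_borel[OF E] local_sets_subset_einterval[OF E]])
      have lin: "A *v (a *s x + c *s y) = a *s (A *v x) + c *s (A *v y)" for A :: "complex^2^2" and x y
        by (simp add: vec_eq_iff matrix_vector_mult_def sum_2 algebra_simps)
      have int_lin: "(LINT x:E|\<nu>. A x *v ?f x) = a *s (LINT x:E|\<nu>. A x *v u x) + c *s (LINT x:E|\<nu>. A x *v v x)"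
        if A: "A \<in> borel_measurable borel" "\<And>E. E \<in> local_sets b \<Longrightarrow> set_integrable \<nu> E A"
        for A :: "real \<Rightarrow> complex^2^2"
      proof -
        note i1 = set_integrable_density_times_BV[OF solution_BV[OF u] E A]
        note i2 = set_integrable_density_times_BV[OF solution_BV[OF v] E A]
        show ?thesis
          unfolding lin
          using set_integral_add(2)[OF set_integral_vmult(1)[OF i1] set_integral_vmult(1)[OF i2], of a c]
          by (simp only: set_integral_vmult(2)[OF i1] set_integral_vmult(2)[OF i2])
      qed
      have "Jmat *v ?d E = a *s (Jmat *v du E) + c *s (Jmat *v dv E)" by (rule lin)
      moreover have "Jmat *v du E = z *s apply_measure b w u E - apply_measure b q u E"
        "Jmat *v dv E = z *s apply_measure b w v E - apply_measure b q v E"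
        using du(2)[OF E] dv(2)[OF E] by (simp_all add: eq_diff_eq)
      moreover have "apply_measure b q ?f E = a *s apply_measure b q u E + c *s apply_measure b q v E"
        "apply_measure b w ?f E = a *s apply_measure b w u E + c *s apply_measure b w v E"
        unfolding apply_q[OF E um[OF solution_BV[OF u]]] apply_q[OF E um[OF solution_BV[OF v]]]
          apply_w[OF E um[OF solution_BV[OF u]]] apply_w[OF E um[OF solution_BV[OF v]]]
          apply_q[OF E um[OF \<open>locally_BV b ?f\<close>]] apply_w[OF E um[OF \<open>locally_BV b ?f\<close>]]
        by (rule int_lin[OF Q_borel Q_integrable] int_lin[OF W_borel W_integrable]; assumption)+
      ultimately show ?thesis
        by (simp add: vec_eq_iff algebra_simps)
    qed
    ultimately show ?thesis by blast
  qed
  ultimately show "is_solution b q w z ?f" unfolding is_solution_def by blast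
qed

end

section \<open>Integration by parts and Lagrange's identity\<close>

text \<open>
  Integration by parts for functions that are the mean of their one-sided limits. By Fubini, the
  product \<open>\<integral> F \<cdot> \<integral> G\<close> is an integral over a square, which the diagonal cuts into two
  triangles; giving half of the diagonal to each of them produces exactly the balanced values.
\<close>

lemma balanced_integration_by_parts:
  fixes F G f g :: "real \<Rightarrow> complex"
  assumes sf: "sigma_finite_measure M" and s: "sets M = sets borel"
    and F: "set_integrable M {x<..y} F" and G: "set_integrable M {x<..y} G"
    and f: "\<And>t. t \<in> {x<..y} \<Longrightarrow> f t = f0 + ((LINT s:{x<..<t}|M. F s) + (LINT s:{x<..t}|M. F s)) / 2"
    and g: "\<And>t. t \<in> {x<..y} \<Longrightarrow> g t = g0 + ((LINT s:{x<..<t}|M. G s) + (LINT s:{x<..t}|M. G s)) / 2"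
  shows "set_integrable M {x<..y} (\<lambda>t. f t * G t + F t * g t)"
    and "(f0 + (LINT t:{x<..y}|M. F t)) * (g0 + (LINT t:{x<..y}|M. G t)) - f0 * g0 =
      (LINT t:{x<..y}|M. f t * G t + F t * g t)"
proof -
  interpret sigma_finite_measure M by fact
  interpret P: pair_sigma_finite M M by unfold_locales
  note [measurable_cong] = s
  let ?E = "{x<..y}"
  define F' where "F' t = indicator ?E t *\<^sub>R F t" for t
  define G' where "G' t = indicator ?E t *\<^sub>R G t" for t
  have F': "integrable M F'" and G': "integrable M G'"
    using F G unfolding set_integrable_def F'_def[abs_def] G'_def[abs_def] by auto
  note [measurable] = borel_measurable_integrable[OF F'] borel_measurable_integrable[OF G']
  define H0 where "H0 = (\<lambda>(s, t). F' s * G' t)"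
  have H0: "integrable (M \<Otimes>\<^sub>M M) H0"
  proof (rule P.Fubini_integrable)
    show "H0 \<in> borel_measurable (M \<Otimes>\<^sub>M M)" unfolding H0_def by measurable
    show "AE s in M. integrable M (\<lambda>t. H0 (s, t))" unfolding H0_def using G' by simp
    have "integrable M (\<lambda>s. norm (F' s) * (LINT t|M. norm (G' t)))"
      using F' by (intro integrable_mult_left integrable_norm)
    then show "integrable M (\<lambda>s. LINT t|M. norm (H0 (s, t)))"
      unfolding H0_def by (simp add: norm_mult)
  qed
  have I0: "(LINT p|(M \<Otimes>\<^sub>M M). H0 p) = (LINT s|M. F' s) * (LINT t|M. G' t)"
    using P.integral_fst'[OF H0] unfolding H0_def by simp
  have sets_lt: "{p \<in> space (M \<Otimes>\<^sub>M M). fst p < snd p} \<in> sets (M \<Otimes>\<^sub>M M)"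
    "{p \<in> space (M \<Otimes>\<^sub>M M). fst p \<le> snd p} \<in> sets (M \<Otimes>\<^sub>M M)"
    "{p \<in> space (M \<Otimes>\<^sub>M M). snd p < fst p} \<in> sets (M \<Otimes>\<^sub>M M)"
    "{p \<in> space (M \<Otimes>\<^sub>M M). snd p \<le> fst p} \<in> sets (M \<Otimes>\<^sub>M M)"
    by measurable
  \<comment> \<open>one triangle of the square together with half of the diagonal\<close>
  define k :: "real \<Rightarrow> real \<Rightarrow> real" where "k s t = ((if s < t then 1 else 0) + (if s \<le> t then 1 else 0)) / 2" for s t
  have k_sym: "k s t + k t s = 1" for s t unfolding k_def by auto
  have sp: "space M = UNIV" using sets_eq_imp_space_eq[OF s] by simp
  have spP: "p \<in> space (M \<Otimes>\<^sub>M M)" for p by (cases p) (simp add: space_pair_measure sp)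
  define H1 where "H1 = (\<lambda>(s, t). k s t *\<^sub>R (F' s * G' t))"
  define H2 where "H2 = (\<lambda>(s, t). k t s *\<^sub>R (F' s * G' t))"
  have H1: "integrable (M \<Otimes>\<^sub>M M) H1"
  proof -
    have "integrable (M \<Otimes>\<^sub>M M) (\<lambda>p. (1/2) *\<^sub>R (indicator {p \<in> space (M \<Otimes>\<^sub>M M). fst p < snd p} p *\<^sub>R H0 p) +
       (1/2) *\<^sub>R (indicator {p \<in> space (M \<Otimes>\<^sub>M M). fst p \<le> snd p} p *\<^sub>R H0 p))"
      by (intro Bochner_Integration.integrable_add integrable_scaleR_right integrable_mult_indicator H0 sets_lt)
    moreover have "H1 p = (1/2) *\<^sub>R (indicator {p \<in> space (M \<Otimes>\<^sub>M M). fst p < snd p} p *\<^sub>R H0 p) +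
       (1/2) *\<^sub>R (indicator {p \<in> space (M \<Otimes>\<^sub>M M). fst p \<le> snd p} p *\<^sub>R H0 p)" for p
      using spP[of p] unfolding H1_def H0_def k_def
      by (cases p) (auto simp: indicator_def scaleR_add_left[symmetric])
    ultimately show ?thesis by presburger
  qed
  have H2: "integrable (M \<Otimes>\<^sub>M M) H2"
  proof -
    have "integrable (M \<Otimes>\<^sub>M M) (\<lambda>p. H0 p - H1 p)" by (intro Bochner_Integration.integrable_diff H0 H1)
    moreover have "(\<lambda>p. H0 p - H1 p) = H2"
    proof
      fix p
      have "H0 p = H1 p + H2 p"
        unfolding H0_def H1_def H2_def using k_sym[of "fst p" "snd p"]
        by (cases p) (simp flip: scaleR_add_left)
      then show "H0 p - H1 p = H2 p" by simp
    qed
    ultimately show ?thesis by simp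
  qed
  have sum: "(LINT p|(M \<Otimes>\<^sub>M M). H0 p) = (LINT p|(M \<Otimes>\<^sub>M M). H1 p) + (LINT p|(M \<Otimes>\<^sub>M M). H2 p)"
  proof -
    have "H0 p = H1 p + H2 p" for p
      unfolding H0_def H1_def H2_def using k_sym[of "fst p" "snd p"]
      by (cases p) (simp flip: scaleR_add_left)
    then have "(LINT p|(M \<Otimes>\<^sub>M M). H0 p) = (LINT p|(M \<Otimes>\<^sub>M M). H1 p + H2 p)" by (simp only:)
    also have "\<dots> = (LINT p|(M \<Otimes>\<^sub>M M). H1 p) + (LINT p|(M \<Otimes>\<^sub>M M). H2 p)"
      by (rule Bochner_Integration.integral_add[OF H1 H2])
    finally show ?thesis .
  qed
  have inner: "(LINT s|M. k s t *\<^sub>R (K s)) = ((LINT s:{x<..<t}|M. K0 s) + (LINT s:{x<..t}|M. K0 s)) / 2"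
    if t: "t \<in> ?E" and K0: "set_integrable M ?E K0" and K: "\<And>s. K s = indicator ?E s *\<^sub>R K0 s"
    for t and K0 K :: "real \<Rightarrow> complex"
  proof -
    have i: "set_integrable M {x<..<t} K0" "set_integrable M {x<..t} K0"
      using t by (auto intro!: set_integrable_subset[OF K0] simp: s)
    have "k s t *\<^sub>R K s = (1/2) *\<^sub>R (indicator {x<..<t} s *\<^sub>R K0 s + indicator {x<..t} s *\<^sub>R K0 s)" for s
      using t unfolding K k_def by (auto simp: indicator_def scaleR_conv_of_real)
    then have "(LINT s|M. k s t *\<^sub>R (K s)) =
        (LINT s|M. (1/2) *\<^sub>R (indicator {x<..<t} s *\<^sub>R K0 s + indicator {x<..t} s *\<^sub>R K0 s))"
      by presburger
    also have "\<dots> = (1/2) *\<^sub>R ((LINT s:{x<..<t}|M. K0 s) + (LINT s:{x<..t}|M. K0 s))"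
      using i unfolding set_integrable_def set_lebesgue_integral_def
      by (subst integral_scaleR_right) (simp add: Bochner_Integration.integral_add)
    finally show ?thesis by (simp add: scaleR_conv_of_real)
  qed
  have in1: "(LINT s|M. H1 (s, t)) = indicator ?E t *\<^sub>R ((f t - f0) * G t)" for t
  proof (cases "t \<in> ?E")
    case True
    have "(LINT s|M. H1 (s, t)) = (LINT s|M. (k s t *\<^sub>R F' s) * G' t)"
      unfolding H1_def by simp
    also have "\<dots> = (LINT s|M. k s t *\<^sub>R F' s) * G' t" by (rule integral_mult_left_zero)
    finally show ?thesis
      using True f[OF True] inner[OF True F, of F'] unfolding F'_def G'_def by simp
  next
    case False
    then show ?thesis unfolding H1_def G'_def by simp
  qed
  have in2: "(LINT t|M. H2 (s, t)) = indicator ?E s *\<^sub>R (F s * (g s - g0))" for s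
  proof (cases "s \<in> ?E")
    case True
    have "(LINT t|M. H2 (s, t)) = (LINT t|M. F' s * (k t s *\<^sub>R G' t))"
      unfolding H2_def by (simp add: mult_ac)
    also have "\<dots> = F' s * (LINT t|M. k t s *\<^sub>R G' t)" by (rule integral_mult_right_zero)
    finally show ?thesis
      using True g[OF True] inner[OF True G, of G'] unfolding F'_def G'_def by simp
  next
    case False
    then show ?thesis unfolding H2_def F'_def by simp
  qed
  have H1': "integrable (M \<Otimes>\<^sub>M M) (\<lambda>(s, t). (\<lambda>s t. H1 (s, t)) s t)"
    and H2': "integrable (M \<Otimes>\<^sub>M M) (\<lambda>(s, t). (\<lambda>s t. H2 (s, t)) s t)" using H1 H2 by simp_all
  have i1: "set_integrable M ?E (\<lambda>t. (f t - f0) * G t)"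
    using P.integrable_snd[OF H1'] unfolding in1 set_integrable_def .
  have v1: "(LINT t:?E|M. (f t - f0) * G t) = (LINT p|(M \<Otimes>\<^sub>M M). H1 p)"
    using P.integral_snd[OF H1'] unfolding in1 set_lebesgue_integral_def by simp
  have i2: "set_integrable M ?E (\<lambda>t. F t * (g t - g0))"
    using P.integrable_fst[OF H2'] unfolding in2 set_integrable_def .
  have v2: "(LINT t:?E|M. F t * (g t - g0)) = (LINT p|(M \<Otimes>\<^sub>M M). H2 p)"
    using P.integral_fst[OF H2'] unfolding in2 set_lebesgue_integral_def by simp
  have eq: "f t * G t + F t * g t = ((f t - f0) * G t + F t * (g t - g0)) + (f0 * G t + F t * g0)" for t
    by (simp add: algebra_simps)
  have i3: "set_integrable M ?E (\<lambda>t. f0 * G t)" "set_integrable M ?E (\<lambda>t. F t * g0)"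
    using F G by auto
  note i12 = set_integral_add(1)[OF i1 i2] and i33 = set_integral_add(1)[OF i3]
  show "set_integrable M ?E (\<lambda>t. f t * G t + F t * g t)"
    unfolding eq by (rule set_integral_add(1)[OF i12 i33])
  have "(LINT t:?E|M. f t * G t + F t * g t) =
    ((LINT t:?E|M. (f t - f0) * G t) + (LINT t:?E|M. F t * (g t - g0))) +
    ((LINT t:?E|M. f0 * G t) + (LINT t:?E|M. F t * g0))"
    unfolding eq set_integral_add(2)[OF i12 i33] set_integral_add(2)[OF i1 i2] set_integral_add(2)[OF i3] ..
  also have "\<dots> = (LINT t:?E|M. F t) * (LINT t:?E|M. G t) + (f0 * (LINT t:?E|M. G t) + (LINT t:?E|M. F t) * g0)"
    unfolding v1 v2 sum[symmetric] I0 by (simp add: F'_def[abs_def] G'_def[abs_def] set_lebesgue_integral_def)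
  finally show "(f0 + (LINT t:?E|M. F t)) * (g0 + (LINT t:?E|M. G t)) - f0 * g0 =
      (LINT t:?E|M. f t * G t + F t * g t)"
    by (simp add: algebra_simps)
qed

definition sesq_form :: "complex^2^2 \<Rightarrow> complex^2 \<Rightarrow> complex^2 \<Rightarrow> complex" where
  "sesq_form A v u = (\<Sum>i\<in>UNIV. \<Sum>j\<in>UNIV. cnj (v $ i) * A $ i $ j * u $ j)"

text \<open>The form \<open>v\<^sup>* J u\<close>.\<close>

definition wronskian :: "complex^2 \<Rightarrow> complex^2 \<Rightarrow> complex" where
  "wronskian v u = cnj (v $ 2) * u $ 1 - cnj (v $ 1) * u $ 2"

lemma sesq_form_self: "sesq_form A v v = quad_form A v"
  by (simp add: sesq_form_def quad_form_def)

lemma set_integral_nth: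
  fixes f :: "real \<Rightarrow> complex^2"
  assumes "set_integrable M E f"
  shows "set_integrable M E (\<lambda>t. f t $ i)" "(LINT t:E|M. f t $ i) = (LINT t:E|M. f t) $ i"
proof -
  have eq: "indicator E t *\<^sub>R (f t $ i) = (indicator E t *\<^sub>R f t) $ i" for t by simp
  show "set_integrable M E (\<lambda>t. f t $ i)"
    using integrable_bounded_linear[OF bounded_linear_vec_nth, of M "\<lambda>t. indicator E t *\<^sub>R f t" i] assms
    unfolding set_integrable_def eq by blast
  show "(LINT t:E|M. f t $ i) = (LINT t:E|M. f t) $ i"
    using integral_bounded_linear[OF bounded_linear_vec_nth, of M "\<lambda>t. indicator E t *\<^sub>R f t" i] assms
    unfolding set_integrable_def set_lebesgue_integral_def eq by blast
qed

lemma set_integral_cnj: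
  fixes f :: "real \<Rightarrow> complex"
  shows "set_integrable M E (\<lambda>t. cnj (f t)) \<longleftrightarrow> set_integrable M E f"
    "(LINT t:E|M. cnj (f t)) = cnj (LINT t:E|M. f t)"
proof -
  have eq: "indicator E t *\<^sub>R cnj (f t) = cnj (indicator E t *\<^sub>R f t)" for t by simp
  show "set_integrable M E (\<lambda>t. cnj (f t)) \<longleftrightarrow> set_integrable M E f"
    unfolding set_integrable_def eq by (rule complex_integrable_cnj)
  show "(LINT t:E|M. cnj (f t)) = cnj (LINT t:E|M. f t)"
    unfolding set_lebesgue_integral_def eq by (rule Bochner_Integration.integral_cnj)
qed

lemma hermitian_nth:
  assumes "conj_transpose A = A" shows "cnj (A $ i $ j) = A $ j $ i"
  using assms by (metis (no_types, lifting) conj_transpose_def vec_lambda_beta)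

context density_system
begin

lemma solution_mean_value:
  assumes sol: "is_solution b q w z u" and xt: "0 < x" "x < t" "ereal t < b"
  shows "u t $ i = right_lim u x $ i + ((LINT s:{x<..<t}|\<nu>. derivative_density z u s $ i) +
    (LINT s:{x<..t}|\<nu>. derivative_density z u s $ i)) / 2"
proof -
  have t: "t \<in> einterval 0 b" using xt by (simp add: in_einterval_0)
  have loc: "{x<..<t} \<in> local_sets b" "{x<..t} \<in> local_sets b"
    using xt by (auto intro!: local_setsI[of _ x t])
  note i = derivative_density_integrable(1)[OF solution_BV[OF sol] loc(1), of z]
    derivative_density_integrable(1)[OF solution_BV[OF sol] loc(2), of z]
  show ?thesis
    unfolding set_integral_nth(2)[OF i(1)] set_integral_nth(2)[OF i(2)]
    by (subst solution_balanced[OF sol t])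
      (simp add: right_lim_diff[OF sol xt] left_lim_diff[OF sol xt] scaleR_conv_of_real[where 'a=complex] field_simps)
qed

text \<open>
  The derivative of \<open>v\<^sup>* J u\<close> is \<open>v\<^sup>* (J u') - (J v')\<^sup>* u\<close>. Inserting the two equations, the terms
  with \<open>q\<close> cancel because \<open>q\<close> is Hermitian, and those with \<open>w\<close> combine to the factor
  \<open>z - cnj z'\<close>. For \<open>z' = cnj z\<close> the form is therefore constant.
\<close>

theorem lagrange_identity:
  assumes u: "is_solution b q w z u" and v: "is_solution b q w z' v"
    and xy: "0 < x" "x < y" "ereal y < b"
  shows "set_integrable \<nu> {x<..y} (\<lambda>t. (z - cnj z') * sesq_form (W t) (v t) (u t))"
    and "wronskian (right_lim v y) (right_lim u y) - wronskian (right_lim v x) (right_lim u x) =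
      (LINT t:{x<..y}|\<nu>. (z - cnj z') * sesq_form (W t) (v t) (u t))"
proof -
  let ?E = "{x<..y}"
  have loc: "?E \<in> local_sets b" using xy by (intro local_sets_Ioc)
  let ?Du = "derivative_density z u" and ?Dv = "derivative_density z' v"
  note iu = derivative_density_integrable(1)[OF solution_BV[OF u] loc, of z]
  note iv = derivative_density_integrable(1)[OF solution_BV[OF v] loc, of z']
  have tE: "0 < x" "x < t" "ereal t < b" if "t \<in> ?E" for t
    using that xy by (auto intro: le_less_trans[of "ereal t" "ereal y"])
  have mu: "u t $ i = right_lim u x $ i + ((LINT s:{x<..<t}|\<nu>. ?Du s $ i) + (LINT s:{x<..t}|\<nu>. ?Du s $ i)) / 2"
    if "t \<in> ?E" for t i using solution_mean_value[OF u tE[OF that]] .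
  have mv: "cnj (v t $ i) = cnj (right_lim v x $ i) +
      ((LINT s:{x<..<t}|\<nu>. cnj (?Dv s $ i)) + (LINT s:{x<..t}|\<nu>. cnj (?Dv s $ i))) / 2"
    if "t \<in> ?E" for t i
    unfolding set_integral_cnj by (subst solution_mean_value[OF v tE[OF that]]) simp
  have icv: "set_integrable \<nu> ?E (\<lambda>t. cnj (?Dv t $ i))" for i
    using set_integral_nth(1)[OF iv] by (simp add: set_integral_cnj)
  have parts_int: "set_integrable \<nu> ?E (\<lambda>t. cnj (v t $ i) * ?Du t $ j + cnj (?Dv t $ i) * u t $ j)" for i j
    by (rule balanced_integration_by_parts(1)[OF nu_sigma_finite sets_nu icv set_integral_nth(1)[OF iu] mv mu])
  have parts: "cnj (right_lim v y $ i) * right_lim u y $ j - cnj (right_lim v x $ i) * right_lim u x $ j =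
    (LINT t:?E|\<nu>. cnj (v t $ i) * ?Du t $ j + cnj (?Dv t $ i) * u t $ j)" for i j
  proof -
    have ru: "right_lim u y $ j = right_lim u x $ j + (LINT t:?E|\<nu>. ?Du t $ j)"
      unfolding right_lim_diff[OF u xy] set_integral_nth(2)[OF iu] by simp
    have rv: "cnj (right_lim v y $ i) = cnj (right_lim v x $ i) + (LINT t:?E|\<nu>. cnj (?Dv t $ i))"
      unfolding right_lim_diff[OF v xy] set_integral_cnj set_integral_nth(2)[OF iv] by simp
    show ?thesis unfolding ru rv
      by (rule balanced_integration_by_parts(2)[OF nu_sigma_finite sets_nu icv set_integral_nth(1)[OF iu] mv mu])
  qed
  have point: "(cnj (v t $ 2) * ?Du t $ 1 + cnj (?Dv t $ 2) * u t $ 1)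
      - (cnj (v t $ 1) * ?Du t $ 2 + cnj (?Dv t $ 1) * u t $ 2)
      = (z - cnj z') * sesq_form (W t) (v t) (u t)" for t
  proof -
    note hQ = hermitian_nth[OF Q_hermitian] and hW = hermitian_nth[OF W_hermitian]
    show ?thesis
      unfolding derivative_density_def sesq_form_def Jmat_mult_nth
      by (simp add: matrix_vector_mult_def sum_2 hQ hW algebra_simps)
  qed
  show "set_integrable \<nu> ?E (\<lambda>t. (z - cnj z') * sesq_form (W t) (v t) (u t))"
    unfolding point[symmetric] by (rule set_integral_diff(1)[OF parts_int parts_int])
  show "wronskian (right_lim v y) (right_lim u y) - wronskian (right_lim v x) (right_lim u x) =
      (LINT t:?E|\<nu>. (z - cnj z') * sesq_form (W t) (v t) (u t))"
    unfolding point[symmetric] set_integral_diff(2)[OF parts_int parts_int] parts[symmetric] wronskian_def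
    by (simp add: algebra_simps)
qed

end

lemma quad_form_add: "quad_form A (u + v) = quad_form A u + sesq_form A u v + sesq_form A v u + quad_form A v"
  by (simp add: quad_form_def sesq_form_def sum_2 algebra_simps)

lemma quad_form_vmult: "quad_form A (a *s v) = of_real ((cmod a)\<^sup>2) * quad_form A v"
  unfolding complex_norm_square by (simp add: quad_form_def sum_2 algebra_simps)

lemma quad_form_parallelogram:
  "quad_form A (u + v) + quad_form A (u - v) = 2 * quad_form A u + 2 * quad_form A v"
  by (simp add: quad_form_def sum_2 algebra_simps)

text \<open>Moving from \<open>v\<close> in the direction \<open>- A v\<close> would make the form negative.\<close>

lemma nonneg_form_kernel:
  assumes A: "conj_transpose A = A" and nn: "\<And>v. 0 \<le> Re (quad_form A v)" and v: "Re (quad_form A v) = 0"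
  shows "A *v v = 0"
proof -
  define n where "n = (cmod ((A *v v) $ 1))\<^sup>2 + (cmod ((A *v v) $ 2))\<^sup>2"
  define a where "a = Re (quad_form A (A *v v))"
  have n0: "0 \<le> n" and a0: "0 \<le> a" unfolding n_def a_def using nn by auto
  have 1: "sesq_form A (A *v v) v = of_real n"
    unfolding n_def of_real_add complex_norm_square
    by (simp add: sesq_form_def matrix_vector_mult_def sum_2 algebra_simps)
  have 2: "sesq_form A v (A *v v) = of_real n"
    unfolding n_def of_real_add complex_norm_square
    by (simp add: sesq_form_def matrix_vector_mult_def sum_2 hermitian_nth[OF A] algebra_simps)
  \<comment> \<open>a step short enough that the quadratic term is dominated; \<open>a + 1\<close> because \<open>a\<close> may vanish\<close>
  define e where "e = n / (a + 1)"
  have "quad_form A (v + of_real (- e) *s (A *v v)) =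
    quad_form A v + of_real (- e) * sesq_form A v (A *v v) + of_real (- e) * sesq_form A (A *v v) v
      + of_real (e\<^sup>2) * quad_form A (A *v v)"
    unfolding quad_form_add quad_form_vmult
    by (simp add: sesq_form_def sum_2 algebra_simps power2_eq_square)
  then have "Re (quad_form A (v + of_real (- e) *s (A *v v))) = - 2 * e * n + e\<^sup>2 * a"
    unfolding 1 2 using v by (simp add: a_def power2_eq_square)
  then have "2 * e * n \<le> e\<^sup>2 * a" using nn[of "v + of_real (- e) *s (A *v v)"] by linarith
  moreover have "e\<^sup>2 * a \<le> e * n"
  proof -
    have "e * a \<le> n" unfolding e_def using n0 a0 by (simp add: field_simps)
    then show ?thesis using n0 a0 unfolding power2_eq_square e_def
      by (metis divide_nonneg_nonneg add_nonneg_nonneg mult.assoc mult_left_mono zero_le_one)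
  qed
  ultimately have "e * n \<le> 0" by linarith
  then have "n * n \<le> 0" unfolding e_def using a0 by (simp add: field_simps)
  then have "n = 0" using n0 by (simp add: mult_le_0_iff)
  then have "(A *v v) $ 1 = 0 \<and> (A *v v) $ 2 = 0"
    unfolding n_def by (simp add: add_nonneg_eq_0_iff)
  then show ?thesis by (simp add: vec_eq_iff forall_2)
qed

lemma tendsto_wronskian [tendsto_intros]:
  "(f \<longlongrightarrow> v) F \<Longrightarrow> (g \<longlongrightarrow> u) F \<Longrightarrow> ((\<lambda>x. wronskian (f x) (g x)) \<longlongrightarrow> wronskian v u) F"
  unfolding wronskian_def by (intro tendsto_intros)

context density_system
begin

text \<open>\<open>energy u\<close> is the measure whose value on \<open>X\<close> is the squared norm of \<open>u\<close> over \<open>X\<close>; norms over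
  unions and limits of intervals become statements about this measure. Cutting \<open>u\<close> off outside
  \<open>(0,b)\<close> makes the density Borel measurable.\<close>

definition energy_density :: "(real \<Rightarrow> complex^2) \<Rightarrow> real \<Rightarrow> ennreal" where
  "energy_density u x = ennreal (Re (quad_form (W x) (indicator (einterval 0 b) x *\<^sub>R u x)))"

definition energy :: "(real \<Rightarrow> complex^2) \<Rightarrow> real measure" where
  "energy u = density \<nu> (energy_density u)"

lemma sets_energy [simp]: "sets (energy u) = sets borel"
  unfolding energy_def by simp

lemma energy_density_borel:
  assumes "locally_BV b u" shows "energy_density u \<in> borel_measurable borel"
proof -
  have "(\<lambda>x. indicator (einterval 0 b) x *\<^sub>R u x) \<in> borel_measurable borel"
    using locally_BV_borel[OF b_pos assms] by simp
  then have "(\<lambda>x. quad_form (W x) (indicator (einterval 0 b) x *\<^sub>R u x)) \<in> borel_measurable borel"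
    by (rule borel_measurable_quad_form[OF W_borel])
  then show ?thesis unfolding energy_density_def[abs_def] by measurable
qed

lemma energy_density_borel':
  "locally_BV b u \<Longrightarrow> energy_density u \<in> borel_measurable \<nu>"
  using energy_density_borel by (simp add: measurable_cong_sets[OF sets_nu refl])

lemma norm2_on_energy:
  assumes u: "locally_BV b u" and X: "X \<in> sets borel" "X \<subseteq> einterval 0 b"
  shows "norm2_on b w X u = emeasure (energy u) X"
proof -
  have "norm2_on b w X u = (\<integral>\<^sup>+x\<in>X. ennreal (Re (quad_form (W x) (u x))) \<partial>\<nu>)"
    by (rule norm2_on_density[OF X(1) locally_BV_borel[OF b_pos u X]])
  also have "\<dots> = (\<integral>\<^sup>+x\<in>X. energy_density u x \<partial>\<nu>)"
    using X(2) by (intro nn_integral_cong) (auto simp: energy_density_def indicator_def)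
  also have "\<dots> = emeasure (energy u) X"
    unfolding energy_def using X energy_density_borel'[OF u] by (intro emeasure_density[symmetric]) auto
  finally show ?thesis .
qed

text \<open>Lagrange's identity for \<open>v = u\<close>, read as a formula for the norm.\<close>

lemma energy_Ioc:
  assumes u: "is_solution b q w z u" and z: "Im z \<noteq> 0" and xy: "0 < x" "x < y" "ereal y < b"
  defines "r \<equiv> (Im (wronskian (right_lim u y) (right_lim u y)) - Im (wronskian (right_lim u x) (right_lim u x))) / (2 * Im z)"
  shows "emeasure (energy u) {x<..y} = ennreal r" "0 \<le> r"
proof -
  let ?E = "{x<..y}"
  have loc: "?E \<in> local_sets b" using xy by (intro local_sets_Ioc)
  have EI: "?E \<subseteq> einterval 0 b" by (rule local_sets_subset_einterval[OF loc])
  have zz: "z - cnj z = 2 * \<i> * of_real (Im z)" by (simp add: complex_eq_iff)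
  have Im_mult: "Im ((z - cnj z) * I) = 2 * Im z * Re I" for I by simp
  have zz0: "z - cnj z \<noteq> 0" unfolding zz using z by simp
  note L = lagrange_identity[OF u u xy, unfolded sesq_form_self]
  have int: "set_integrable \<nu> ?E (\<lambda>t. quad_form (W t) (u t))"
    using set_integrable_mult_right[where a = "inverse (z - cnj z)", OF L(1)] zz0
    by (simp add: mult.assoc[symmetric])
  have intR: "set_integrable \<nu> ?E (\<lambda>t. Re (quad_form (W t) (u t)))"
    using int unfolding set_integrable_def
    by (auto dest: integrable_Re)
  have valR: "(LINT t:?E|\<nu>. Re (quad_form (W t) (u t))) = Re (LINT t:?E|\<nu>. quad_form (W t) (u t))"
    using int unfolding set_integrable_def set_lebesgue_integral_def
    by (subst integral_Re[symmetric]) auto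
  have "wronskian (right_lim u y) (right_lim u y) - wronskian (right_lim u x) (right_lim u x) =
     (z - cnj z) * (LINT t:?E|\<nu>. quad_form (W t) (u t))"
    unfolding L(2) by simp
  then have "Im (wronskian (right_lim u y) (right_lim u y)) - Im (wronskian (right_lim u x) (right_lim u x)) =
      2 * Im z * Re (LINT t:?E|\<nu>. quad_form (W t) (u t))"
    by (metis (no_types, lifting) Im_mult minus_complex.simps(2))
  then have r: "r = (LINT t:?E|\<nu>. Re (quad_form (W t) (u t)))"
    unfolding r_def valR using z by simp
  show "0 \<le> r" unfolding r set_lebesgue_integral_def
    by (intro Bochner_Integration.integral_nonneg) (simp add: W_nonneg)
  have "emeasure (energy u) ?E = (\<integral>\<^sup>+x\<in>?E. energy_density u x \<partial>\<nu>)"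
    unfolding energy_def using energy_density_borel'[OF solution_BV[OF u]] by (intro emeasure_density) auto
  also have "\<dots> = (\<integral>\<^sup>+x. ennreal (indicator ?E x *\<^sub>R Re (quad_form (W x) (u x))) \<partial>\<nu>)"
    using EI by (intro nn_integral_cong) (auto simp: energy_density_def indicator_def)
  also have "\<dots> = ennreal r"
    unfolding r set_lebesgue_integral_def
    using intR W_nonneg unfolding set_integrable_def by (intro nn_integral_eq_integral) auto
  finally show "emeasure (energy u) ?E = ennreal r" .
qed

lemma right_lim_at_0:
  assumes sol: "is_solution b q w z u" and u0: "(u \<longlongrightarrow> u0) (at_right 0)"
  shows "(right_lim u \<longlongrightarrow> u0) (at_right 0)"
proof (rule tendsto_right_lim[OF u0])
  obtain d where d: "0 < d" "ereal d < b" using ereal_dense2[OF b_pos[unfolded zero_ereal_def]] by auto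
  show "eventually (\<lambda>t. (u \<longlongrightarrow> right_lim u t) (at_right t)) (at_right 0)"
    using eventually_at_right_real[OF d(1)]
  proof eventually_elim
    case (elim t)
    then have "t \<in> einterval 0 b" using d by (auto simp: in_einterval_0 intro: less_trans[of "ereal t" "ereal d"])
    then show ?case by (rule solution_right_lim[OF sol])
  qed
  fix P assume "eventually P (at_right (0::real))"
  then obtain s where s: "0 < s" "\<And>t. 0 < t \<Longrightarrow> t < s \<Longrightarrow> P t"
    unfolding eventually_at_right_field by blast
  have "eventually P (at_right t)" if "t \<in> {0<..<s}" for t
    using eventually_at_right_real[of t s] that s(2) by (auto elim!: eventually_mono)
  then show "eventually (\<lambda>t. eventually P (at_right t)) (at_right 0)"
    using eventually_at_right_real[OF s(1)] by (rule eventually_mono[rotated])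
qed

text \<open>Let the left end of \<open>(x,c]\<close> tend to \<open>0\<close>: the norms increase and the boundary terms converge, so
  the norm over \<open>(0,c]\<close> is finite.\<close>

lemma energy_from_0:
  assumes u: "is_solution b q w z u" and z: "Im z \<noteq> 0" and u0: "(u \<longlongrightarrow> u0) (at_right 0)"
    and c: "c \<in> einterval 0 b"
  defines "r \<equiv> (Im (wronskian (right_lim u c) (right_lim u c)) - Im (wronskian u0 u0)) / (2 * Im z)"
  shows "emeasure (energy u) {0<..c} = ennreal r" "0 \<le> r"
proof -
  have c0: "0 < c" "ereal c < b" using c by (auto simp: in_einterval_0)
  define x where "x n = c / (real n + 2)" for n
  have x: "0 < x n" "x n < c" for n
  proof -
    have "c / (real n + 2) < c / 1"
      using c0 by (intro divide_strict_left_mono) (auto simp: add_pos_pos)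
    then show "0 < x n" "x n < c" unfolding x_def using c0 by auto
  qed
  have x_lim: "x \<longlonglongrightarrow> 0" unfolding x_def by real_asymp
  have x_at: "filterlim x (at_right 0) sequentially"
    using x_lim x by (auto simp: filterlim_at intro!: always_eventually) (metis less_irrefl)
  have x_dec: "x n \<le> x m" if "m \<le> n" for m n
    unfolding x_def using that c0 by (intro divide_left_mono) auto
  have U: "(\<Union>n. {x n<..c}) = {0<..c}"
  proof (intro equalityI subsetI)
    fix t assume t: "t \<in> {0<..c}"
    then have "eventually (\<lambda>n. x n < t) sequentially" using order_tendstoD(2)[OF x_lim] by auto
    then obtain n where "x n < t" by (auto simp: eventually_sequentially)
    then show "t \<in> (\<Union>n. {x n<..c})" using t by auto
  next
    fix t assume "t \<in> (\<Union>n. {x n<..c})"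
    then obtain n where "x n < t" "t \<le> c" by auto
    then show "t \<in> {0<..c}" using x(1)[of n] by simp
  qed
  define rn where "rn n = (Im (wronskian (right_lim u c) (right_lim u c)) -
    Im (wronskian (right_lim u (x n)) (right_lim u (x n)))) / (2 * Im z)" for n
  have en: "emeasure (energy u) {x n<..c} = ennreal (rn n)" "0 \<le> rn n" for n
    using energy_Ioc[OF u z x(1) x(2) c0(2)] unfolding rn_def by auto
  have lim: "rn \<longlonglongrightarrow> r"
    unfolding rn_def r_def
    by (intro tendsto_intros filterlim_compose[OF right_lim_at_0[OF u u0] x_at]) (use z in auto)
  show "0 \<le> r" by (rule LIMSEQ_le_const[OF lim]) (use en in auto)
  have "(\<lambda>n. emeasure (energy u) {x n<..c}) \<longlonglongrightarrow> emeasure (energy u) (\<Union>n. {x n<..c})"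
  proof (rule Lim_emeasure_incseq)
    show "incseq (\<lambda>n. {x n<..c})" using x_dec by (fastforce simp: incseq_def)
  qed auto
  moreover have "(\<lambda>n. emeasure (energy u) {x n<..c}) \<longlonglongrightarrow> ennreal r"
    unfolding en by (rule tendsto_ennrealI[OF lim])
  ultimately show "emeasure (energy u) {0<..c} = ennreal r"
    unfolding U by (rule LIMSEQ_unique)
qed

lemma energy_continuity_point:
  assumes u: "is_solution b q w z u" and c: "continuity_point b q w c"
  shows "norm2_on b w {0<..<c} u = emeasure (energy u) {0<..c}"
proof -
  have cI: "c \<in> einterval 0 b" and w0: "w {c} = 0" using c unfolding continuity_point_def by auto
  have c0: "0 < c" "ereal c < b" using cI by (auto simp: in_einterval_0)
  have fin: "emeasure \<nu> {c} < \<infinity>" by (rule nu_finite[OF singleton_local[OF cI]])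
  have "energy_density u c * emeasure \<nu> {c} = 0"
  proof (cases "measure \<nu> {c} = 0")
    case True
    then have "emeasure \<nu> {c} = 0" using fin by (simp add: emeasure_eq_ennreal_measure less_top)
    then show ?thesis by simp
  next
    case False
    then have "W c = 0" using point_mass(2)[OF cI] w0 by simp
    then show ?thesis by (simp add: energy_density_def quad_form_def)
  qed
  moreover have "emeasure (energy u) {c} = energy_density u c * emeasure \<nu> {c}"
    unfolding energy_def using energy_density_borel'[OF solution_BV[OF u]]
    by (subst emeasure_density) (auto simp: nn_integral_indicator_singleton)
  ultimately have 0: "emeasure (energy u) {c} = 0" by simp
  have U: "{0<..c} = {0<..<c} \<union> {c}" using c0 by auto
  have "emeasure (energy u) {0<..c} = emeasure (energy u) {0<..<c} + emeasure (energy u) {c}"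
    unfolding U by (intro plus_emeasure[symmetric]) auto
  moreover have "{0<..<c} \<subseteq> einterval 0 b"
  proof
    fix t assume "t \<in> {0<..<c}"
    then have "0 < t" "ereal t < ereal c" by auto
    then show "t \<in> einterval 0 b"
      using c0 unfolding in_einterval_0 by (auto intro: less_trans[of "ereal t" "ereal c"])
  qed
  ultimately show ?thesis
    using norm2_on_energy[OF solution_BV[OF u], of "{0<..<c}"] 0 by simp
qed

lemma norm2_energy:
  assumes "is_solution b q w z u"
  shows "norm2 b w u = emeasure (energy u) (einterval 0 b)"
  by (rule norm2_on_energy[OF solution_BV[OF assms]]) auto

lemma norm2_nn_integral:
  assumes u: "is_solution b q w z u"
  shows "norm2 b w u = (\<integral>\<^sup>+x. energy_density u x \<partial>\<nu>)"
proof -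
  have "norm2 b w u = (\<integral>\<^sup>+x\<in>einterval 0 b. energy_density u x \<partial>\<nu>)"
    unfolding norm2_energy[OF u] energy_def
    using energy_density_borel'[OF solution_BV[OF u]] by (intro emeasure_density) auto
  also have "\<dots> = (\<integral>\<^sup>+x. energy_density u x \<partial>\<nu>)"
    by (intro nn_integral_cong) (auto simp: energy_density_def indicator_def quad_form_def)
  finally show ?thesis .
qed

text \<open>The parallelogram law bounds the form of a sum by twice the sum of the forms.\<close>

lemma norm2_linear_finite:
  assumes u: "is_solution b q w z u" and v: "is_solution b q w z v"
    and fin: "norm2 b w u < \<infinity>" "norm2 b w v < \<infinity>"
  shows "norm2 b w (\<lambda>x. a *s u x + c *s v x) < \<infinity>"
proof -
  let ?f = "\<lambda>x. a *s u x + c *s v x"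
  let ?A = "2 * (cmod a)\<^sup>2" and ?C = "2 * (cmod c)\<^sup>2"
  have pt: "energy_density ?f x \<le> ennreal ?A * energy_density u x + ennreal ?C * energy_density v x" for x
  proof (cases "x \<in> einterval 0 b")
    case True
    have "Re (quad_form (W x) (?f x)) \<le> ?A * Re (quad_form (W x) (u x)) + ?C * Re (quad_form (W x) (v x))"
      using arg_cong[OF quad_form_parallelogram[of "W x" "a *s u x" "c *s v x"], of Re]
        W_nonneg[of x "a *s u x - c *s v x"]
      unfolding quad_form_vmult by simp
    then have "ennreal (Re (quad_form (W x) (?f x))) \<le>
      ennreal (?A * Re (quad_form (W x) (u x)) + ?C * Re (quad_form (W x) (v x)))"
      by (rule ennreal_leI)
    then show ?thesis
      using True W_nonneg unfolding energy_density_def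
      by (simp add: ennreal_plus ennreal_mult' del: ennreal_plus[symmetric])
  next
    case False
    then show ?thesis by (simp add: energy_density_def quad_form_def)
  qed
  have "norm2 b w ?f = (\<integral>\<^sup>+x. energy_density ?f x \<partial>\<nu>)"
    by (rule norm2_nn_integral[OF solution_linear(1)[OF u v]])
  also have "\<dots> \<le> (\<integral>\<^sup>+x. ennreal ?A * energy_density u x + ennreal ?C * energy_density v x \<partial>\<nu>)"
    by (intro nn_integral_mono pt)
  also have "\<dots> = ennreal ?A * norm2 b w u + ennreal ?C * norm2 b w v"
    unfolding norm2_nn_integral[OF u] norm2_nn_integral[OF v]
    using energy_density_borel'[OF solution_BV[OF u]] energy_density_borel'[OF solution_BV[OF v]]
    by (simp add: nn_integral_add nn_integral_cmult)
  also have "\<dots> < \<infinity>" using fin by (simp add: ennreal_mult_less_top)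
  finally show ?thesis .
qed

text \<open>A solution of norm zero satisfies \<open>w u = 0\<close>, hence solves the equation for every parameter.\<close>

lemma norm2_eq_0_solution:
  assumes u: "is_solution b q w z u" and 0: "norm2 b w u = 0"
  shows "is_solution b q w z' u"
proof -
  have "AE x in \<nu>. energy_density u x = 0"
    using 0 unfolding norm2_nn_integral[OF u]
    by (subst (asm) nn_integral_0_iff_AE[OF energy_density_borel'[OF solution_BV[OF u]]])
  then have ae: "AE x in \<nu>. x \<in> einterval 0 b \<longrightarrow> W x *v u x = 0"
  proof eventually_elim
    case (elim x)
    show ?case
    proof
      assume "x \<in> einterval 0 b"
      then have "Re (quad_form (W x) (u x)) = 0"
        using elim W_nonneg[of x "u x"] by (simp add: energy_density_def ennreal_eq_0_iff)
      then show "W x *v u x = 0" by (rule nonneg_form_kernel[OF W_hermitian W_nonneg])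
    qed
  qed
  have w0: "apply_measure b w u E = 0" if E: "E \<in> local_sets b" for E
  proof -
    have um: "(\<lambda>x. indicator E x *\<^sub>R u x) \<in> borel_measurable borel"
      by (rule locally_BV_borel[OF b_pos solution_BV[OF u] local_sets_borel[OF E] local_sets_subset_einterval[OF E]])
    have "AE x in \<nu>. indicator E x *\<^sub>R (W x *v u x) = 0"
      using ae by eventually_elim (use local_sets_subset_einterval[OF E] in \<open>auto simp: indicator_def\<close>)
    then have "(LINT x:E|\<nu>. W x *v u x) = 0"
      unfolding set_lebesgue_integral_def by (rule integral_eq_zero_AE)
    then show ?thesis unfolding apply_w[OF E um] .
  qed
  show ?thesis using u w0 unfolding is_solution_def by simp
qed

end

section \<open>Weyl circles, nested disks and evaluation of solutions\<close>

text \<open>Inclusion of balls means \<open>dist + r' \<le> r\<close>. Hence the radii decrease, the centres form a Cauchy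
  sequence, and the inequality survives in the limit.\<close>

lemma nested_cballs:
  fixes x :: "nat \<Rightarrow> 'a::euclidean_space"
  assumes r: "\<And>n. 0 \<le> r n" and sub: "\<And>n. cball (x (Suc n)) (r (Suc n)) \<subseteq> cball (x n) (r n)"
  obtains L \<rho> where "r \<longlonglongrightarrow> \<rho>" "0 \<le> \<rho>" "(\<Inter>n. cball (x n) (r n)) = cball L \<rho>"
proof -
  have step: "dist (x k) (x n) + r k \<le> r n" if "n \<le> k" for n k
    using that
  proof (induction rule: dec_induct)
    case (step k)
    have "dist (x (Suc k)) (x k) + r (Suc k) \<le> r k"
      using sub[of k] r[of "Suc k"] by (simp add: cball_subset_cball_iff)
    then show ?case using step.IH dist_triangle[of "x (Suc k)" "x n" "x k"] by linarith
  qed simp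
  have "decseq r"
    unfolding decseq_def using step zero_le_dist by (meson add_increasing le_add_same_cancel2 order_trans)
  then obtain \<rho> where \<rho>: "r \<longlonglongrightarrow> \<rho>" "\<And>n. \<rho> \<le> r n"
    using decseq_convergent[of r 0] r by blast
  have "Cauchy x"
    unfolding Cauchy_altdef2
  proof (intro allI impI)
    fix e :: real assume e: "0 < e"
    have "eventually (\<lambda>n. r n < \<rho> + e) sequentially" using order_tendstoD(2)[OF \<rho>(1)] e by simp
    then obtain N where "r N < \<rho> + e" by (auto simp: eventually_sequentially)
    then have "\<forall>n\<ge>N. dist (x n) (x N) < e"
      using step[of N] \<rho>(2) by (smt (verit, best))
    then show "\<exists>N. \<forall>n\<ge>N. dist (x n) (x N) < e" by blast
  qed
  then obtain L where L: "x \<longlonglongrightarrow> L" using Cauchy_convergent_iff convergent_def by blast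
  have in1: "dist L (x n) + \<rho> \<le> r n" for n
  proof (rule LIMSEQ_le_const2)
    show "(\<lambda>k. dist (x k) (x n) + r k) \<longlonglongrightarrow> dist L (x n) + \<rho>" by (intro tendsto_intros L \<rho>(1))
  qed (use step in blast)
  have "(\<Inter>n. cball (x n) (r n)) = cball L \<rho>"
  proof (intro equalityI subsetI)
    fix y assume "y \<in> (\<Inter>n. cball (x n) (r n))"
    then have "dist (x n) y \<le> r n" for n by auto
    then have "dist L y \<le> \<rho>"
      by (intro LIMSEQ_le[OF tendsto_dist[OF L tendsto_const] \<rho>(1)]) auto
    then show "y \<in> cball L \<rho>" by simp
  next
    fix y assume "y \<in> cball L \<rho>"
    then have "dist (x n) y \<le> r n" for n
      using in1[of n] dist_triangle[of "x n" y L] by (simp add: dist_commute)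
    then show "y \<in> (\<Inter>n. cball (x n) (r n))" by auto
  qed
  moreover have "0 \<le> \<rho>" by (rule LIMSEQ_le_const[OF \<rho>(1)]) (use r in auto)
  ultimately show ?thesis using \<rho>(1) that by blast
qed

lemma wronskian_det:
  "wronskian a u * wronskian b v - wronskian a v * wronskian b u =
    cnj (a $ 1 * b $ 2 - a $ 2 * b $ 1) * (u $ 1 * v $ 2 - u $ 2 * v $ 1)"
  by (simp add: wronskian_def algebra_simps)

lemma wronskian_skew: "wronskian u v = - cnj (wronskian v u)"
  by (simp add: wronskian_def)

text \<open>The off-diagonal entries of \<open>F\<^sup>* J F\<close> are controlled by diagonal ones.\<close>

lemma wronskian_polarization:
  "cmod (wronskian u v) \<le> cmod (wronskian (u + v) (u + v)) + cmod (wronskian (u + \<i> *s v) (u + \<i> *s v))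
    + 2 * cmod (wronskian u u) + 2 * cmod (wronskian v v)"
proof -
  let ?w = "wronskian u v"
  have 1: "wronskian (u + v) (u + v) - wronskian u u - wronskian v v = ?w - cnj ?w"
    by (simp add: wronskian_def algebra_simps)
  have 2: "wronskian (u + \<i> *s v) (u + \<i> *s v) - wronskian u u - wronskian v v = \<i> * (?w + cnj ?w)"
    by (simp add: wronskian_def algebra_simps)
  have "2 * \<bar>Im ?w\<bar> \<le> cmod (?w - cnj ?w)" "2 * \<bar>Re ?w\<bar> \<le> cmod (\<i> * (?w + cnj ?w))"
    using abs_Im_le_cmod[of "?w - cnj ?w"] abs_Re_le_cmod[of "?w + cnj ?w"] by (auto simp: norm_mult)
  moreover have "cmod (?w - cnj ?w) \<le> cmod (wronskian (u + v) (u + v)) + cmod (wronskian u u) + cmod (wronskian v v)"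
    "cmod (\<i> * (?w + cnj ?w)) \<le> cmod (wronskian (u + \<i> *s v) (u + \<i> *s v)) + cmod (wronskian u u) + cmod (wronskian v v)"
    unfolding 1[symmetric] 2[symmetric]
    by (rule order_trans[OF norm_triangle_ineq4] add_right_mono norm_triangle_ineq4)+
  moreover have "cmod ?w \<le> \<bar>Re ?w\<bar> + \<bar>Im ?w\<bar>" by (rule cmod_le)
  ultimately show ?thesis
    using norm_ge_zero[of "wronskian (u + v) (u + v)"]
      norm_ge_zero[of "wronskian (u + \<i> *s v) (u + \<i> *s v)"]
      norm_ge_zero[of "wronskian u u"] norm_ge_zero[of "wronskian v v"] by linarith
qed

lemma linear_combination_vanishes_iff:
  fixes p v :: "complex^2"
  shows "(\<forall>a c. a *s p + c *s v = 0 \<longrightarrow> a = 0 \<and> c = 0) \<longleftrightarrow> p $ 1 * v $ 2 - p $ 2 * v $ 1 \<noteq> 0"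
proof
  assume ind: "\<forall>a c. a *s p + c *s v = 0 \<longrightarrow> a = 0 \<and> c = 0"
  show "p $ 1 * v $ 2 - p $ 2 * v $ 1 \<noteq> 0"
  proof
    assume d: "p $ 1 * v $ 2 - p $ 2 * v $ 1 = 0"
    have "v $ 1 *s p + (- (p $ 1)) *s v = 0" "v $ 2 *s p + (- (p $ 2)) *s v = 0"
      using d by (simp_all add: vec_eq_iff forall_2 algebra_simps)
    then have "v $ 1 = 0" "v $ 2 = 0" using ind by blast+
    then have "0 *s p + 1 *s v = 0" by (simp add: vec_eq_iff forall_2)
    then show False using ind by (metis zero_neq_one)
  qed
next
  assume d: "p $ 1 * v $ 2 - p $ 2 * v $ 1 \<noteq> 0"
  show "\<forall>a c. a *s p + c *s v = 0 \<longrightarrow> a = 0 \<and> c = 0"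
  proof (intro allI impI)
    fix a c assume "a *s p + c *s v = 0"
    then have e: "a * p $ 1 + c * v $ 1 = 0" "a * p $ 2 + c * v $ 2 = 0"
      by (auto simp: vec_eq_iff forall_2)
    have "a * (p $ 1 * v $ 2 - p $ 2 * v $ 1) = (a * p $ 1 + c * v $ 1) * v $ 2 - (a * p $ 2 + c * v $ 2) * v $ 1"
      "c * (p $ 1 * v $ 2 - p $ 2 * v $ 1) = (a * p $ 2 + c * v $ 2) * p $ 1 - (a * p $ 1 + c * v $ 1) * p $ 2"
      by (simp_all add: algebra_simps)
    then show "a = 0 \<and> c = 0" using d unfolding e by simp
  qed
qed

lemma linear_combination_exists:
  fixes p v x :: "complex^2"
  assumes "p $ 1 * v $ 2 - p $ 2 * v $ 1 \<noteq> 0"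
  shows "\<exists>a c. x = a *s p + c *s v"
proof -
  let ?d = "p $ 1 * v $ 2 - p $ 2 * v $ 1"
  have "x = ((x $ 1 * v $ 2 - x $ 2 * v $ 1) / ?d) *s p + ((p $ 1 * x $ 2 - p $ 2 * x $ 1) / ?d) *s v"
    using assms by (simp add: vec_eq_iff forall_2 add_divide_distrib[symmetric] eq_divide_eq) (simp add: algebra_simps)
  then show ?thesis by blast
qed

text \<open>Completion of the square: \<open>\<chi>\<^sup>* J \<chi>\<close> for \<open>\<chi> = \<phi> + m \<psi>\<close> is quadratic in \<open>m\<close>, and its zero set is the Weyl circle.\<close>

lemma wronskian_weyl_circle:
  fixes V :: "complex^2^2"
  assumes E: "weyl_denom V \<noteq> 0"
  shows "wronskian (column 1 V + m *s column 2 V) (column 1 V + m *s column 2 V) =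
    weyl_denom V * of_real ((cmod (m - weyl_center V))\<^sup>2 - (weyl_radius V)\<^sup>2)"
proof -
  define A B C D where "A = V$1$1" and "B = V$2$1" and "C = V$1$2" and "D = V$2$2"
  define e where "e = C * cnj D - cnj C * D"
  define P where "P = B * cnj C - A * cnj D"
  define d where "d = A * D - B * C"
  have e0: "e \<noteq> 0" using E unfolding weyl_denom_def e_def C_def D_def .
  have ce: "cnj e = - e" unfolding e_def by simp
  have key: "P * cnj P + e * (cnj B * A - cnj A * B) = d * cnj d"
    unfolding P_def e_def d_def by (simp add: algebra_simps)
  have "weyl_denom V * of_real ((cmod (m - weyl_center V))\<^sup>2 - (weyl_radius V)\<^sup>2)
    = e * ((m - P / e) * cnj (m - P / e) - (d / e) * cnj (d / e))"
    unfolding weyl_denom_def weyl_center_def weyl_radius_def of_real_diff complex_norm_square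
      e_def P_def d_def A_def B_def C_def D_def ..
  also have "\<dots> = e * m * cnj m + m * cnj P - cnj m * P - (P * cnj P - d * cnj d) / e"
    using e0 by (simp add: ce field_simps)
  also have "P * cnj P - d * cnj d = - e * (cnj B * A - cnj A * B)"
    using key by (simp add: algebra_simps)
  also have "e * m * cnj m + m * cnj P - cnj m * P - (- e * (cnj B * A - cnj A * B)) / e =
      e * m * cnj m + m * cnj P - cnj m * P + (cnj B * A - cnj A * B)"
    using e0 by simp
  also have "\<dots> = wronskian (column 1 V + m *s column 2 V) (column 1 V + m *s column 2 V)"
    unfolding e_def P_def A_def B_def C_def D_def wronskian_def column_def
    by (simp add: algebra_simps)
  finally show ?thesis ..
qed

context density_system
begin

text \<open>The matrix \<open>B\<^sub>+\<close> at \<open>cnj z\<close> is minus the adjoint of \<open>B\<^sub>-\<close> at \<open>z\<close>.\<close>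

lemma exceptional_set_cnj:
  assumes "z \<notin> exceptional_set b q w" shows "cnj z \<notin> exceptional_set b q w"
proof -
  have *: "det (Bmat q w s x (cnj z)) = cnj (det (Bmat q w (- s) x z))" if x: "x \<in> einterval 0 b" for x s
  proof -
    note hQ = hermitian_nth[OF Q_hermitian, of x] and hW = hermitian_nth[OF W_hermitian, of x]
    have m: "(mat a ** A) $ i $ j = a * A $ i $ j" for a and A :: "complex^2^2" and i j
      using exhaust_2[of i] by (auto simp: matrix_matrix_mult_def mat_def sum_2)
    show ?thesis
      unfolding Bmat_def point_mass[OF x] det_2
      by (simp add: m Jmat_def hQ hW scaleR_conv_of_real[where 'a=complex] algebra_simps)
  qed
  show ?thesis
    using assms *[of _ 1] *[of _ "- 1"] unfolding exceptional_set_def by auto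
qed

lemma einterval_downward: "s \<in> einterval 0 b \<Longrightarrow> 0 < t \<Longrightarrow> t \<le> s \<Longrightarrow> t \<in> einterval 0 b"
  unfolding in_einterval_0 by (auto intro: le_less_trans[of "ereal t" "ereal s"])

text \<open>Only countably many points carry mass, while every open interval is uncountable.\<close>

lemma continuity_point_above:
  assumes x: "x \<in> einterval 0 b"
  shows "\<exists>c>x. continuity_point b q w c"
proof -
  have x0: "0 < x" "ereal x < b" using x by (auto simp: in_einterval_0)
  obtain d where d: "x < d" "ereal d < b" using ereal_dense2[OF x0(2)] by auto
  let ?E = "{x<..<d}"
  have loc: "?E \<in> local_sets b" using x0 d by (intro local_setsI[of _ x d]) auto
  let ?N = "density \<nu> (indicator ?E)"
  have em: "emeasure ?N A = emeasure \<nu> (?E \<inter> A)" if "A \<in> sets borel" for A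
  proof -
    have "emeasure ?N A = (\<integral>\<^sup>+x. indicator ?E x * indicator A x \<partial>\<nu>)"
      using that by (intro emeasure_density) (simp_all add: measurable_cong_sets[OF sets_nu refl])
    also have "\<dots> = (\<integral>\<^sup>+x. indicator (?E \<inter> A) x \<partial>\<nu>)"
      by (intro nn_integral_cong) (simp add: indicator_inter_arith)
    also have "\<dots> = emeasure \<nu> (?E \<inter> A)" using that by (intro nn_integral_indicator) simp
    finally show ?thesis .
  qed
  have "finite_measure ?N"
    using em[of UNIV] nu_finite[OF loc] sets_eq_imp_space_eq[OF sets_nu] by (intro finite_measureI) auto
  then have "countable {t. measure ?N {t} \<noteq> 0}" by (rule finite_measure.countable_support)
  then have "\<not> ?E \<subseteq> {t. measure ?N {t} \<noteq> 0}"
    using d(1) countable_subset uncountable_open_interval[of x d] by blast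
  then obtain c where c: "c \<in> ?E" "measure ?N {c} = 0" by blast
  have cI: "c \<in> einterval 0 b" using c(1) local_sets_subset_einterval[OF loc] by blast
  have "measure ?N {c} = measure \<nu> {c}" using em[of "{c}"] c(1) by (simp add: measure_def)
  then have "q {c} = 0" "w {c} = 0" using c(2) point_mass[OF cI] by auto
  then show ?thesis using c cI unfolding continuity_point_def by auto
qed

lemma continuity_points_cofinal:
  assumes x: "x \<in> einterval 0 b"
  obtains c :: "nat \<Rightarrow> real" where "\<And>n. continuity_point b q w (c n)" "\<And>n. x < c n"
    "\<And>n. c n \<le> c (Suc n)" "\<And>t. t \<in> einterval 0 b \<Longrightarrow> \<exists>n. t < c n"
proof -
  obtain r l :: "nat \<Rightarrow> real" where
    ul: "einterval 0 b = (\<Union>i. {l i..r i})" "\<And>i. l i < r i"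
    by (rule local_exhaustion[OF b_pos]) (rule that; assumption)
  have ri: "r i \<in> einterval 0 b" for i unfolding ul(1) using ul(2)[of i] by (auto intro!: exI[of _ i] less_imp_le)
  have "\<exists>c. \<forall>n. (continuity_point b q w (c n) \<and> x < c n \<and> r n < c n) \<and> c n \<le> c (Suc n)"
  proof (rule dependent_nat_choice)
    have "max x (r 0) \<in> einterval 0 b" using x ri[of 0] by (simp add: max_def)
    from continuity_point_above[OF this]
    show "\<exists>c. continuity_point b q w c \<and> x < c \<and> r 0 < c" by auto
  next
    fix c n assume "continuity_point b q w c \<and> x < c \<and> r n < c"
    then have "max c (r (Suc n)) \<in> einterval 0 b" using ri[of "Suc n"] by (simp add: max_def continuity_point_def)
    from continuity_point_above[OF this] \<open>continuity_point b q w c \<and> x < c \<and> r n < c\<close>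
    show "\<exists>c'. (continuity_point b q w c' \<and> x < c' \<and> r (Suc n) < c') \<and> c \<le> c'"
      by (metis less_imp_le less_trans max_less_iff_conj)
  qed
  then obtain c where c: "\<And>n. continuity_point b q w (c n)" "\<And>n. x < c n" "\<And>n. r n < c n" "\<And>n. c n \<le> c (Suc n)"
    by blast
  have "\<exists>n. t < c n" if t: "t \<in> einterval 0 b" for t
  proof -
    obtain n where "t \<in> {l n..r n}" using t unfolding ul(1) by blast
    then have "t \<le> r n" by simp
    then show ?thesis using c(3)[of n] by (intro exI[of _ n]) simp
  qed
  with c show ?thesis by (intro that)
qed

text \<open>Exhaustion by the intervals \<open>(0,c n]\<close> and continuity of the measure from below.\<close>

lemma energy_sup:
  assumes "\<And>t. t \<in> einterval 0 b \<Longrightarrow> emeasure (energy u) {0<..t} \<le> K"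
  shows "emeasure (energy u) (einterval 0 b) \<le> K"
proof -
  obtain x where x: "x \<in> einterval 0 b"
    using ereal_dense2[OF b_pos[unfolded zero_ereal_def]] by (auto simp: in_einterval_0)
  obtain c where c: "\<And>n. continuity_point b q w (c n)" "\<And>n. c n \<le> c (Suc n)"
    "\<And>t. t \<in> einterval 0 b \<Longrightarrow> \<exists>n. t < c n"
    using continuity_points_cofinal[OF x] by metis
  have cI: "c n \<in> einterval 0 b" for n using c(1) unfolding continuity_point_def by auto
  have U: "(\<Union>n. {0<..c n}) = einterval 0 b"
  proof (intro equalityI subsetI)
    fix t assume "t \<in> (\<Union>n. {0<..c n})"
    then show "t \<in> einterval 0 b" using einterval_downward[OF cI] by auto
  next
    fix t assume t: "t \<in> einterval 0 b"
    then obtain n where "t < c n" using c(3) by blast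
    then show "t \<in> (\<Union>n. {0<..c n})" using t by (auto simp: in_einterval_0 intro!: exI[of _ n])
  qed
  have "incseq c" by (intro incseq_SucI c(2))
  then have "(\<lambda>n. emeasure (energy u) {0<..c n}) \<longlonglongrightarrow> emeasure (energy u) (\<Union>n. {0<..c n})"
  proof (intro Lim_emeasure_incseq)
    show "incseq (\<lambda>n. {0<..c n})"
      unfolding incseq_def
    proof (intro allI impI)
      fix m n :: nat assume "m \<le> n"
      from incseqD[OF \<open>incseq c\<close> this] show "{0<..c m} \<subseteq> {0<..c n}" by auto
    qed
  qed auto
  then show ?thesis
    unfolding U by (rule LIMSEQ_le_const2) (use assms[OF cI] in auto)
qed

lemma zero_solution: "is_solution b q w z (\<lambda>x. 0)"
proof -
  have r: "right_lim (\<lambda>x::real. 0 :: complex^2) x = 0" and l: "left_lim (\<lambda>x::real. 0 :: complex^2) x = 0" for x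
    unfolding right_lim_def left_lim_def by (auto intro!: tendsto_Lim)
  have "derivative_measure b (\<lambda>x. 0) (\<lambda>E. 0)"
    unfolding derivative_measure_def local_measure_def by (simp add: r)
  then show ?thesis
    unfolding is_solution_def locally_BV_def balanced_def apply_measure_def set_lebesgue_integral_def
    by (auto simp: r l)
qed

lemma solution_sum:
  assumes "\<And>i. i < (n::nat) \<Longrightarrow> is_solution b q w z (f i)"
  shows "is_solution b q w z (\<lambda>x. \<Sum>i<n. a i *s f i x)"
  using assms
proof (induction n)
  case 0
  then show ?case using zero_solution by simp
next
  case (Suc n)
  have "is_solution b q w z (\<lambda>x. 1 *s (\<Sum>i<n. a i *s f i x) + a n *s f n x)"
    by (intro solution_linear(1) Suc) (use Suc.prems in auto)
  then show ?case by simp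
qed

lemma solution_vanishes:
  assumes u: "is_solution b q w z u" and z: "z \<notin> exceptional_set b q w"
    and c: "continuity_point b q w c" and 0: "u c = 0" and x: "x \<in> einterval 0 b"
  shows "u x = 0"
  using solution_unique(1)[OF u z _ _ x, of c] continuity_point_lims(1)[OF u c] 0 c
  unfolding continuity_point_def by simp

text \<open>Evaluation at a continuity point embeds a space of solutions into \<open>\<complex>\<^sup>2\<close>.\<close>

lemma quotient_dim_values:
  assumes q: "quotient_dim V {\<lambda>x. 0} n" and V: "V \<subseteq> solution_space b q w z"
    and z: "z \<notin> exceptional_set b q w" and c: "continuity_point b q w c"
  shows "vec.dim ((\<lambda>u. u c) ` V) = n"
proof -
  obtain f :: "nat \<Rightarrow> real \<Rightarrow> complex^2" where f: "\<And>i. i < n \<Longrightarrow> f i \<in> V"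
    and sp: "\<And>u. u \<in> V \<Longrightarrow> \<exists>a. (\<lambda>x. u x - (\<Sum>i<n. a i *s f i x)) = (\<lambda>x. 0)"
    and ind: "\<And>a. (\<lambda>x. \<Sum>i<n. a i *s f i x) = (\<lambda>x. 0) \<Longrightarrow> \<forall>i<n. a i = 0"
    using q unfolding quotient_dim_def by auto
  have ind': "\<forall>i<n. a i = 0" if "(\<Sum>i<n. a i *s f i c) = 0" for a
  proof (rule ind, rule ext)
    fix x
    have fi: "is_solution b q w z (f i)" "x \<notin> einterval 0 b \<Longrightarrow> f i x = 0" if "i < n" for i
      using f[OF that] V unfolding solution_space_def by auto
    show "(\<Sum>i<n. a i *s f i x) = 0"
    proof (cases "x \<in> einterval 0 b")
      case True
      show ?thesis
        by (rule solution_vanishes[OF solution_sum[OF fi(1)] z c that True])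
    qed (use fi in simp)
  qed
  let ?e = "\<lambda>i. f i c"
  have inj: "inj_on ?e {..<n}"
  proof (rule inj_onI)
    fix i j assume ij: "i \<in> {..<n}" "j \<in> {..<n}" "f i c = f j c"
    show "i = j"
    proof (rule ccontr)
      assume ne: "i \<noteq> j"
      define a :: "nat \<Rightarrow> complex" where "a k = (if k = i then 1 else 0) - (if k = j then 1 else 0)" for k
      have "(\<Sum>k<n. a k *s f k c) = (\<Sum>k<n. (if k = i then f k c else 0)) - (\<Sum>k<n. (if k = j then f k c else 0))"
        unfolding sum_subtractf[symmetric] by (intro sum.cong refl) (auto simp: a_def vec_eq_iff)
      also have "\<dots> = 0" using ij by simp
      finally have "a i = 0" using ind' ij by blast
      then show False using ne by (simp add: a_def)
    qed
  qed
  show ?thesis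
  proof (rule vec.dim_unique[of "?e ` {..<n}"])
    show "?e ` {..<n} \<subseteq> (\<lambda>u. u c) ` V" using f by auto
    show "(\<lambda>u. u c) ` V \<subseteq> vec.span (?e ` {..<n})"
    proof
      fix y assume "y \<in> (\<lambda>u. u c) ` V"
      then obtain u where u: "u \<in> V" "y = u c" by blast
      then obtain a where "(\<lambda>x. u x - (\<Sum>i<n. a i *s f i x)) = (\<lambda>x. 0)" using sp by blast
      from fun_cong[OF this, of c] have y: "y = (\<Sum>i<n. a i *s f i c)" using u(2) by simp
      show "y \<in> vec.span (?e ` {..<n})"
        unfolding y by (intro vec.span_sum vec.span_scale vec.span_base imageI)
    qed
    show "vec.independent (?e ` {..<n})"
      unfolding vec.dependent_finite[OF finite_imageI[OF finite_lessThan]]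
    proof (clarify)
      fix g i assume i: "i < n" "g (f i c) \<noteq> 0" and s: "(\<Sum>v\<in>?e ` {..<n}. g v *s v) = 0"
      have "(\<Sum>i<n. g (f i c) *s f i c) = 0"
        using s by (simp add: sum.reindex[OF inj])
      then show False using ind'[of "\<lambda>i. g (f i c)"] i by blast
    qed
    show "card (?e ` {..<n}) = n" by (simp add: card_image[OF inj])
  qed
qed

end

section \<open>Weyl disks of the system\<close>

context density_system
begin

text \<open>The representative of a solution in the space of solutions that vanish off \<open>(0,b)\<close>.\<close>

definition cut :: "(real \<Rightarrow> complex^2) \<Rightarrow> real \<Rightarrow> complex^2" where
  "cut u x = (if x \<in> einterval 0 b then u x else 0)"

lemma cut_in_solution_space: "is_solution b q w z u \<Longrightarrow> cut u \<in> solution_space b q w z"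
  unfolding solution_space_def by (auto simp: cut_def intro: is_solution_cong(1))

lemma norm2_cong:
  assumes u: "is_solution b q w z u" and uv: "\<And>x. x \<in> einterval 0 b \<Longrightarrow> u x = v x"
  shows "norm2 b w v = norm2 b w u"
proof -
  have "energy_density v = energy_density u"
    unfolding energy_density_def using uv by (auto simp: indicator_def fun_eq_iff)
  moreover have "is_solution b q w z v" by (rule is_solution_cong(1)[OF u]) (rule uv)
  ultimately show ?thesis
    using norm2_nn_integral[OF u] norm2_nn_integral[of z v] by simp
qed

lemma norm2_cut: "is_solution b q w z u \<Longrightarrow> norm2 b w (cut u) = norm2 b w u"
  by (rule norm2_cong) (auto simp: cut_def)

lemma energy_le_norm2:
  assumes u: "is_solution b q w z u" and X: "X \<in> sets borel" "X \<subseteq> einterval 0 b"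
  shows "emeasure (energy u) X \<le> norm2 b w u"
  unfolding norm2_energy[OF u] by (rule emeasure_mono) (use X in auto)

text \<open>The increment of \<open>h\<^sup>* J h\<close> between two points is \<open>2 i Im z\<close> times the squared norm of \<open>h\<close>
  between them, hence at most that of the whole interval.\<close>

lemma wronskian_bounded:
  assumes h: "is_solution b q w z h" and z: "Im z \<noteq> 0" and fin: "norm2 b w h < \<infinity>"
    and x: "x \<in> einterval 0 b"
  shows "\<exists>B. \<forall>c. continuity_point b q w c \<and> x < c \<longrightarrow> cmod (wronskian (h c) (h c)) \<le> B"
proof -
  obtain K where K: "norm2 b w h = ennreal K" "0 \<le> K"
    using fin by (cases "norm2 b w h") auto
  let ?B = "\<bar>Im (wronskian (right_lim h x) (right_lim h x))\<bar> + \<bar>2 * Im z\<bar> * K"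
  have "cmod (wronskian (h c) (h c)) \<le> ?B" if c: "continuity_point b q w c" "x < c" for c
  proof -
    have cI: "c \<in> einterval 0 b" using c(1) unfolding continuity_point_def by blast
    have xc: "0 < x" "x < c" "ereal c < b" using x cI c(2) by (auto simp: in_einterval_0)
    let ?r = "(Im (wronskian (h c) (h c)) - Im (wronskian (right_lim h x) (right_lim h x))) / (2 * Im z)"
    note en = energy_Ioc[OF h z xc, unfolded continuity_point_lims(1)[OF h c(1)]]
    have "{x<..c} \<subseteq> einterval 0 b" using einterval_downward[OF cI] xc by auto
    then have "ennreal ?r \<le> ennreal K"
      unfolding en(1)[symmetric] K(1)[symmetric] by (intro energy_le_norm2[OF h]) auto
    then have "?r \<le> K" using K(2) by (simp add: ennreal_le_iff)
    then have "\<bar>2 * Im z\<bar> * \<bar>?r\<bar> \<le> \<bar>2 * Im z\<bar> * K" using en(2) by (intro mult_left_mono) auto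
    moreover have "Im (wronskian (h c) (h c)) = Im (wronskian (right_lim h x) (right_lim h x)) + 2 * Im z * ?r"
      using z by simp
    ultimately have "\<bar>Im (wronskian (h c) (h c))\<bar> \<le> ?B"
      using abs_triangle_ineq[of "Im (wronskian (right_lim h x) (right_lim h x))" "2 * Im z * ?r"]
      by (simp only: abs_mult)
    moreover have "Re (wronskian (h c) (h c)) = 0"
      using wronskian_skew[of "h c" "h c"] by (simp add: complex_eq_iff)
    ultimately show ?thesis by (simp add: cmod_def)
  qed
  then show ?thesis by blast
qed

context
  fixes z :: complex and \<alpha> :: real and U :: "real \<Rightarrow> complex^2^2"
  assumes Im_z: "Im z \<noteq> 0" and z_regular: "z \<notin> exceptional_set b q w"
    and fundamental: "fundamental_matrix b q w \<alpha> z U"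
    and definite: "null_solutions b q w = {\<lambda>x. 0}"
begin

lemma phi_psi_solution:
  shows phi_solution: "is_solution b q w z (phi U)" and psi_solution: "is_solution b q w z (psi U)"
  using fundamental unfolding fundamental_matrix_def phi_def[abs_def] psi_def[abs_def] by auto

lemma phi_psi_lim:
  shows phi_lim: "(phi U \<longlongrightarrow> vector [of_real (cos \<alpha>), of_real (sin \<alpha>)]) (at_right 0)"
    and psi_lim: "(psi U \<longlongrightarrow> vector [- of_real (sin \<alpha>), of_real (cos \<alpha>)]) (at_right 0)"
proof -
  have "((\<lambda>x. column j (U x)) \<longlongrightarrow> column j (vector [vector [of_real (cos \<alpha>), - of_real (sin \<alpha>)],
                   vector [of_real (sin \<alpha>), of_real (cos \<alpha>)]] :: complex^2^2)) (at_right 0)" for j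
    using fundamental unfolding fundamental_matrix_def column_def
    by (intro tendsto_vec_lambda tendsto_vec_nth) auto
  note * = this[of 1] this[of 2]
  have "column 1 (vector [vector [of_real (cos \<alpha>), - of_real (sin \<alpha>)],
      vector [of_real (sin \<alpha>), of_real (cos \<alpha>)]] :: complex^2^2) = (vector [of_real (cos \<alpha>), of_real (sin \<alpha>)] :: complex^2)"
    "column 2 (vector [vector [of_real (cos \<alpha>), - of_real (sin \<alpha>)],
      vector [of_real (sin \<alpha>), of_real (cos \<alpha>)]] :: complex^2^2) = (vector [- of_real (sin \<alpha>), of_real (cos \<alpha>)] :: complex^2)"
    by (simp_all add: vec_eq_iff forall_2 column_def)
  then show "(phi U \<longlongrightarrow> vector [of_real (cos \<alpha>), of_real (sin \<alpha>)]) (at_right 0)"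
    "(psi U \<longlongrightarrow> vector [- of_real (sin \<alpha>), of_real (cos \<alpha>)]) (at_right 0)"
    using * unfolding phi_def[abs_def] psi_def[abs_def] by simp_all
qed

lemma weyl_solution_eq: "weyl_solution U m = (\<lambda>x. 1 *s phi U x + m *s psi U x)"
  by (simp add: weyl_solution_def fun_eq_iff)

lemma weyl_solution_solution: "is_solution b q w z (weyl_solution U m)"
  unfolding weyl_solution_eq by (rule solution_linear(1)[OF phi_solution psi_solution])

lemma combination_lim:
  "((\<lambda>x. a *s phi U x + d *s psi U x) \<longlongrightarrow>
    a *s vector [of_real (cos \<alpha>), of_real (sin \<alpha>)] + d *s vector [- of_real (sin \<alpha>), of_real (cos \<alpha>)]) (at_right 0)"
  using mv.tendsto[OF tendsto_const phi_lim, of "mat a"] mv.tendsto[OF tendsto_const psi_lim, of "mat d"]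
  unfolding mat_vector_mult by (rule tendsto_add)

lemma cos_sin_complex: "complex_of_real (cos \<alpha>) * of_real (cos \<alpha>) + of_real (sin \<alpha>) * of_real (sin \<alpha>) = 1"
  by (metis of_real_1 of_real_add of_real_mult power2_eq_square sin_cos_squared_add2)

lemma wronskian_initial:
  "wronskian (1 *s vector [of_real (cos \<alpha>), of_real (sin \<alpha>)] + m *s vector [- of_real (sin \<alpha>), of_real (cos \<alpha>)])
    (1 *s vector [of_real (cos \<alpha>), of_real (sin \<alpha>)] + m *s vector [- of_real (sin \<alpha>), of_real (cos \<alpha>)]) = cnj m - m"
proof -
  let ?c = "complex_of_real (cos \<alpha>)" and ?s = "complex_of_real (sin \<alpha>)"
  have "wronskian (1 *s vector [?c, ?s] + m *s vector [- ?s, ?c]) (1 *s vector [?c, ?s] + m *s vector [- ?s, ?c])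
    = (cnj m - m) * (?c * ?c + ?s * ?s)"
    by (simp add: wronskian_def algebra_simps)
  then show ?thesis by (simp add: cos_sin_complex)
qed

text \<open>By Lagrange's identity on \<open>(0,c)\<close>, these are, at a point of continuity \<open>c\<close>, the
  squared norms of \<open>\<psi>\<close> and of \<open>\<chi>\<^sub>m\<close> over \<open>(0,c)\<close>; the boundary term at \<open>0\<close> vanishes for \<open>\<psi>\<close> and is \<open>cnj m - m\<close> for \<open>\<chi>\<^sub>m\<close>.\<close>

definition psi_energy :: "real \<Rightarrow> real" where
  "psi_energy c = Im (weyl_denom (U c)) / (2 * Im z)"

definition weyl_energy :: "complex \<Rightarrow> real \<Rightarrow> real" where
  "weyl_energy m c = (Im (wronskian (weyl_solution U m c) (weyl_solution U m c)) + 2 * Im m) / (2 * Im z)"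

lemma wronskian_psi: "wronskian (psi U c) (psi U c) = weyl_denom (U c)"
  by (simp add: wronskian_def weyl_denom_def psi_def column_def)

lemma energy_psi:
  assumes c: "continuity_point b q w c"
  shows "emeasure (energy (psi U)) {0<..c} = ennreal (psi_energy c)" "0 \<le> psi_energy c"
proof -
  have cI: "c \<in> einterval 0 b" using c unfolding continuity_point_def by blast
  have "wronskian (vector [- of_real (sin \<alpha>), of_real (cos \<alpha>)]) (vector [- of_real (sin \<alpha>), of_real (cos \<alpha>)]) = 0"
    by (simp add: wronskian_def)
  then show "emeasure (energy (psi U)) {0<..c} = ennreal (psi_energy c)" "0 \<le> psi_energy c"
    using energy_from_0[OF psi_solution Im_z psi_lim cI]
    unfolding continuity_point_lims(1)[OF psi_solution c] wronskian_psi psi_energy_def by auto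
qed

lemma energy_weyl_solution:
  assumes c: "continuity_point b q w c"
  shows "emeasure (energy (weyl_solution U m)) {0<..c} = ennreal (weyl_energy m c)" "0 \<le> weyl_energy m c"
proof -
  have cI: "c \<in> einterval 0 b" using c unfolding continuity_point_def by blast
  note L = energy_from_0[OF weyl_solution_solution Im_z
      combination_lim[of 1 m, folded weyl_solution_eq] cI, unfolded wronskian_initial]
  show "emeasure (energy (weyl_solution U m)) {0<..c} = ennreal (weyl_energy m c)" "0 \<le> weyl_energy m c"
    using L unfolding continuity_point_lims(1)[OF weyl_solution_solution c] weyl_energy_def by auto
qed

lemma psi_energy_mono:
  assumes c: "continuity_point b q w c" "continuity_point b q w c'" and le: "c \<le> c'"
  shows "psi_energy c \<le> psi_energy c'" "weyl_energy m c \<le> weyl_energy m c'"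
proof -
  have sub: "{0<..c} \<subseteq> {0<..c'}" using le by auto
  have "emeasure (energy (psi U)) {0<..c} \<le> emeasure (energy (psi U)) {0<..c'}"
    "emeasure (energy (weyl_solution U m)) {0<..c} \<le> emeasure (energy (weyl_solution U m)) {0<..c'}"
    by (auto intro!: emeasure_mono sub)
  then show "psi_energy c \<le> psi_energy c'" "weyl_energy m c \<le> weyl_energy m c'"
    using energy_psi[OF c(1)] energy_psi[OF c(2)] energy_weyl_solution[OF c(1)] energy_weyl_solution[OF c(2)]
    by (simp_all add: ennreal_le_iff)
qed

text \<open>With centre \<open>k\<close> and radius \<open>r\<close> of the disk, \<open>weyl_energy m c - Im m / Im z\<close> equals
  \<open>psi_energy c \<cdot> (|m - k|\<^sup>2 - r\<^sup>2)\<close>. Nestedness of the disks is thereby reduced to monotonicity of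
  the norm.\<close>

lemma mem_weyl_disk:
  assumes pos: "0 < psi_energy c"
  shows "m \<in> weyl_disk (U c) \<longleftrightarrow> weyl_energy m c \<le> Im m / Im z"
proof -
  have E: "weyl_denom (U c) \<noteq> 0" using pos unfolding psi_energy_def by auto
  let ?d = "cmod (m - weyl_center (U c))" and ?r = "weyl_radius (U c)"
  have "weyl_solution U m c = column 1 (U c) + m *s column 2 (U c)"
    by (simp add: weyl_solution_def phi_def psi_def)
  then have "wronskian (weyl_solution U m c) (weyl_solution U m c) = weyl_denom (U c) * of_real (?d\<^sup>2 - ?r\<^sup>2)"
    using wronskian_weyl_circle[OF E] by simp
  then have I: "Im (wronskian (weyl_solution U m c) (weyl_solution U m c)) = Im (weyl_denom (U c)) * (?d\<^sup>2 - ?r\<^sup>2)"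
    by simp
  have "weyl_energy m c - Im m / Im z = psi_energy c * (?d\<^sup>2 - ?r\<^sup>2)"
    unfolding weyl_energy_def I psi_energy_def using Im_z by (simp add: field_simps)
  then have "weyl_energy m c \<le> Im m / Im z \<longleftrightarrow> psi_energy c * (?d\<^sup>2 - ?r\<^sup>2) \<le> 0" by linarith
  also have "\<dots> \<longleftrightarrow> ?d\<^sup>2 \<le> ?r\<^sup>2" using pos by (simp add: mult_le_0_iff)
  also have "\<dots> \<longleftrightarrow> ?d \<le> ?r" by (intro power_mono_iff) (auto simp: weyl_radius_def)
  also have "\<dots> \<longleftrightarrow> m \<in> weyl_disk (U c)"
    by (simp add: weyl_disk_def dist_norm norm_minus_commute)
  finally show ?thesis ..
qed

lemma weyl_disk_nested:
  assumes c: "continuity_point b q w c" "continuity_point b q w c'" and le: "c \<le> c'"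
    and pos: "0 < psi_energy c"
  shows "weyl_disk (U c') \<subseteq> weyl_disk (U c)"
proof
  fix m assume "m \<in> weyl_disk (U c')"
  then show "m \<in> weyl_disk (U c)"
    using mem_weyl_disk[OF pos, of m] mem_weyl_disk[of c' m] psi_energy_mono(1)[OF c le] psi_energy_mono(2)[OF c le, of m] pos
    by auto
qed

text \<open>This is where definiteness enters: if \<open>\<psi>\<close> had norm zero, it would solve the equation for
  \<open>\<lambda> = 0\<close> as well and belong to the trivial space of null solutions.\<close>

lemma psi_energy_eventually_positive:
  "\<exists>x\<in>einterval 0 b. \<forall>c. continuity_point b q w c \<and> x < c \<longrightarrow> 0 < psi_energy c"
proof -
  have "\<exists>x\<in>einterval 0 b. 0 < emeasure (energy (psi U)) {0<..x}"
  proof (rule ccontr)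
    assume "\<not> ?thesis"
    then have "emeasure (energy (psi U)) {0<..t} \<le> 0" if "t \<in> einterval 0 b" for t
      using that by (auto simp: not_less)
    then have "emeasure (energy (psi U)) (einterval 0 b) \<le> 0" by (rule energy_sup)
    then have 0: "norm2 b w (psi U) = 0" unfolding norm2_energy[OF psi_solution] by simp
    then have "cut (psi U) \<in> null_solutions b q w"
      unfolding null_solutions_def
      using cut_in_solution_space[OF norm2_eq_0_solution[OF psi_solution 0, of 0]] norm2_cut[OF psi_solution]
      by simp
    then have cz: "cut (psi U) = (\<lambda>x. 0)" unfolding definite by simp
    obtain d where d: "0 < d" "ereal d < b" using ereal_dense2[OF b_pos[unfolded zero_ereal_def]] by auto
    have "eventually (\<lambda>x. psi U x = 0) (at_right 0)"
      using eventually_at_right_real[OF d(1)]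
    proof eventually_elim
      case (elim x)
      then have "ereal x < ereal d" "0 < x" by auto
      then have "x \<in> einterval 0 b" using d unfolding in_einterval_0 by (auto intro: less_trans[of "ereal x" "ereal d"])
      then show ?case using fun_cong[OF cz, of x] by (simp add: cut_def)
    qed
    then have "(psi U \<longlongrightarrow> 0) (at_right 0)" by (rule tendsto_eventually)
    then have "vector [- of_real (sin \<alpha>), of_real (cos \<alpha>)] = (0 :: complex^2)"
      using psi_lim by (intro tendsto_unique[of "at_right (0::real)"]) auto
    then have "complex_of_real (sin \<alpha>) = 0" "complex_of_real (cos \<alpha>) = 0"
      by (auto simp: vec_eq_iff forall_2)
    then show False using cos_sin_complex by simp
  qed
  then obtain x where x: "x \<in> einterval 0 b" "0 < emeasure (energy (psi U)) {0<..x}" by blast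
  have "0 < psi_energy c" if c: "continuity_point b q w c" "x < c" for c
  proof -
    have "emeasure (energy (psi U)) {0<..x} \<le> emeasure (energy (psi U)) {0<..c}"
      using c(2) by (intro emeasure_mono) auto
    with x(2) have "0 < ennreal (psi_energy c)"
      unfolding energy_psi(1)[OF c(1)] by (rule less_le_trans)
    then show ?thesis by simp
  qed
  with x(1) show ?thesis by blast
qed

text \<open>The disks along a sequence of continuity points that tends to \<open>b\<close> have the same intersection as
  all of them. The sequence may start beyond a given \<open>x\<close>.\<close>

lemma limit_disk_cball:
  assumes x: "x \<in> einterval 0 b"
  obtains c :: "nat \<Rightarrow> real" and L \<rho> where "\<And>n. continuity_point b q w (c n)" "\<And>n. x < c n"
    "\<And>n. 0 < psi_energy (c n)" "(\<lambda>n. weyl_radius (U (c n))) \<longlonglongrightarrow> \<rho>" "0 \<le> \<rho>"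
    "limit_disk b q w U = cball L \<rho>"
proof -
  obtain x1 where x1: "x1 \<in> einterval 0 b" "\<And>c. continuity_point b q w c \<Longrightarrow> x1 < c \<Longrightarrow> 0 < psi_energy c"
    using psi_energy_eventually_positive by blast
  have mx: "max x x1 \<in> einterval 0 b" using x x1(1) by (simp add: max_def)
  obtain c where c: "\<And>n. continuity_point b q w (c n)" "\<And>n. max x x1 < c n"
    "\<And>n. c n \<le> c (Suc n)" "\<And>t. t \<in> einterval 0 b \<Longrightarrow> \<exists>n. t < c n"
    by (rule continuity_points_cofinal[OF mx]) (rule that; assumption)
  have pos: "0 < psi_energy (c n)" for n using x1(2)[OF c(1)] c(2)[of n] by simp
  have sub: "cball (weyl_center (U (c (Suc n)))) (weyl_radius (U (c (Suc n)))) \<subseteq>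
      cball (weyl_center (U (c n))) (weyl_radius (U (c n)))" for n
    using weyl_disk_nested[OF c(1) c(1) c(3) pos] unfolding weyl_disk_def .
  have r0: "0 \<le> weyl_radius (U (c n))" for n by (simp add: weyl_radius_def)
  obtain L \<rho> where L: "(\<lambda>n. weyl_radius (U (c n))) \<longlonglongrightarrow> \<rho>" "0 \<le> \<rho>"
    "(\<Inter>n. cball (weyl_center (U (c n))) (weyl_radius (U (c n)))) = cball L \<rho>"
    by (rule nested_cballs[of "\<lambda>n. weyl_radius (U (c n))" "\<lambda>n. weyl_center (U (c n))", OF r0 sub])
  have iff: "continuity_point b q w t \<and> 0 < norm2_on b w {0<..<t} (psi U) \<longleftrightarrow>
      continuity_point b q w t \<and> 0 < psi_energy t" for t
    using energy_continuity_point[OF psi_solution, of t] energy_psi(1)[of t] by auto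
  have "limit_disk b q w U = (\<Inter>n. weyl_disk (U (c n)))"
    unfolding limit_disk_def iff
  proof (intro equalityI subsetI)
    fix m assume m: "m \<in> (\<Inter>n. weyl_disk (U (c n)))"
    show "m \<in> (\<Inter>t\<in>{t. continuity_point b q w t \<and> 0 < psi_energy t}. weyl_disk (U t))"
    proof
      fix t assume "t \<in> {t. continuity_point b q w t \<and> 0 < psi_energy t}"
      then have t: "continuity_point b q w t" "0 < psi_energy t" by auto
      then obtain n where "t < c n" using c(4)[of t] unfolding continuity_point_def by blast
      then show "m \<in> weyl_disk (U t)" using weyl_disk_nested[OF t(1) c(1)[of n] _ t(2)] m by auto
    qed
  next
    fix m assume "m \<in> (\<Inter>t\<in>{t. continuity_point b q w t \<and> 0 < psi_energy t}. weyl_disk (U t))"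
    then show "m \<in> (\<Inter>n. weyl_disk (U (c n)))" using c(1) pos by auto
  qed
  then have "limit_disk b q w U = cball L \<rho>" using L(3) unfolding weyl_disk_def by simp
  moreover have "x < c n" for n using c(2)[of n] by simp
  ultimately show ?thesis using that[of c \<rho> L] c(1) pos L(1,2) by blast
qed

text \<open>The bound \<open>Im m / Im z\<close> on the norm over \<open>(0,c)\<close> does not depend on \<open>c\<close>.\<close>

lemma limit_disk_square_integrable:
  assumes m: "m \<in> limit_disk b q w U"
  shows "norm2 b w (weyl_solution U m) < \<infinity>"
proof -
  obtain x where x: "x \<in> einterval 0 b" "\<And>c. continuity_point b q w c \<Longrightarrow> x < c \<Longrightarrow> 0 < psi_energy c"
    using psi_energy_eventually_positive by blast
  have "emeasure (energy (weyl_solution U m)) {0<..t} \<le> ennreal (Im m / Im z)" if t: "t \<in> einterval 0 b" for t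
  proof -
    have "max x t \<in> einterval 0 b" using x t by (simp add: max_def)
    then obtain c where c: "max x t < c" "continuity_point b q w c" using continuity_point_above by blast
    have pos: "0 < psi_energy c" using x(2)[OF c(2)] c(1) by simp
    have "0 < norm2_on b w {0<..<c} (psi U)"
      using energy_continuity_point[OF psi_solution c(2)] energy_psi(1)[OF c(2)] pos by simp
    then have "m \<in> weyl_disk (U c)" using m c(2) unfolding limit_disk_def by blast
    then have "weyl_energy m c \<le> Im m / Im z" using mem_weyl_disk[OF pos] by simp
    then have "emeasure (energy (weyl_solution U m)) {0<..c} \<le> ennreal (Im m / Im z)"
      unfolding energy_weyl_solution(1)[OF c(2)] by (rule ennreal_leI)
    moreover have "emeasure (energy (weyl_solution U m)) {0<..t} \<le> emeasure (energy (weyl_solution U m)) {0<..c}"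
      using c(1) by (intro emeasure_mono) auto
    ultimately show ?thesis by simp
  qed
  then have "norm2 b w (weyl_solution U m) \<le> ennreal (Im m / Im z)"
    unfolding norm2_energy[OF weyl_solution_solution] by (rule energy_sup)
  then show ?thesis by (rule le_less_trans) simp
qed

text \<open>A combination that vanishes at one continuity point vanishes identically, so its value at \<open>0\<close> does, too.\<close>

lemma fundamental_det:
  assumes c: "continuity_point b q w c"
  shows "phi U c $ 1 * psi U c $ 2 - phi U c $ 2 * psi U c $ 1 \<noteq> 0"
  unfolding linear_combination_vanishes_iff[symmetric]
proof (intro allI impI)
  fix a d assume 0: "a *s phi U c + d *s psi U c = 0"
  let ?u = "\<lambda>x. a *s phi U x + d *s psi U x"
  have u: "is_solution b q w z ?u" by (rule solution_linear(1)[OF phi_solution psi_solution])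
  obtain e where e: "0 < e" "ereal e < b" using ereal_dense2[OF b_pos[unfolded zero_ereal_def]] by auto
  have "eventually (\<lambda>x. ?u x = 0) (at_right 0)"
    using eventually_at_right_real[OF e(1)]
  proof eventually_elim
    case (elim x)
    then have "x \<in> einterval 0 b" using einterval_downward[of e x] e by (simp add: in_einterval_0)
    then show ?case by (rule solution_vanishes[OF u z_regular c 0])
  qed
  then have "(?u \<longlongrightarrow> 0) (at_right 0)" by (rule tendsto_eventually)
  then have *: "a *s vector [of_real (cos \<alpha>), of_real (sin \<alpha>)] +
      d *s vector [- of_real (sin \<alpha>), of_real (cos \<alpha>)] = (0 :: complex^2)"
    using combination_lim by (intro tendsto_unique[of "at_right (0::real)"]) auto
  show "a = 0 \<and> d = 0"
    using * linear_combination_vanishes_iff[of "vector [of_real (cos \<alpha>), of_real (sin \<alpha>)]"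
        "vector [- of_real (sin \<alpha>), of_real (cos \<alpha>)]"] cos_sin_complex by simp
qed

text \<open>A combination of \<open>\<phi>\<close> and \<open>\<psi>\<close> matches \<open>u\<close> at one continuity point, hence everywhere by uniqueness.\<close>

lemma solution_span:
  assumes u: "is_solution b q w z u"
  shows "\<exists>a d. \<forall>x\<in>einterval 0 b. u x = a *s phi U x + d *s psi U x"
proof -
  obtain x where "x \<in> einterval 0 b" using psi_energy_eventually_positive by blast
  then obtain c where c: "continuity_point b q w c" using continuity_point_above by blast
  obtain a d where ad: "u c = a *s phi U c + d *s psi U c"
    using linear_combination_exists[OF fundamental_det[OF c]] by blast
  let ?v = "\<lambda>x. a *s phi U x + d *s psi U x"
  have v: "is_solution b q w z ?v" by (rule solution_linear(1)[OF phi_solution psi_solution])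
  have "is_solution b q w z (\<lambda>x. 1 *s u x + (- 1) *s ?v x)" by (rule solution_linear(1)[OF u v])
  then have "1 *s u x + (- 1) *s ?v x = 0" if "x \<in> einterval 0 b" for x
    by (rule solution_vanishes[OF _ z_regular c _ that]) (simp add: ad vec_eq_iff)
  moreover have "1 *s u x + (- 1) *s ?v x = u x - ?v x" for x by (simp add: vec_eq_iff)
  ultimately have "u x = ?v x" if "x \<in> einterval 0 b" for x
    using that by (metis eq_iff_diff_eq_0)
  then show ?thesis by blast
qed

text \<open>The limit disk is never empty; with \<open>L\<close> in it, \<open>\<psi>\<close> and \<open>\<chi>\<^sub>L\<close> form a square-integrable basis.\<close>

lemma all_square_integrable:
  assumes fin: "norm2 b w (psi U) < \<infinity>" and u: "is_solution b q w z u"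
  shows "norm2 b w u < \<infinity>"
proof -
  obtain x where x: "x \<in> einterval 0 b" using psi_energy_eventually_positive by blast
  obtain L \<rho> where L: "0 \<le> \<rho>" "limit_disk b q w U = cball L \<rho>"
    by (rule limit_disk_cball[OF x])
  then have chi: "norm2 b w (weyl_solution U L) < \<infinity>" by (intro limit_disk_square_integrable) simp
  obtain a d where ad: "\<And>x. x \<in> einterval 0 b \<Longrightarrow> u x = a *s phi U x + d *s psi U x"
    using solution_span[OF u] by blast
  have "norm2 b w (\<lambda>x. a *s weyl_solution U L x + (d - a * L) *s psi U x) < \<infinity>"
    by (rule norm2_linear_finite[OF weyl_solution_solution psi_solution chi fin])
  moreover have "a *s weyl_solution U L x + (d - a * L) *s psi U x = u x" if "x \<in> einterval 0 b" for x
    unfolding ad[OF that] weyl_solution_def by (simp add: vec_eq_iff algebra_simps)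
  then have "norm2 b w (\<lambda>x. a *s weyl_solution U L x + (d - a * L) *s psi U x) = norm2 b w u"
    by (intro norm2_cong[OF u, symmetric, THEN sym]) simp
  ultimately show ?thesis by simp
qed

text \<open>Two points of the disk give two square-integrable \<open>\<chi>\<close>, and \<open>\<psi>\<close> is a multiple of their difference.\<close>

lemma positive_radius_psi:
  assumes L: "limit_disk b q w U = cball L \<rho>" "0 < \<rho>"
  shows "norm2 b w (psi U) < \<infinity>"
proof -
  have in1: "L \<in> limit_disk b q w U" "L + of_real \<rho> \<in> limit_disk b q w U"
    using L by (auto simp: dist_norm)
  let ?k = "inverse (of_real \<rho> :: complex)"
  have "norm2 b w (\<lambda>x. ?k *s weyl_solution U (L + of_real \<rho>) x + (- ?k) *s weyl_solution U L x) < \<infinity>"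
    by (intro norm2_linear_finite[OF weyl_solution_solution weyl_solution_solution]
        limit_disk_square_integrable in1)
  moreover have "?k *s weyl_solution U (L + of_real \<rho>) x + (- ?k) *s weyl_solution U L x = psi U x" for x
    using L(2) by (simp add: weyl_solution_def vec_eq_iff field_simps)
  ultimately show ?thesis by simp
qed

text \<open>
  Two independent square-integrable solutions \<open>f\<close>, \<open>g\<close> at \<open>cnj z\<close> keep the radii away from
  zero. With \<open>F = (f, g)\<close>, the matrix \<open>F\<^sup>* J U\<close> is constant, so that \<open>|det F| |det U|\<close> is a
  positive constant, and \<open>|det F|\<^sup>2 = det (F\<^sup>* J F)\<close> is bounded near \<open>b\<close>.
\<close>

lemma radius_bounded_below:
  assumes f: "is_solution b q w (cnj z) f" and g: "is_solution b q w (cnj z) g"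
    and fin: "norm2 b w f < \<infinity>" "norm2 b w g < \<infinity>" "norm2 b w (psi U) < \<infinity>"
    and ind: "\<And>a d. (\<And>x. x \<in> einterval 0 b \<Longrightarrow> a *s f x + d *s g x = 0) \<Longrightarrow> a = 0 \<and> d = 0"
    and x: "x \<in> einterval 0 b"
  shows "\<exists>\<delta>>0. \<forall>c. continuity_point b q w c \<and> x < c \<and> 0 < psi_energy c \<longrightarrow> \<delta> \<le> weyl_radius (U c)"
proof -
  have Im_cnj: "Im (cnj z) \<noteq> 0" using Im_z by simp
  note cz = exceptional_set_cnj[OF z_regular]
  have sum1: "is_solution b q w (cnj z) (\<lambda>x. 1 *s f x + 1 *s g x)"
    and sum2: "is_solution b q w (cnj z) (\<lambda>x. 1 *s f x + \<i> *s g x)"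
    by (rule solution_linear(1)[OF f g])+
  note bd = wronskian_bounded[OF f Im_cnj fin(1) x] wronskian_bounded[OF g Im_cnj fin(2) x]
    wronskian_bounded[OF sum1 Im_cnj norm2_linear_finite[OF f g fin(1,2)] x]
    wronskian_bounded[OF sum2 Im_cnj norm2_linear_finite[OF f g fin(1,2)] x]
  obtain B1 B2 B3 B4 where B: "\<And>c. continuity_point b q w c \<Longrightarrow> x < c \<Longrightarrow> cmod (wronskian (f c) (f c)) \<le> B1"
    "\<And>c. continuity_point b q w c \<Longrightarrow> x < c \<Longrightarrow> cmod (wronskian (g c) (g c)) \<le> B2"
    "\<And>c. continuity_point b q w c \<Longrightarrow> x < c \<Longrightarrow> cmod (wronskian (1 *s f c + 1 *s g c) (1 *s f c + 1 *s g c)) \<le> B3"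
    "\<And>c. continuity_point b q w c \<Longrightarrow> x < c \<Longrightarrow> cmod (wronskian (1 *s f c + \<i> *s g c) (1 *s f c + \<i> *s g c)) \<le> B4"
    using bd by blast
  define M where "M = B3 + B4 + 2 * B1 + 2 * B2"
  define F where "F c = f c $ 1 * g c $ 2 - f c $ 2 * g c $ 1" for c
  define D where "D c = phi U c $ 1 * psi U c $ 2 - phi U c $ 2 * psi U c $ 1" for c
  have F_bound: "(cmod (F c))\<^sup>2 \<le> B1 * B2 + M * M" if c: "continuity_point b q w c" "x < c" for c
  proof -
    have w: "cmod (wronskian (f c) (g c)) \<le> M"
      using wronskian_polarization[of "f c" "g c"] B[OF c] unfolding M_def by simp
    have "of_real ((cmod (F c))\<^sup>2) = wronskian (f c) (f c) * wronskian (g c) (g c) - wronskian (f c) (g c) * wronskian (g c) (f c)"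
      unfolding wronskian_det F_def complex_norm_square by (simp add: mult.commute)
    then have "(cmod (F c))\<^sup>2 = cmod (wronskian (f c) (f c) * wronskian (g c) (g c) - wronskian (f c) (g c) * wronskian (g c) (f c))"
      by (metis abs_of_nonneg norm_of_real zero_le_power2)
    also have "\<dots> \<le> cmod (wronskian (f c) (f c)) * cmod (wronskian (g c) (g c)) +
        cmod (wronskian (f c) (g c)) * cmod (wronskian (g c) (f c))"
      unfolding norm_mult[symmetric] by (rule norm_triangle_ineq4)
    also have "cmod (wronskian (g c) (f c)) = cmod (wronskian (f c) (g c))"
      by (subst wronskian_skew) simp
    also have "cmod (wronskian (f c) (f c)) * cmod (wronskian (g c) (g c)) +
        cmod (wronskian (f c) (g c)) * cmod (wronskian (f c) (g c)) \<le> B1 * B2 + M * M"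
      using B(1)[OF c] B(2)[OF c] w by (intro add_mono mult_mono) (auto intro: order_trans[OF norm_ge_zero])
    finally show ?thesis .
  qed
  have F_nz: "F c \<noteq> 0" if c: "continuity_point b q w c" for c
    unfolding F_def linear_combination_vanishes_iff[symmetric]
  proof (intro allI impI)
    fix a d assume 0: "a *s f c + d *s g c = 0"
    show "a = 0 \<and> d = 0"
      by (rule ind, rule solution_vanishes[OF solution_linear(1)[OF f g] cz c 0])
  qed
  have const: "wronskian (h c) (u c) = wronskian (h c') (u c')"
    if u: "is_solution b q w z u" and h: "is_solution b q w (cnj z) h"
      and c: "continuity_point b q w c" "continuity_point b q w c'" "c < c'" for u h c c'
  proof -
    have "0 < c" "c < c'" "ereal c' < b" using c by (auto simp: continuity_point_def in_einterval_0)
    from lagrange_identity(2)[OF u h this]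
    show ?thesis
      unfolding continuity_point_lims(1)[OF u c(1)] continuity_point_lims(1)[OF u c(2)]
        continuity_point_lims(1)[OF h c(1)] continuity_point_lims(1)[OF h c(2)] by simp
  qed
  obtain c0 where c0: "x < c0" "continuity_point b q w c0" using continuity_point_above[OF x] by blast
  define \<kappa> where "\<kappa> = cmod (F c0) * cmod (D c0)"
  have \<kappa>0: "0 < \<kappa>" using F_nz[OF c0(2)] fundamental_det[OF c0(2)] unfolding \<kappa>_def D_def by simp
  have FD: "cmod (F c) * cmod (D c) = \<kappa>" if c: "continuity_point b q w c" for c
  proof -
    have eq: "cnj (F t) * D t = wronskian (f t) (phi U t) * wronskian (g t) (psi U t)
        - wronskian (f t) (psi U t) * wronskian (g t) (phi U t)" for t
      unfolding wronskian_det F_def D_def ..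
    have "cnj (F c) * D c = cnj (F c0) * D c0"
    proof (cases c c0 rule: linorder_cases)
      case less
      show ?thesis unfolding eq
        by (simp only: const[OF phi_solution f c c0(2) less] const[OF psi_solution f c c0(2) less]
            const[OF phi_solution g c c0(2) less] const[OF psi_solution g c c0(2) less])
    next
      case greater
      show ?thesis unfolding eq
        by (simp only: const[OF phi_solution f c0(2) c greater] const[OF psi_solution f c0(2) c greater]
            const[OF phi_solution g c0(2) c greater] const[OF psi_solution g c0(2) c greater])
    qed simp
    then have "cmod (cnj (F c) * D c) = cmod (cnj (F c0) * D c0)" by simp
    then show ?thesis unfolding \<kappa>_def norm_mult by simp
  qed
  obtain R where R: "norm2 b w (psi U) = ennreal R" "0 \<le> R"
    using fin(3) by (cases "norm2 b w (psi U)") auto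
  \<comment> \<open>\<open>|F c|\<^sup>2 \<le> T\<close> gives \<open>|F c| \<le> S\<close>; the summands \<open>1\<close> in \<open>S\<close> and \<open>R + 1\<close> keep denominators positive\<close>
  define T where "T = B1 * B2 + M * M"
  define S where "S = \<bar>T\<bar> + 1"
  have S: "1 \<le> S" unfolding S_def by simp
  define \<delta> where "\<delta> = (\<kappa> / S) / (2 * \<bar>Im z\<bar> * (R + 1))"
  have "0 < \<delta>" unfolding \<delta>_def using \<kappa>0 S R(2) Im_z by (intro divide_pos_pos mult_pos_pos) auto
  moreover have "\<delta> \<le> weyl_radius (U c)" if c: "continuity_point b q w c" "x < c" "0 < psi_energy c" for c
  proof -
    have F_le: "cmod (F c) \<le> S"
    proof (rule ccontr)
      assume "\<not> cmod (F c) \<le> S"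
      then have "S * 1 \<le> cmod (F c) * cmod (F c)" using S by (intro mult_mono) auto
      then show False using F_bound[OF c(1,2)] abs_ge_self[of T]
        unfolding T_def[symmetric] S_def power2_eq_square by simp
    qed
    have "\<kappa> \<le> S * cmod (D c)" unfolding FD[OF c(1), symmetric] using F_le by (intro mult_right_mono) auto
    then have D_ge: "\<kappa> / S \<le> cmod (D c)" using S by (simp add: divide_le_eq mult.commute)
    have "ennreal (psi_energy c) \<le> ennreal R"
      unfolding energy_psi(1)[OF c(1), symmetric] R(1)[symmetric]
      using einterval_downward[of c] c(1)
      by (intro energy_le_norm2[OF psi_solution]) (auto simp: continuity_point_def)
    then have "psi_energy c \<le> R" using R(2) by (simp add: ennreal_le_iff)
    then have pe: "psi_energy c \<le> R + 1" by simp
    have "Re (weyl_denom (U c)) = 0" by (simp add: weyl_denom_def)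
    then have "cmod (weyl_denom (U c)) = \<bar>Im (weyl_denom (U c))\<bar>" by (simp add: cmod_def)
    also have "Im (weyl_denom (U c)) = 2 * Im z * psi_energy c" unfolding psi_energy_def using Im_z by simp
    also have "\<bar>2 * Im z * psi_energy c\<bar> = 2 * \<bar>Im z\<bar> * psi_energy c" using c(3) by (simp add: abs_mult)
    finally have E: "cmod (weyl_denom (U c)) = 2 * \<bar>Im z\<bar> * psi_energy c" .
    have "weyl_radius (U c) = cmod (D c) / (2 * \<bar>Im z\<bar> * psi_energy c)"
      unfolding weyl_radius_def norm_divide E D_def by (simp add: phi_def psi_def column_def)
    moreover have "\<delta> \<le> cmod (D c) / (2 * \<bar>Im z\<bar> * psi_energy c)"
      unfolding \<delta>_def using D_ge pe c(3) Im_z \<kappa>0 S by (intro frac_le mult_left_mono mult_pos_pos) auto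
    ultimately show ?thesis by simp
  qed
  ultimately show ?thesis by blast
qed

lemma quotient_dim_all_square_integrable:
  assumes fin: "norm2 b w (psi U) < \<infinity>"
    and q: "quotient_dim {u \<in> solution_space b q w z. norm2 b w u < \<infinity>} {\<lambda>x. 0} n"
  shows "n = 2"
proof -
  obtain x where "x \<in> einterval 0 b" using psi_energy_eventually_positive by blast
  then obtain c where c: "continuity_point b q w c" using continuity_point_above by blast
  then have cI: "c \<in> einterval 0 b" unfolding continuity_point_def by blast
  have "y \<in> (\<lambda>u. u c) ` {u \<in> solution_space b q w z. norm2 b w u < \<infinity>}" for y
  proof -
    obtain a d where ad: "y = a *s phi U c + d *s psi U c"
      using linear_combination_exists[OF fundamental_det[OF c]] by blast
    let ?v = "\<lambda>x. a *s phi U x + d *s psi U x"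
    have v: "is_solution b q w z ?v" by (rule solution_linear(1)[OF phi_solution psi_solution])
    have "cut ?v \<in> {u \<in> solution_space b q w z. norm2 b w u < \<infinity>}"
      using cut_in_solution_space[OF v] norm2_cut[OF v] all_square_integrable[OF fin v] by simp
    moreover have "cut ?v c = y" using cI by (simp add: cut_def ad)
    ultimately show ?thesis by blast
  qed
  then have "(\<lambda>u. u c) ` {u \<in> solution_space b q w z. norm2 b w u < \<infinity>} = UNIV" by blast
  moreover have "vec.dim ((\<lambda>u. u c) ` {u \<in> solution_space b q w z. norm2 b w u < \<infinity>}) = n"
    by (rule quotient_dim_values[OF q _ z_regular c]) auto
  ultimately have "n = vec.dim (UNIV :: (complex^2) set)" by (simp only:)
  then show ?thesis by (simp only: vec_dim_card) simp
qed

text \<open>A solution independent of \<open>\<chi>\<^sub>m\<close> would combine with it to \<open>\<psi>\<close>.\<close>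

lemma quotient_dim_one:
  assumes inf: "\<not> norm2 b w (psi U) < \<infinity>" and m: "norm2 b w (weyl_solution U m) < \<infinity>"
    and q: "quotient_dim {u \<in> solution_space b q w z. norm2 b w u < \<infinity>} {\<lambda>x. 0} n"
  shows "n = 1"
proof -
  obtain x where "x \<in> einterval 0 b" using psi_energy_eventually_positive by blast
  then obtain c where c: "continuity_point b q w c" using continuity_point_above by blast
  then have cI: "c \<in> einterval 0 b" unfolding continuity_point_def by blast
  let ?V = "{u \<in> solution_space b q w z. norm2 b w u < \<infinity>}" and ?p = "weyl_solution U m c"
  have p0: "?p \<noteq> 0"
    using fundamental_det[OF c] unfolding linear_combination_vanishes_iff[symmetric] weyl_solution_eq
    by (metis zero_neq_one)
  have "vec.dim ((\<lambda>u. u c) ` ?V) = 1"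
  proof (rule vec.dim_unique[of "{?p}"])
    have V1: "cut (weyl_solution U m) \<in> ?V"
      using cut_in_solution_space[OF weyl_solution_solution] norm2_cut[OF weyl_solution_solution] m by simp
    have "?p = cut (weyl_solution U m) c" using cI by (simp add: cut_def)
    then have "?p \<in> (\<lambda>u. u c) ` ?V" by (rule image_eqI[OF _ V1])
    then show "{?p} \<subseteq> (\<lambda>u. u c) ` ?V" by blast
    show "(\<lambda>u. u c) ` ?V \<subseteq> vec.span {?p}"
    proof
      fix y assume "y \<in> (\<lambda>u. u c) ` ?V"
      then obtain u where u: "is_solution b q w z u" "norm2 b w u < \<infinity>" "y = u c"
        unfolding solution_space_def by blast
      obtain a d where ad: "\<And>x. x \<in> einterval 0 b \<Longrightarrow> u x = a *s phi U x + d *s psi U x"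
        using solution_span[OF u(1)] by blast
      have "d = a * m"
      proof (rule ccontr)
        assume ne: "d \<noteq> a * m"
        let ?k = "inverse (d - a * m)"
        have k: "?k * (d - a * m) = 1" using ne by simp
        let ?g = "\<lambda>x. ?k *s u x + (- ?k * a) *s weyl_solution U m x"
        have "norm2 b w ?g < \<infinity>"
          by (rule norm2_linear_finite[OF u(1) weyl_solution_solution u(2) m])
        moreover have "psi U x = ?g x" if "x \<in> einterval 0 b" for x
        proof -
          have "?g x = (?k * (d - a * m)) *s psi U x"
            unfolding ad[OF that] weyl_solution_def by (simp add: vec_eq_iff algebra_simps)
          then show ?thesis unfolding k by simp
        qed
        then have "norm2 b w ?g = norm2 b w (psi U)" by (rule norm2_cong[OF psi_solution])
        ultimately show False using inf by simp
      qed
      then have "y = a *s ?p" unfolding u(3) ad[OF cI] weyl_solution_def by (simp add: vec_eq_iff algebra_simps)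
      then show "y \<in> vec.span {?p}" by (auto intro: vec.span_scale vec.span_base)
    qed
    show "vec.independent {?p}" using p0 by (simp add: vec.dependent_single)
  qed simp
  moreover have "vec.dim ((\<lambda>u. u c) ` ?V) = n"
    by (rule quotient_dim_values[OF q _ z_regular c]) auto
  ultimately show ?thesis by simp
qed

text \<open>
  Equality of the deficiency indices is used once: if \<open>\<psi>\<close> is square-integrable, the dimension at
  \<open>z\<close> is two, hence also at \<open>cnj z\<close>, which provides the two solutions that keep the radii away
  from zero.
\<close>

lemma weyl_dichotomy:
  assumes q1: "quotient_dim {u \<in> solution_space b q w z. norm2 b w u < \<infinity>} {\<lambda>x. 0} n"
    and q2: "quotient_dim {u \<in> solution_space b q w (cnj z). norm2 b w u < \<infinity>} {\<lambda>x. 0} n"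
  shows "has_positive_radius (limit_disk b q w U) \<longleftrightarrow> norm2 b w (psi U) < \<infinity>"
    and "norm2 b w (psi U) < \<infinity> \<Longrightarrow> n = 2"
    and "(\<exists>m. limit_disk b q w U = {m}) \<longleftrightarrow> norm2 b w (psi U) = \<infinity>"
    and "limit_disk b q w U = {m} \<Longrightarrow> norm2 b w (weyl_solution U m) < \<infinity> \<and> n = 1"
proof -
  obtain x where x: "x \<in> einterval 0 b" using psi_energy_eventually_positive by blast
  obtain c L \<rho> where c: "\<And>n. continuity_point b q w (c n)" "\<And>n. x < c n"
    "\<And>n. 0 < psi_energy (c n)" "(\<lambda>n. weyl_radius (U (c n))) \<longlonglongrightarrow> \<rho>" "0 \<le> \<rho>"
    "limit_disk b q w U = cball L \<rho>"
    by (rule limit_disk_cball[OF x]) (rule that; assumption)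
  have n2: "n = 2" if "norm2 b w (psi U) < \<infinity>"
    by (rule quotient_dim_all_square_integrable[OF that q1])
  then show "norm2 b w (psi U) < \<infinity> \<Longrightarrow> n = 2" .
  have pos: "0 < \<rho>" if fin: "norm2 b w (psi U) < \<infinity>"
  proof -
    have "quotient_dim {u \<in> solution_space b q w (cnj z). norm2 b w u < \<infinity>} {\<lambda>x. 0} 2"
      using q2 n2[OF fin] by simp
    then obtain f :: "nat \<Rightarrow> real \<Rightarrow> complex^2" where
      f: "\<And>i. i < 2 \<Longrightarrow> f i \<in> {u \<in> solution_space b q w (cnj z). norm2 b w u < \<infinity>}"
      and ind: "\<And>a. (\<lambda>x. \<Sum>i<2. a i *s f i x) = (\<lambda>x. 0) \<Longrightarrow> \<forall>i<2. a i = 0"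
      unfolding quotient_dim_def by auto
    have f01: "is_solution b q w (cnj z) (f 0)" "is_solution b q w (cnj z) (f 1)"
      "norm2 b w (f 0) < \<infinity>" "norm2 b w (f 1) < \<infinity>"
      "\<And>x. x \<notin> einterval 0 b \<Longrightarrow> f 0 x = 0" "\<And>x. x \<notin> einterval 0 b \<Longrightarrow> f 1 x = 0"
      using f[of 0] f[of 1] unfolding solution_space_def by auto
    have "a = 0 \<and> d = 0" if *: "\<And>x. x \<in> einterval 0 b \<Longrightarrow> a *s f 0 x + d *s f 1 x = 0" for a d
    proof -
      have "(\<Sum>i<2. (if i = 0 then a else d) *s f i x) = 0" for x
        using *[of x] f01(5,6)[of x] by (cases "x \<in> einterval 0 b") (simp_all add: numeral_2_eq_2)
      then have "\<forall>i<(2::nat). (if i = 0 then a else d) = 0" by (intro ind) simp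
      from this[rule_format, of 0] this[rule_format, of 1] show ?thesis by simp
    qed
    from radius_bounded_below[OF f01(1-4) fin this x]
    obtain \<delta> where \<delta>: "0 < \<delta>" "\<And>c. continuity_point b q w c \<Longrightarrow> x < c \<Longrightarrow> 0 < psi_energy c \<Longrightarrow> \<delta> \<le> weyl_radius (U c)"
      by blast
    have "\<delta> \<le> \<rho>" by (rule LIMSEQ_le_const[OF c(4)]) (use \<delta>(2) c in auto)
    then show ?thesis using \<delta>(1) by simp
  qed
  show "has_positive_radius (limit_disk b q w U) \<longleftrightarrow> norm2 b w (psi U) < \<infinity>"
    using pos positive_radius_psi c(6) unfolding has_positive_radius_def by metis
  have single: "\<rho> = 0" if "limit_disk b q w U = {m}" for m
  proof -
    have "L \<in> limit_disk b q w U" "L + of_real \<rho> \<in> limit_disk b q w U"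
      unfolding c(6) using c(5) by (auto simp: dist_norm)
    then have "L + of_real \<rho> = L" unfolding that by simp
    then show ?thesis by simp
  qed
  have zero: "limit_disk b q w U = {L} \<and> norm2 b w (psi U) = \<infinity>" if "\<rho> = 0"
  proof -
    have "\<not> norm2 b w (psi U) < \<infinity>" using pos that by auto
    then show ?thesis using c(6) that by (simp add: not_less top.extremum_unique)
  qed
  have zero': "\<rho> = 0" if "norm2 b w (psi U) = \<infinity>"
    using positive_radius_psi[OF c(6)] c(5) that by (cases "\<rho> = 0") auto
  show "(\<exists>m. limit_disk b q w U = {m}) \<longleftrightarrow> norm2 b w (psi U) = \<infinity>"
    using single zero zero' by blast
  assume m: "limit_disk b q w U = {m}"
  then have "\<not> norm2 b w (psi U) < \<infinity>" using zero single by simp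
  moreover have "norm2 b w (weyl_solution U m) < \<infinity>"
    using m by (intro limit_disk_square_integrable) simp
  ultimately show "norm2 b w (weyl_solution U m) < \<infinity> \<and> n = 1" using quotient_dim_one[OF _ _ q1] by blast
qed

end

end


section \<open>The dichotomy\<close>

theorem theorem3p2:
  fixes b :: ereal
    and q w :: "real set \<Rightarrow> complex^2^2"
    and \<alpha> :: real
    and z :: complex
    and U :: "real \<Rightarrow> complex^2^2"
    and n_plus n_minus :: nat
  assumes "0 < b"
    and "local_measure b q" "hermitian_measure b q" "finite_near_0 b q"
    and "local_measure b w" "nonneg_measure b w" "finite_near_0 b w"
    and "\<exists>E \<in> local_sets b. w E \<noteq> 0"
    and "exceptional_set b q w \<noteq> UNIV"
    and "0 \<le> \<alpha>" "\<alpha> < pi"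
    and "z \<notin> \<real>"
    and "z \<notin> exceptional_set b q w"
    and "fundamental_matrix b q w \<alpha> z U"
    and "deficiency_index b q w {z. Im z > 0} n_plus"
    and "deficiency_index b q w {z. Im z < 0} n_minus"
    and "null_solutions b q w = {\<lambda>x. 0}"
    and "n_plus = n_minus"
  shows "(has_positive_radius (limit_disk b q w U) \<longleftrightarrow> norm2 b w (psi U) < \<infinity>)
    \<and> (norm2 b w (psi U) < \<infinity> \<longrightarrow>
         (\<forall>u. is_solution b q w z u \<longrightarrow> norm2 b w u < \<infinity>) \<and> n_plus = 2 \<and> n_minus = 2)
    \<and> ((\<exists>m. limit_disk b q w U = {m}) \<longleftrightarrow> norm2 b w (psi U) = \<infinity>)
    \<and> (\<forall>m. limit_disk b q w U = {m} \<longrightarrow>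
         norm2 b w (weyl_solution U m) < \<infinity> \<and> n_plus = 1 \<and> n_minus = 1)"
proof -
  obtain \<nu> Q W where "density_system b q w \<nu> Q W"
    using density_system_exists assms(1-7) by blast
  then interpret density_system b q w \<nu> Q W .
  have Im_z: "Im z \<noteq> 0" using \<open>z \<notin> \<real>\<close> by (simp add: complex_is_Real_iff)
  have q1: "quotient_dim {u \<in> solution_space b q w z. norm2 b w u < \<infinity>} {\<lambda>x. 0} n_plus"
    and q2: "quotient_dim {u \<in> solution_space b q w (cnj z). norm2 b w u < \<infinity>} {\<lambda>x. 0} n_plus"
    using assms(15-18) Im_z unfolding deficiency_index_def
    by (cases "0 < Im z"; simp)+
  note D = weyl_dichotomy[OF Im_z \<open>z \<notin> exceptional_set b q w\<close> \<open>fundamental_matrix b q w \<alpha> z U\<close>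
      \<open>null_solutions b q w = {\<lambda>x. 0}\<close> q1 q2]
  note A = all_square_integrable[OF Im_z \<open>z \<notin> exceptional_set b q w\<close> \<open>fundamental_matrix b q w \<alpha> z U\<close>
      \<open>null_solutions b q w = {\<lambda>x. 0}\<close>]
  show ?thesis
    using D(1,3) D(2) D(4) A \<open>n_plus = n_minus\<close> by metis
qed

end
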